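(* Let $\mathbb G$ be a homogeneous group and let $\Sigma\subset\mathbb G$ be a $C^1$ smooth embedded submanifold of topological dimension $n$ and degree $N$. Let $p\in\Sigma$ be an algebraically regular point of maximum degree $N$, with homogeneous tangent space $A_p\Sigma$. Assume that one of the following holds: (1) $p$ is a horizontal point; (2) $\mathbb G$ has step two; (3) $\Sigma$ is one dimensional; (4) $p$ is a transversal point. Let $\Sigma_p=p^{-1}\Sigma$, and let $\psi=(\psi_1,\dots,\psi_q):U\to\mathbb R^q$, together with the orthonormal graded basis $(e_1,\dots,e_q)$ and the integers $\alpha_j,\mu_j$ ($0\le j\le \iota$, $\mu_j=\alpha_1+\cdots+\alpha_j$) and $b_1,\dots,b_n$, be special coordinates of $\Sigma_p$ around the origin. Define the $C^1$ smooth homeomorphism $\eta:\mathbb R^n\to\mathbb R^n$ by $$\eta(t)=\Big(\frac{|t_1|^{b_1}}{b_1}\mathrm{sgn}(t_1),\dots,\frac{|t_n|^{b_n}}{b_n}\mathrm{sgn}(t_n)\Big),$$ the $C^1$ smooth mapping $\Gamma=\psi\circ\eta$ (defined near $0$), and the subset of indexes $I\subset\{1,\dots,q\}$ such that $$A_0\Sigma_p=\mathrm{span}\{e_l:l\in I\}=\mathrm{span}\{e_1,\dots,e_{\alpha_1},e_{m_1+1},\dots,e_{m_1+\alpha_2},\dots,e_{m_{\iota-1}+1},\dots,e_{m_{\iota-1}+\alpha_\iota}\}.$$ Then, as $t\to0$, for every $s=1,\dots,q$, $$\Gamma_s(t)=\begin{cases}\dfrac{|t_{s-m_{d_s-1}+\mu_{d_s-1}}|^{d_s}}{d_s}\,\mathrm{sgn}(t_{s-m_{d_s-1}+\mu_{d_s-1}})&\text{if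 }s\in I,\\[2mm] o(|t|^{d_s})&\text{if }s\notin I.\end{cases}$$
   Context: Homogeneous groups. A homogeneous group is a finite dimensional real vector space $\mathbb G=H^1\oplus\cdots\oplus H^\iota$, $H^\iota\neq\{0\}$, with a nilpotent Lie bracket satisfying $[H^i,H^j]\subset H^{i+j}$ ($H^k=\{0\}$ for $k>\iota$), with group law given by the Baker-Campbell-Hausdorff formula $xy=x+y+\frac12[x,y]+\cdots$ (so the identity is $0$ and $x^{-1}=-x$), and with the linear dilations $\delta_r$, $r>0$, $\delta_r x=r^ix$ for $x\in H^i$. The integer $\iota$ is the step. Put $q=\dim\mathbb G$, $h_j=\dim H^j$, $m_j=h_1+\cdots+h_j$, $m_0=0$. $\mathrm{Lie}(\mathbb G)$ is the Lie algebra of left invariant vector fields; $\mathbb G$ is identified with $T_0\mathbb G$, and then $\exp X=X(0)$. A scalar product on $\mathbb G$ making the $H^j$ mutually orthogonal is fixed. A graded basis is a basis $(e_1,\dots,e_q)$ of $\mathbb G$ such that $(e_i)_{m_{j-1}<i\le m_j}$ is a basis of $H^j$ for each $j$; put $d_i=j$ if $m_{j-1}<i\le m_j$. A homogeneous subgroup is a Lie subgroup that is a linear subspace invariant under all $\delta_r$. A horizontal subgroup is a homogeneous subgroup contained in $H^1$. A vertical subgroup is a homogeneous subgroup of the form $N_\ell\oplus H^{\ell+1}\oplus\cdots\oplus H^\iota$, with $\ell\in\{1,\dots,\iota\}$ and $N_\ell\subset H^\ell$ a linear subspace. Degree and homogeneous tangent space. Given an orthonormal graded basis, let $X_i\in\mathrm{Lie}(\mathbb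 G)$ with $X_i(0)=e_i$. For $I=(i_1<\cdots<i_k)$ put $X_I=X_{i_1}\wedge\cdots\wedge X_{i_k}$, $d(X_I)=d_{i_1}+\cdots+d_{i_k}$, and $\pi_M(\sum_I c_IX_I)=\sum_{d(X_I)=M}c_IX_I$. For $p\in\Sigma$ let $\xi$ be the left invariant $n$-vector field with $\xi(p)=t_1\wedge\cdots\wedge t_n$, $(t_i)$ a basis of $T_p\Sigma$. The pointwise degree is $d_\Sigma(p)=\max\{M:\pi_M(\xi)\neq0\}$; the degree of $\Sigma$ is $d(\Sigma)=\max_{p\in\Sigma}d_\Sigma(p)$; $p$ has maximum degree if $d_\Sigma(p)=d(\Sigma)$. With $M=d_\Sigma(p)$ let $\mathcal A_p\Sigma=\{X\in\mathrm{Lie}(\mathbb G):X\wedge\pi_M(\xi)=0\}$ and $A_p\Sigma=\exp\mathcal A_p\Sigma$ (homogeneous tangent space). The point $p$ is algebraically regular if $\mathcal A_p\Sigma$ is a Lie subalgebra. A horizontal (resp. transversal) point is an algebraically regular point whose $A_p\Sigma$ is a horizontal (resp. vertical) subgroup. Special coordinates around the origin. Let $\Sigma'$ be a $C^1$ smooth $n$-dimensional submanifold with $0\in\Sigma'$. Special coordinates consist of integers $0\le\alpha_j\le h_j$ ($j=1,\dots,\iota$) with $\sum_j\alpha_j=n$, an orthonormal graded basis $(e_1,\dots,e_q)$, a bounded open neighborhood $U\subset\mathbb R^n$ of $0$, and a $C^1$ smooth embedding $\Psi:U\to\Sigma'$, $\Psi(y)=\sum_{j=1}^q\psi_j(y)e_j$,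 $\psi=(\psi_1,\dots,\psi_q)$, with $\Psi(0)=0$, such that the following two properties hold. (a) Divide the $q$ rows of $D\psi(0)$ into consecutive blocks of sizes $h_1,\dots,h_\iota$ and its $n$ columns into consecutive blocks of sizes $\alpha_1,\dots,\alpha_\iota$; then the $(j,i)$ block is zero if $i<j$, equals the identity $I_{\alpha_j}$ on top of a zero $(h_j-\alpha_j)\times\alpha_j$ matrix if $i=j$, and has its first $\alpha_j$ rows zero (the last $h_j-\alpha_j$ rows being arbitrary) if $i>j$. (b) With $\mu_0=0$, $\mu_j=\alpha_1+\cdots+\alpha_j$, one has $\psi_s(y)=y_{s-m_{j-1}+\mu_{j-1}}$ on $U$ for $s=m_{j-1}+1,\dots,m_{j-1}+\alpha_j$ and $j=1,\dots,\iota$. Such coordinates always exist and the $\alpha_j$ are uniquely determined by $\Sigma'$. For $i=1,\dots,n$ the induced degree is $b_i=j$ if and only if $\mu_{j-1}<i\le\mu_j$. *)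

theory Defs
  imports "HOL-Analysis.Analysis" "HOL-Library.Landau_Symbols"
begin

section \<open>Maps and submanifolds of class C1\<close>

definition C1_on :: "'a::real_normed_vector set \<Rightarrow> ('a \<Rightarrow> 'b::real_normed_vector) \<Rightarrow> bool" where
  "C1_on U F \<longleftrightarrow>
     (\<exists>F' :: 'a \<Rightarrow> 'a \<Rightarrow>\<^sub>L 'b.
        (\<forall>x\<in>U. (F has_derivative blinfun_apply (F' x)) (at x)) \<and> continuous_on U F')"

text \<open>\<^const>\<open>C1_on\<close> and \<open>C1_embedding\<close> are only used on open sets.\<close>

definition C1_embedding ::
    "'a::real_normed_vector set \<Rightarrow> ('a \<Rightarrow> 'b::real_normed_vector) \<Rightarrow> bool" where
  "C1_embedding U F \<longleftrightarrow>
     C1_on U F \<and> (\<forall>y\<in>U. inj (frechet_derivative F (at y))) \<and> (\<exists>g. homeomorphism U (F ` U) F g)"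

definition C1_submanifold :: "nat \<Rightarrow> 'a::euclidean_space set \<Rightarrow> bool" where
  "C1_submanifold n S \<longleftrightarrow>
     (\<forall>p\<in>S. \<exists>V W F G L. open V \<and> p \<in> V \<and> open W \<and> homeomorphism V W F G \<and>
        C1_on V F \<and> C1_on W G \<and> subspace L \<and> dim L = n \<and> F ` (S \<inter> V) = L \<inter> (W :: 'a set))"

definition tangent_space :: "'a::real_normed_vector set \<Rightarrow> 'a \<Rightarrow> 'a set" where
  "tangent_space S p =
     {v. \<exists>\<epsilon>>0. \<exists>\<gamma>. C1_on {-\<epsilon><..<\<epsilon>} \<gamma> \<and> \<gamma> ` {-\<epsilon><..<\<epsilon>} \<subseteq> S \<and> \<gamma> 0 = p \<and>
        (\<gamma> has_vector_derivative v) (at (0::real))}"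


section \<open>Homogeneous groups\<close>

text \<open>
  The Baker-Campbell-Hausdorff series in Dynkin's form, truncated at total degree \<open>m\<close>. An entry
  \<open>(r, s)\<close> of a list stands for the factor \<open>x^r y^s\<close> of a word, and a word \<open>w1 \<dots> wk\<close> is evaluated
  as the right-nested bracket \<open>[w1, [w2, \<dots>, wk]]\<close>. For a bracket that is nilpotent of step \<open>\<le> m\<close>
  nothing is lost by the truncation.
\<close>

fun nested_bracket :: "('a \<Rightarrow> 'a \<Rightarrow> 'a) \<Rightarrow> 'a::real_vector list \<Rightarrow> 'a" where
  "nested_bracket br [] = 0"
| "nested_bracket br [v] = v"
| "nested_bracket br (v # w # ws) = br v (nested_bracket br (w # ws))"

definition dynkin_word :: "'a \<Rightarrow> 'a \<Rightarrow> (nat \<times> nat) list \<Rightarrow> 'a list" where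
  "dynkin_word x y rs = concat (map (\<lambda>(r, s). replicate r x @ replicate s y) rs)"

definition dynkin_degree :: "(nat \<times> nat) list \<Rightarrow> nat" where
  "dynkin_degree rs = (\<Sum>(r, s)\<leftarrow>rs. r + s)"

definition dynkin_coeff :: "(nat \<times> nat) list \<Rightarrow> real" where
  "dynkin_coeff rs =
     (- 1) ^ (length rs - 1) / real (length rs) / real (dynkin_degree rs) /
     (\<Prod>(r, s)\<leftarrow>rs. fact r * fact s)"

definition dynkin_index :: "nat \<Rightarrow> (nat \<times> nat) list set" where
  "dynkin_index m =
     {rs. rs \<noteq> [] \<and> (\<forall>(r, s)\<in>set rs. 0 < r + s) \<and> dynkin_degree rs \<le> m}"

definition bch :: "('a \<Rightarrow> 'a \<Rightarrow> 'a) \<Rightarrow> nat \<Rightarrow> 'a \<Rightarrow> 'a \<Rightarrow> 'a::real_vector" where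
  "bch br m x y =
     (\<Sum>rs\<in>dynkin_index m. dynkin_coeff rs *\<^sub>R nested_bracket br (dynkin_word x y rs))"

lemma finite_dynkin_index: "finite (dynkin_index m)"
proof -
  have len: "length rs \<le> dynkin_degree rs" if "\<forall>(r, s)\<in>set rs. 0 < r + s" for rs
    using that by (induction rs) (auto simp: dynkin_degree_def)
  have ent: "r \<le> dynkin_degree rs \<and> s \<le> dynkin_degree rs" if "(r, s) \<in> set rs" for r s rs
    using that by (induction rs) (auto simp: dynkin_degree_def)
  have "dynkin_index m \<subseteq> {rs. set rs \<subseteq> {..m} \<times> {..m} \<and> length rs \<le> m}"
  proof
    fix rs assume rs: "rs \<in> dynkin_index m"
    then have "length rs \<le> m" "dynkin_degree rs \<le> m"
      using len[of rs] by (auto simp: dynkin_index_def)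
    moreover have "r \<le> m \<and> s \<le> m" if "(r, s) \<in> set rs" for r s
      using ent[OF that] \<open>dynkin_degree rs \<le> m\<close> by linarith
    ultimately show "rs \<in> {rs. set rs \<subseteq> {..m} \<times> {..m} \<and> length rs \<le> m}" by auto
  qed
  then show ?thesis
    by (rule finite_subset) (rule finite_lists_length_le, simp)
qed

text \<open>
  The scalar product is that of the ambient type; since the layers \<open>H j\<close> are mutually orthogonal,
  their sum is direct as soon as they span. The bracket is nilpotent of step \<open>\<le> \<iota>\<close> because it
  respects the grading. That the Baker-Campbell-Hausdorff polynomial is a group law with identity
  \<open>0\<close> and inverse \<open>-x\<close> is a property of every nilpotent Lie algebra (so no structure is
  excluded by listing it); the group law \<open>gmul\<close> is part of the data.
\<close>

locale homogeneous_group =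
  fixes br :: "'a::euclidean_space \<Rightarrow> 'a \<Rightarrow> 'a"
    and H :: "nat \<Rightarrow> 'a set"
    and \<iota> :: nat
    and gmul :: "'a \<Rightarrow> 'a \<Rightarrow> 'a"
  assumes bracket_bilinear: "bilinear br"
    and bracket_alternating: "br x x = 0"
    and bracket_jacobi: "br x (br y z) + br y (br z x) + br z (br x y) = 0"
    and step_pos: "1 \<le> \<iota>"
    and layer_subspace: "1 \<le> j \<Longrightarrow> subspace (H j)"
    and layer_above_step: "\<iota> < j \<Longrightarrow> H j = {0}"
    and layer_top: "H \<iota> \<noteq> {0}"
    and layers_span: "span (\<Union>j\<in>{1..\<iota>}. H j) = UNIV"
    and layers_orthogonal:
      "1 \<le> i \<Longrightarrow> 1 \<le> j \<Longrightarrow> i \<noteq> j \<Longrightarrow> x \<in> H i \<Longrightarrow> y \<in> H j \<Longrightarrow> x \<bullet> y = 0"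
    and bracket_graded:
      "1 \<le> i \<Longrightarrow> 1 \<le> j \<Longrightarrow> x \<in> H i \<Longrightarrow> y \<in> H j \<Longrightarrow> br x y \<in> H (i + j)"
    and group_law: "group gmul 0 uminus"
    and group_law_bch: "gmul x y = bch br \<iota> x y"

definition dilation :: "(nat \<Rightarrow> 'a::euclidean_space set) \<Rightarrow> nat \<Rightarrow> real \<Rightarrow> 'a \<Rightarrow> 'a" where
  "dilation H \<iota> r =
     (THE \<delta>. linear \<delta> \<and> (\<forall>i\<in>{1..\<iota>}. \<forall>x\<in>H i. \<delta> x = r ^ i *\<^sub>R x))"

definition homogeneous_subgroup ::
    "(nat \<Rightarrow> 'a::euclidean_space set) \<Rightarrow> nat \<Rightarrow> ('a \<Rightarrow> 'a \<Rightarrow> 'a) \<Rightarrow> 'a set \<Rightarrow> bool" where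
  "homogeneous_subgroup H \<iota> gmul S \<longleftrightarrow>
     0 \<in> S \<and> (\<forall>x\<in>S. \<forall>y\<in>S. gmul x y \<in> S) \<and> (\<forall>x\<in>S. - x \<in> S) \<and>
     subspace S \<and> (\<forall>r>0. dilation H \<iota> r ` S \<subseteq> S)"

definition horizontal_subgroup ::
    "(nat \<Rightarrow> 'a::euclidean_space set) \<Rightarrow> nat \<Rightarrow> ('a \<Rightarrow> 'a \<Rightarrow> 'a) \<Rightarrow> 'a set \<Rightarrow> bool" where
  "horizontal_subgroup H \<iota> gmul S \<longleftrightarrow> homogeneous_subgroup H \<iota> gmul S \<and> S \<subseteq> H 1"

definition vertical_subgroup ::
    "(nat \<Rightarrow> 'a::euclidean_space set) \<Rightarrow> nat \<Rightarrow> ('a \<Rightarrow> 'a \<Rightarrow> 'a) \<Rightarrow> 'a set \<Rightarrow> bool" where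
  "vertical_subgroup H \<iota> gmul S \<longleftrightarrow> homogeneous_subgroup H \<iota> gmul S \<and>
     (\<exists>l\<in>{1..\<iota>}. \<exists>N. subspace N \<and> N \<subseteq> H l \<and>
        S = {x + y | x y. x \<in> N \<and> y \<in> span (\<Union>j\<in>{l+1..\<iota>}. H j)})"


section \<open>Graded bases\<close>

definition partial_sum :: "(nat \<Rightarrow> nat) \<Rightarrow> nat \<Rightarrow> nat" where
  "partial_sum c j = (\<Sum>i=1..j. c i)"

text \<open>The number of the block containing \<open>i\<close>, for consecutive blocks of sizes \<open>c 1, c 2, \<dots>\<close>; it
  gives both the degrees \<open>d_i\<close> (\<open>c = h\<close>) and the induced degrees \<open>b_i\<close> (\<open>c = \<alpha>\<close>).\<close>

definition block :: "(nat \<Rightarrow> nat) \<Rightarrow> nat \<Rightarrow> nat" where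
  "block c i = (THE j. 1 \<le> j \<and> partial_sum c (j - 1) < i \<and> i \<le> partial_sum c j)"

abbreviation layer_dim :: "(nat \<Rightarrow> 'a::euclidean_space set) \<Rightarrow> nat \<Rightarrow> nat" where
  "layer_dim H j \<equiv> dim (H j)"

abbreviation layer_sum :: "(nat \<Rightarrow> 'a::euclidean_space set) \<Rightarrow> nat \<Rightarrow> nat" where
  "layer_sum H \<equiv> partial_sum (layer_dim H)"

abbreviation index_degree :: "(nat \<Rightarrow> 'a::euclidean_space set) \<Rightarrow> nat \<Rightarrow> nat" where
  "index_degree H \<equiv> block (layer_dim H)"

definition orthonormal_graded_basis ::
    "(nat \<Rightarrow> 'a::euclidean_space set) \<Rightarrow> nat \<Rightarrow> (nat \<Rightarrow> 'a) \<Rightarrow> bool" where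
  "orthonormal_graded_basis H \<iota> e \<longleftrightarrow>
     (\<forall>i\<in>{1..DIM('a)}. \<forall>j\<in>{1..DIM('a)}. e i \<bullet> e j = (if i = j then 1 else 0)) \<and>
     span (e ` {1..DIM('a)}) = UNIV \<and>
     (\<forall>j\<in>{1..\<iota>}. span (e ` {layer_sum H (j - 1)<..layer_sum H j}) = H j)"


section \<open>Left invariant vector fields and multivectors\<close>

definition left_invariant_fields ::
    "('a \<Rightarrow> 'a \<Rightarrow> 'a) \<Rightarrow> ('a::real_normed_vector \<Rightarrow> 'a) set" where
  "left_invariant_fields gmul =
     {X. \<forall>p x. X (gmul p x) = frechet_derivative (gmul p) (at x) (X x)}"

definition field_bracket ::
    "('a::real_normed_vector \<Rightarrow> 'a) \<Rightarrow> ('a \<Rightarrow> 'a) \<Rightarrow> 'a \<Rightarrow> 'a" where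
  "field_bracket X Y p = frechet_derivative Y (at p) (X p) - frechet_derivative X (at p) (Y p)"

text \<open>
  A left invariant multivector field is represented by its value at the identity, and a
  \<open>k\<close>-vector at the identity by the alternating form on \<open>k\<close>-tuples (indexed by \<open>1, \<dots>, k\<close>) of
  (co)vectors obtained from the scalar product: \<open>v_1 \<and> \<dots> \<and> v_k\<close> is the form
  \<open>(w_1, \<dots>, w_k) \<mapsto> det (v_i \<bullet> w_j)\<close>. The function \<open>vec_wedge k x \<zeta>\<close> is \<open>x \<and> \<zeta>\<close> for a
  \<open>k\<close>-vector \<open>\<zeta>\<close>, by expansion of the determinant along the first row.
\<close>

type_synonym 'a multivector = "(nat \<Rightarrow> 'a) \<Rightarrow> real"

definition wedge :: "nat \<Rightarrow> (nat \<Rightarrow> 'a) \<Rightarrow> 'a::real_inner multivector" where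
  "wedge k v = (\<lambda>w. \<Sum>\<sigma> | \<sigma> permutes {1..k}. of_int (sign \<sigma>) * (\<Prod>i=1..k. v i \<bullet> w (\<sigma> i)))"

definition vec_wedge :: "nat \<Rightarrow> 'a::real_inner \<Rightarrow> 'a multivector \<Rightarrow> 'a multivector" where
  "vec_wedge k x \<zeta> =
     (\<lambda>w. \<Sum>j=1..k+1. (- 1) ^ (j + 1) * (x \<bullet> w j) * \<zeta> (\<lambda>i. if i < j then w i else w (i + 1)))"

definition select :: "(nat \<Rightarrow> 'a) \<Rightarrow> nat set \<Rightarrow> nat \<Rightarrow> 'a" where
  "select e I = (\<lambda>i. e (sorted_list_of_set I ! (i - 1)))"

text \<open>
  For an orthonormal graded basis \<open>e\<close> the \<open>X_I = wedge n (select e I)\<close> satisfy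
  \<open>X_I (select e J) = \<delta>_IJ\<close>, so the coefficient of \<open>X_I\<close> in an \<open>n\<close>-vector \<open>\<xi>\<close> is
  \<open>\<xi> (select e I)\<close>.
\<close>

definition degree_part ::
    "(nat \<Rightarrow> 'a::euclidean_space set) \<Rightarrow> (nat \<Rightarrow> 'a) \<Rightarrow> nat \<Rightarrow> nat \<Rightarrow> 'a multivector \<Rightarrow> 'a multivector" where
  "degree_part H e n M \<xi> =
     (\<lambda>w. \<Sum>I | I \<subseteq> {1..DIM('a)} \<and> card I = n \<and> (\<Sum>i\<in>I. index_degree H i) = M.
            \<xi> (select e I) * wedge n (select e I) w)"


section \<open>Degree and homogeneous tangent space\<close>

text \<open>The \<open>n\<close>-vector depends on the chosen basis of the tangent space only up to a nonzero factor.\<close>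

definition tangent_multivector ::
    "('a \<Rightarrow> 'a \<Rightarrow> 'a) \<Rightarrow> nat \<Rightarrow> 'a set \<Rightarrow> 'a \<Rightarrow> 'a::euclidean_space multivector" where
  "tangent_multivector gmul n S p =
     (SOME \<xi>. \<exists>X. (\<forall>i\<in>{1..n}. X i \<in> left_invariant_fields gmul) \<and>
        inj_on (\<lambda>i. X i p) {1..n} \<and> independent ((\<lambda>i. X i p) ` {1..n}) \<and>
        span ((\<lambda>i. X i p) ` {1..n}) = tangent_space S p \<and>
        \<xi> = wedge n (\<lambda>i. X i 0))"

definition pointwise_degree ::
    "('a \<Rightarrow> 'a \<Rightarrow> 'a) \<Rightarrow> (nat \<Rightarrow> 'a set) \<Rightarrow> (nat \<Rightarrow> 'a) \<Rightarrow> nat \<Rightarrow> 'a::euclidean_space set \<Rightarrow> 'a \<Rightarrow> nat" where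
  "pointwise_degree gmul H e n S p =
     Max {M. degree_part H e n M (tangent_multivector gmul n S p) \<noteq> (\<lambda>w. 0)}"

definition submanifold_degree ::
    "('a \<Rightarrow> 'a \<Rightarrow> 'a) \<Rightarrow> (nat \<Rightarrow> 'a set) \<Rightarrow> (nat \<Rightarrow> 'a) \<Rightarrow> nat \<Rightarrow> 'a::euclidean_space set \<Rightarrow> nat" where
  "submanifold_degree gmul H e n S = Max (pointwise_degree gmul H e n S ` S)"

definition tangent_fields ::
    "('a \<Rightarrow> 'a \<Rightarrow> 'a) \<Rightarrow> (nat \<Rightarrow> 'a set) \<Rightarrow> (nat \<Rightarrow> 'a) \<Rightarrow> nat \<Rightarrow> 'a::euclidean_space set \<Rightarrow> 'a \<Rightarrow> ('a \<Rightarrow> 'a) set" where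
  "tangent_fields gmul H e n S p =
     {X \<in> left_invariant_fields gmul.
        vec_wedge n (X 0)
          (degree_part H e n (pointwise_degree gmul H e n S p) (tangent_multivector gmul n S p))
        = (\<lambda>w. 0)}"

definition homogeneous_tangent_space ::
    "('a \<Rightarrow> 'a \<Rightarrow> 'a) \<Rightarrow> (nat \<Rightarrow> 'a set) \<Rightarrow> (nat \<Rightarrow> 'a) \<Rightarrow> nat \<Rightarrow> 'a::euclidean_space set \<Rightarrow> 'a \<Rightarrow> 'a set" where
  "homogeneous_tangent_space gmul H e n S p = (\<lambda>X. X 0) ` tangent_fields gmul H e n S p"

text \<open>\<^const>\<open>tangent_fields\<close> is always a linear space of fields, so that being a Lie subalgebra means
  being closed under the bracket.\<close>

definition algebraically_regular ::
    "('a \<Rightarrow> 'a \<Rightarrow> 'a) \<Rightarrow> (nat \<Rightarrow> 'a set) \<Rightarrow> (nat \<Rightarrow> 'a) \<Rightarrow> nat \<Rightarrow> 'a::euclidean_space set \<Rightarrow> 'a \<Rightarrow> bool" where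
  "algebraically_regular gmul H e n S p \<longleftrightarrow>
     (\<forall>X\<in>tangent_fields gmul H e n S p. \<forall>Y\<in>tangent_fields gmul H e n S p.
        field_bracket X Y \<in> tangent_fields gmul H e n S p)"

definition horizontal_point ::
    "('a \<Rightarrow> 'a \<Rightarrow> 'a) \<Rightarrow> (nat \<Rightarrow> 'a set) \<Rightarrow> nat \<Rightarrow> (nat \<Rightarrow> 'a) \<Rightarrow> nat \<Rightarrow> 'a::euclidean_space set \<Rightarrow> 'a \<Rightarrow> bool" where
  "horizontal_point gmul H \<iota> e n S p \<longleftrightarrow>
     algebraically_regular gmul H e n S p \<and>
     horizontal_subgroup H \<iota> gmul (homogeneous_tangent_space gmul H e n S p)"

definition transversal_point ::
    "('a \<Rightarrow> 'a \<Rightarrow> 'a) \<Rightarrow> (nat \<Rightarrow> 'a set) \<Rightarrow> nat \<Rightarrow> (nat \<Rightarrow> 'a) \<Rightarrow> nat \<Rightarrow> 'a::euclidean_space set \<Rightarrow> 'a \<Rightarrow> bool" where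
  "transversal_point gmul H \<iota> e n S p \<longleftrightarrow>
     algebraically_regular gmul H e n S p \<and>
     vertical_subgroup H \<iota> gmul (homogeneous_tangent_space gmul H e n S p)"


section \<open>Special coordinates around the origin\<close>

text \<open>
  The coordinates \<open>y_1, \<dots>, y_n\<close> of \<open>y :: real^'n\<close> are \<open>y $ idx 1, \<dots>, y $ idx n\<close>, where \<open>idx\<close> is
  a bijection from \<open>{1..n}\<close> onto the index type.
\<close>

definition partial_deriv :: "(nat \<Rightarrow> 'n) \<Rightarrow> nat \<Rightarrow> (real^'n::finite \<Rightarrow> real) \<Rightarrow> real^'n \<Rightarrow> real" where
  "partial_deriv idx i g y = frechet_derivative g (at y) (axis (idx i) 1)"

definition special_coordinates ::
    "(nat \<Rightarrow> 'a::euclidean_space set) \<Rightarrow> nat \<Rightarrow> (nat \<Rightarrow> 'n) \<Rightarrow> 'a set \<Rightarrow>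
     (nat \<Rightarrow> nat) \<Rightarrow> (nat \<Rightarrow> 'a) \<Rightarrow> (real^'n::finite) set \<Rightarrow> (nat \<Rightarrow> real^'n \<Rightarrow> real) \<Rightarrow> bool" where
  "special_coordinates H \<iota> idx S \<alpha> e U \<psi> \<longleftrightarrow>
     (let m = layer_sum H; \<mu> = partial_sum \<alpha>; \<Psi> = (\<lambda>y. \<Sum>j=1..DIM('a). \<psi> j y *\<^sub>R e j) in
      (\<forall>j\<in>{1..\<iota>}. \<alpha> j \<le> layer_dim H j) \<and> (\<Sum>j=1..\<iota>. \<alpha> j) = CARD('n) \<and>
      orthonormal_graded_basis H \<iota> e \<and>
      open U \<and> bounded U \<and> 0 \<in> U \<and> C1_embedding U \<Psi> \<and> \<Psi> ` U \<subseteq> S \<and> \<Psi> 0 = 0 \<and>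
      \<comment> \<open>row \<open>r\<close> and column \<open>c\<close> of the \<open>(j, i)\<close> block of the Jacobian matrix at the origin\<close>
      (\<forall>j\<in>{1..\<iota>}. \<forall>i\<in>{1..\<iota>}. \<forall>r\<in>{1..layer_dim H j}. \<forall>c\<in>{1..\<alpha> i}.
         let D = partial_deriv idx (\<mu> (i - 1) + c) (\<psi> (m (j - 1) + r)) 0 in
           (i < j \<longrightarrow> D = 0) \<and>
           (i = j \<longrightarrow> D = (if r = c then 1 else 0)) \<and>
           (i > j \<longrightarrow> r \<le> \<alpha> j \<longrightarrow> D = 0)) \<and>
      (\<forall>j\<in>{1..\<iota>}. \<forall>s\<in>{m (j - 1) + 1..m (j - 1) + \<alpha> j}. \<forall>y\<in>U.
         \<psi> s y = y $ idx (s - m (j - 1) + \<mu> (j - 1))))"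

definition homogeneous_reparam ::
    "(nat \<Rightarrow> 'n) \<Rightarrow> (nat \<Rightarrow> nat) \<Rightarrow> real^'n::finite \<Rightarrow> real^'n" where
  "homogeneous_reparam idx b t =
     (\<Sum>i=1..CARD('n). (\<bar>t $ idx i\<bar> ^ b i / real (b i) * sgn (t $ idx i)) *\<^sub>R axis (idx i) 1)"

definition special_indices :: "(nat \<Rightarrow> 'a::euclidean_space set) \<Rightarrow> nat \<Rightarrow> (nat \<Rightarrow> nat) \<Rightarrow> nat set" where
  "special_indices H \<iota> \<alpha> = (\<Union>j\<in>{1..\<iota>}. {layer_sum H (j - 1) + 1..layer_sum H (j - 1) + \<alpha> j})"

end

theory Submission
  imports Defs "Jordan_Normal_Form.Determinant"
begin

text \<open>
  Since the degree is maximal at \<open>p\<close>, the left translated tangent spaces of \<open>p\<^sup>-\<^sup>1\<Sigma>\<close> near the origin are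
  graphs over \<open>span {e l | l \<in> I}\<close> in which a direction of degree \<open>j\<close> contributes nothing to the
  coordinates of degree greater than \<open>j\<close>. Along the curves \<open>\<tau> \<mapsto> \<Psi> (\<tau>\<^sup>b \<eta> t)\<close>, \<open>0 \<le> \<tau> \<le> 1\<close>, the
  coordinates in \<open>I\<close> are prescribed, and the graph property turns the structure of the left
  invariant fields, \<open>d L\<^sub>x v = v + 1/2 [x, v] + \<dots>\<close>, into a bootstrap on the order of vanishing of all
  coordinates. The coordinates outside \<open>I\<close> are of smaller order than their degree because the
  homogeneous tangent space is a subalgebra.
\<close>

no_notation scalar_prod (infix "\<bullet>" 70)
no_notation Matrix.vec_index (infixl "$" 100)
unbundle no m_inv_syntax

section \<open>Determinants and multivectors\<close>

text \<open>\<open>\<Psi>\<close> is only of class C1, so a Taylor expansion stops at first order,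
  while vanishing of orders up to \<iota> is claimed. The higher orders come from integrating a
  first order relation for the velocity, each integration using the orders already known. The
  estimates have to be uniform along the curves; Landau symbols are therefore taken along the filter
  t \<rightarrow> 0 times the principal filter of [0, 1].

  Maximality of the degree enters through determinants: a component of too high a degree in one
  vector of a frame of the left translated tangent space would give the tangent multivector a
  nonzero coefficient of degree greater than N. The coefficients of the graph are merely continuous;
  those between equal degrees vanish at the origin by the shape of the Jacobian matrix, and this is
  one source of the small o. Since the tangent multivector is defined by an arbitrary choice, it is
  compared with the wedge of an explicit frame, up to a nonzero factor.\<close>

lemma wedge_eq_det:
  "wedge n v w = Determinant.det (mat n n (\<lambda>(i, j). v (Suc i) \<bullet> w (Suc j)))"
proof -
  \<comment> \<open>\<open>wedge\<close> counts from 1 and matrices count from 0; conjugation by the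
    shift keeps signs. In matrix form the product rule and the Laplace expansion are
    available.\<close>
  let ?\<phi> = "map_permutation {1..n} (\<lambda>i. i - 1)"
  let ?\<psi> = "map_permutation {0..<n} Suc"
  have inj: "inj_on (\<lambda>i. i - 1) {1..n}" "inj_on Suc {0..<n}"
    by (auto simp: inj_on_def)
  have im: "(\<lambda>i. i - 1) ` {1..n} = {0..<n}" "Suc ` {0..<n} = {1..n}"
    by (force simp: image_iff Bex_def)+
  have per: "?\<psi> p permutes {1..n}" if "p permutes {0..<n}" for p
    using map_permutation_permutes[of Suc "{0..<n}" "{1..n}" p] inj im that
    by (simp add: bij_betw_def)
  have per': "?\<phi> p permutes {0..<n}" if "p permutes {1..n}" for p
    using map_permutation_permutes[of "\<lambda>i. i - 1" "{1..n}" "{0..<n}" p] inj im that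
    by (simp add: bij_betw_def)
  have "Determinant.det (mat n n (\<lambda>(i, j). v (Suc i) \<bullet> w (Suc j))) =
    (\<Sum>p\<in>{p. p permutes {0..<n}}. of_int (sign p) * (\<Prod>i=0..<n. v (Suc i) \<bullet> w (Suc (p i))))"
    by (subst det_def'[of _ n]) (auto intro!: sum.cong prod.cong simp: permutes_in_image[of _ "{0..<n}", simplified])
  also have "\<dots> = wedge n v w"
    unfolding wedge_def
  proof (rule sum.reindex_bij_witness[of _ ?\<phi> ?\<psi>])
    fix p assume p: "p \<in> {p. p permutes {0..<n}}"
    show "?\<phi> (?\<psi> p) = p"
      by (subst map_permutation_compose_inv[of Suc "{0..<n}" "{1..n}"])
         (use p inj im in \<open>auto simp: bij_betw_def\<close>)
    show "?\<psi> p \<in> {q. q permutes {1..n}}" using per p by auto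
    have s: "sign (?\<psi> p) = sign p" using p inj by (intro sign_map_permutation) auto
    have "(\<Prod>i=1..n. v i \<bullet> w (?\<psi> p i)) = (\<Prod>i=0..<n. v (Suc i) \<bullet> w (?\<psi> p (Suc i)))"
      by (rule prod.reindex_bij_witness[of _ Suc "\<lambda>i. i - 1"]) auto
    also have "\<dots> = (\<Prod>i=0..<n. v (Suc i) \<bullet> w (Suc (p i)))"
      using p inj by (intro prod.cong) (auto simp: map_permutation_apply)
    finally show "real_of_int (sign (?\<psi> p)) * (\<Prod>i=1..n. v i \<bullet> w (?\<psi> p i)) =
        of_int (sign p) * (\<Prod>i=0..<n. v (Suc i) \<bullet> w (Suc (p i)))"
      using s by simp
  next
    fix p assume p: "p \<in> {q. q permutes {1..n}}"
    show "?\<psi> (?\<phi> p) = p"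
      by (subst map_permutation_compose_inv[of "\<lambda>i. i - 1" "{1..n}" "{0..<n}"])
         (use p inj im in \<open>auto simp: bij_betw_def\<close>)
    show "?\<phi> p \<in> {p. p permutes {0..<n}}" using per' p by auto
  qed
  finally show ?thesis by simp
qed

text \<open>Invariance of the determinant under transposition. Through it, facts about the arguments
  \<open>w\<close> of the form apply to the vectors \<open>v\<close> as well.\<close>

lemma wedge_commute: "wedge n v w = wedge n w v"
proof -
  have "wedge n v w =
    (\<Sum>q | q permutes {1..n}. of_int (sign (inv q)) * (\<Prod>i=1..n. v i \<bullet> w (inv q i)))"
    unfolding wedge_def by (rule sum_permutations_inverse)
  also have "\<dots> = wedge n w v"
    unfolding wedge_def
  proof (intro sum.cong refl)
    fix q assume "q \<in> {q. q permutes {1..n}}"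
    then have q: "q permutes {1..n}" by simp
    have "(\<Prod>i=1..n. v i \<bullet> w (inv q i)) = (\<Prod>i=1..n. v (q i) \<bullet> w (inv q (q i)))"
      by (rule prod.permute[OF q, unfolded o_def])
    also have "\<dots> = (\<Prod>i=1..n. w i \<bullet> v (q i))"
      using permutes_inverses[OF q] by (simp add: inner_commute)
    finally show "real_of_int (sign (inv q)) * (\<Prod>i=1..n. v i \<bullet> w (inv q i)) =
        of_int (sign q) * (\<Prod>i=1..n. w i \<bullet> v (q i))"
      using q by (simp add: sign_inverse permutation_permutes[THEN iffD2] exI[of _ "{1..n}"])
  qed
  finally show ?thesis .
qed

text \<open>A multivector is a function of infinite sequences, so the last clause has to say that
  entries outside {1..n} do not matter.\<close>

definition alternating_form :: "nat \<Rightarrow> 'a::real_vector multivector \<Rightarrow> bool" where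
  "alternating_form n D \<longleftrightarrow>
     (\<forall>w. \<forall>i\<in>{1..n}. linear (\<lambda>x. D (w(i := x)))) \<and>
     (\<forall>w q. q permutes {1..n} \<longrightarrow> D (w \<circ> q) = of_int (sign q) * D w) \<and>
     (\<forall>w w'. (\<forall>i\<in>{1..n}. w i = w' i) \<longrightarrow> D w = D w')"

lemma alternating_form_wedge: "alternating_form n (wedge n v)"
  unfolding alternating_form_def
proof (intro conjI allI ballI impI)
  fix w :: "nat \<Rightarrow> 'a" and i assume i: "i \<in> {1..n}"
  \<comment> \<open>In each term \<open>x\<close> occurs in exactly one factor, the one at position
    \<open>inv q i\<close>; isolating it makes linearity visible.\<close>
  have eq: "wedge n v (w(i := x)) = (\<Sum>q | q permutes {1..n}. of_int (sign q) *
      ((v (inv q i) \<bullet> x) * (\<Prod>k\<in>{1..n} - {inv q i}. v k \<bullet> w (q k))))" for x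
    unfolding wedge_def
  proof (intro sum.cong refl)
    fix q assume "q \<in> {q. q permutes {1..n}}"
    then have q: "q permutes {1..n}" by simp
    have "inv q i \<in> {1..n}" using permutes_in_image[OF permutes_inv[OF q]] i by blast
    then have "(\<Prod>k=1..n. v k \<bullet> (w(i := x)) (q k)) =
      (v (inv q i) \<bullet> (w(i := x)) (q (inv q i))) *
      (\<Prod>k\<in>{1..n} - {inv q i}. v k \<bullet> (w(i := x)) (q k))"
      by (intro prod.remove) auto
    also have "(\<Prod>k\<in>{1..n} - {inv q i}. v k \<bullet> (w(i := x)) (q k)) =
       (\<Prod>k\<in>{1..n} - {inv q i}. v k \<bullet> w (q k))"
      using permutes_inverses[OF q] by (intro prod.cong) auto
    finally show "real_of_int (sign q) * (\<Prod>k=1..n. v k \<bullet> (w(i := x)) (q k)) =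
      of_int (sign q) * ((v (inv q i) \<bullet> x) * (\<Prod>k\<in>{1..n} - {inv q i}. v k \<bullet> w (q k)))"
      using permutes_inverses[OF q] by simp
  qed
  show "linear (\<lambda>x. wedge n v (w(i := x)))"
    unfolding eq
    by (rule linearI) (simp_all add: inner_add_right algebra_simps sum.distrib sum_distrib_left)
next
  fix w :: "nat \<Rightarrow> 'a" and \<pi> assume \<pi>: "\<pi> permutes {1..n}"
  have p: "permutation q" if "q permutes {1..n}" for q
    using that by (auto simp: permutation_permutes)
  have "of_int (sign \<pi>) * wedge n v w =
     (\<Sum>q | q permutes {1..n}. of_int (sign \<pi>) * (of_int (sign (\<pi> \<circ> q)) * (\<Prod>i=1..n. v i \<bullet> w ((\<pi> \<circ> q) i))))"
    unfolding wedge_def sum_distrib_left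
    by (rule setum_permutations_compose_left[OF \<pi>])
  also have "\<dots> = wedge n v (w \<circ> \<pi>)"
    unfolding wedge_def using \<pi>
    by (intro sum.cong) (auto simp: sign_compose p sign_idempotent simp flip: of_int_mult mult.assoc)
  finally show "wedge n v (w \<circ> \<pi>) = of_int (sign \<pi>) * wedge n v w" by simp
next
  fix w w' :: "nat \<Rightarrow> 'a" assume eq: "\<forall>i\<in>{1..n}. w i = w' i"
  show "wedge n v w = wedge n v w'"
    unfolding wedge_def
  proof (intro sum.cong refl)
    fix q assume "q \<in> {q. q permutes {1..n}}"
    then have "(\<Prod>i=1..n. v i \<bullet> w (q i)) = (\<Prod>i=1..n. v i \<bullet> w' (q i))"
      using eq permutes_in_image[of q "{1..n}"] by (intro prod.cong refl) (simp del: atLeastAtMost_iff)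
    then show "real_of_int (sign q) * (\<Prod>i=1..n. v i \<bullet> w (q i)) =
       of_int (sign q) * (\<Prod>i=1..n. v i \<bullet> w' (q i))" by simp
  qed
qed

lemma select_bij:
  assumes "finite J"
  shows "bij_betw (\<lambda>i. sorted_list_of_set J ! (i - 1)) {1..card J} J"
proof -
  have "bij_betw (\<lambda>i. sorted_list_of_set J ! i) {..<card J} J"
    using assms by (intro bij_betw_nth) auto
  moreover have "bij_betw (\<lambda>i. i - 1) {1..card J} {..<card J}"
    by (rule bij_betw_byWitness[of _ Suc]) auto
  ultimately show ?thesis using bij_betw_trans by (fastforce simp: o_def)
qed

section \<open>Exchange of the arguments of an alternating form\<close>

context
  fixes n :: nat and D :: "'a::real_vector multivector"
  assumes alt: "alternating_form n D"
begin

lemma alternating_form_linear: "i \<in> {1..n} \<Longrightarrow> linear (\<lambda>x. D (w(i := x)))"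
  using alt by (auto simp: alternating_form_def)

lemma alternating_form_permute: "q permutes {1..n} \<Longrightarrow> D (w \<circ> q) = of_int (sign q) * D w"
  using alt by (auto simp: alternating_form_def)

lemma alternating_form_cong: "(\<And>i. i \<in> {1..n} \<Longrightarrow> w i = w' i) \<Longrightarrow> D w = D w'"
  using alt by (auto simp: alternating_form_def)

lemma alternating_form_repeat:
  assumes "i \<in> {1..n}" "j \<in> {1..n}" "i \<noteq> j" "w i = w j"
  shows "D w = 0"
proof -
  let ?t = "Transposition.transpose i j"
  have "?t permutes {1..n}" using assms by (intro permutes_swap_id)
  from alternating_form_permute[OF this, of w] have "D (w \<circ> ?t) = - D w"
    using assms by (simp add: sign_swap_id)
  moreover have "w \<circ> ?t = w"
    using assms by (auto simp: fun_eq_iff Transposition.transpose_def)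
  ultimately show ?thesis by simp
qed

text \<open>If a multilinear form does not vanish, then the vectors can be replaced one at a time
  by elements of spanning sets.\<close>

lemma alternating_form_nonzero_on_spanning:
  assumes "D w \<noteq> 0" and span: "\<And>i. i \<in> {1..n} \<Longrightarrow> w i \<in> span (f ` B i)"
  obtains r where "\<And>i. i \<in> {1..n} \<Longrightarrow> r i \<in> B i" "inj_on r {1..n}" "D (f \<circ> r) \<noteq> 0"
proof -
  have "\<exists>r. (\<forall>i\<in>{1..m}. r i \<in> B i) \<and> D (\<lambda>i. if i \<in> {1..m} then f (r i) else w i) \<noteq> 0"
    if "m \<le> n" for m
    using that
  proof (induction m)
    case 0
    show ?case using assms(1) by auto
  next
    case (Suc m)
    then obtain r where r: "\<forall>i\<in>{1..m}. r i \<in> B i"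
      and nz: "D (\<lambda>i. if i \<in> {1..m} then f (r i) else w i) \<noteq> 0" by auto
    let ?w = "\<lambda>i. if i \<in> {1..m} then f (r i) else w i"
    have lin: "linear (\<lambda>x. D (?w(Suc m := x)))"
      using Suc.prems by (intro alternating_form_linear) auto
    have "?w(Suc m := w (Suc m)) = ?w" by auto
    then have "\<not> (\<forall>x\<in>f ` B (Suc m). D (?w(Suc m := x)) = 0)"
      using linear_eq_0_on_span[OF lin, of "f ` B (Suc m)" "w (Suc m)"] span[of "Suc m"] Suc.prems nz
      by auto
    then obtain k where k: "k \<in> B (Suc m)" "D (?w(Suc m := f k)) \<noteq> 0" by auto
    have eq: "(\<lambda>i. if i \<in> {1..Suc m} then f ((r(Suc m := k)) i) else w i) = ?w(Suc m := f k)"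
      by (auto simp: fun_eq_iff)
    show ?case
      by (rule exI[of _ "r(Suc m := k)"]) (use k r in \<open>unfold eq, auto\<close>)
  qed
  from this[of n] obtain r where r: "\<forall>i\<in>{1..n}. r i \<in> B i"
      "D (\<lambda>i. if i \<in> {1..n} then f (r i) else w i) \<noteq> 0" by auto
  have "D (\<lambda>i. if i \<in> {1..n} then f (r i) else w i) = D (f \<circ> r)"
    by (rule alternating_form_cong) auto
  then have nz: "D (f \<circ> r) \<noteq> 0" using r by simp
  moreover have "inj_on r {1..n}"
    using alternating_form_repeat[of _ _ "f \<circ> r"] nz by (fastforce intro!: inj_onI)
  ultimately show ?thesis using that r by blast
qed

text \<open>\<open>r\<close> and the increasing enumeration used by \<open>select\<close> run
  through the same set, so they differ by a permutation, and the values by its sign.\<close>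

lemma alternating_form_select:
  assumes inj: "inj_on r {1..n}"
  obtains q where "q permutes {1..n}" "D (select f (r ` {1..n})) = of_int (sign q) * D (f \<circ> r)"
proof -
  define J where "J = r ` {1..n}"
  define g where "g i = sorted_list_of_set J ! (i - 1)" for i
  have J: "finite J" "card J = n" using inj by (auto simp: J_def card_image)
  have g: "bij_betw g {1..n} J" using select_bij[OF J(1)] J(2) by (simp add: g_def[abs_def])
  have r: "bij_betw r {1..n} J" using inj by (simp add: J_def bij_betw_def)
  define q where "q i = (if i \<in> {1..n} then inv_into {1..n} r (g i) else i)" for i
  have "bij_betw (inv_into {1..n} r \<circ> g) {1..n} {1..n}"
    by (rule bij_betw_trans[OF g bij_betw_inv_into[OF r]])
  then have "bij_betw q {1..n} {1..n}"
    by (rule bij_betw_cong[THEN iffD1, rotated]) (auto simp: q_def)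
  then have q: "q permutes {1..n}" by (rule bij_imp_permutes) (auto simp: q_def)
  have "D (select f J) = D ((f \<circ> r) \<circ> q)"
  proof (rule alternating_form_cong)
    fix i assume i: "i \<in> {1..n}"
    then have "g i \<in> r ` {1..n}" using g by (auto simp: bij_betw_def J_def)
    then show "select f J i = ((f \<circ> r) \<circ> q) i"
      using i by (simp add: select_def q_def f_inv_into_f g_def[symmetric, unfolded One_nat_def])
  qed
  then show ?thesis using that[OF q] alternating_form_permute[OF q] by (simp add: J_def)
qed

end

text \<open>The factor is the determinant of the matrix expressing \<open>v\<close> through
  \<open>u\<close>: the matrix of scalar products of \<open>v\<close> and \<open>w\<close> is this
  matrix times that of \<open>u\<close> and \<open>w\<close>. It may be zero.\<close>

lemma wedge_scale_basis:
  assumes "\<And>i. i \<in> {1..n} \<Longrightarrow> v i \<in> span (u ` {1..n})"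
  shows "\<exists>c. \<forall>w. wedge n v w = c * wedge n u w"
proof -
  have "\<exists>a. x = (\<Sum>k=1..n. a k *\<^sub>R u k)" if "x \<in> span (u ` {1..n})" for x
    using that
  proof (induction rule: span_induct_alt)
    case base
    show ?case by (rule exI[of _ "\<lambda>_. 0"]) simp
  next
    case (step c x y)
    then obtain i a where "i \<in> {1..n}" "x = u i" "y = (\<Sum>k=1..n. a k *\<^sub>R u k)" by auto
    then have "c *\<^sub>R x + y = (\<Sum>k=1..n. (a k + (if k = i then c else 0)) *\<^sub>R u k)"
      by (simp add: scaleR_add_left sum.distrib if_distrib[of "\<lambda>c. c *\<^sub>R _"] cong: if_cong)
    then show ?case by (rule exI[of _ "\<lambda>k. a k + (if k = i then c else 0)"])
  qed
  then have "\<exists>a. v i = (\<Sum>k=1..n. a k *\<^sub>R u k)" if "i \<in> {1..n}" for i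
    using assms[OF that] by blast
  then obtain M where M: "\<And>i. i \<in> {1..n} \<Longrightarrow> v i = (\<Sum>k=1..n. M i k *\<^sub>R u k)" by metis
  let ?M = "mat n n (\<lambda>(i, j). M (Suc i) (Suc j))"
  have "wedge n v w = Determinant.det ?M * wedge n u w" for w
  proof -
    have s: "(\<Sum>k=1..n. g k) = (\<Sum>k=0..<n. g (Suc k))" for g :: "nat \<Rightarrow> real"
      by (rule sum.reindex_bij_witness[of _ Suc "\<lambda>i. i - 1"]) auto
    have "mat n n (\<lambda>(i, j). v (Suc i) \<bullet> w (Suc j)) = ?M * mat n n (\<lambda>(i, j). u (Suc i) \<bullet> w (Suc j))"
      by (rule eq_matI) (auto simp: scalar_prod_def M inner_sum_left s[unfolded One_nat_def])
    then show ?thesis by (simp add: wedge_eq_det det_mult[of _ n])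
  qed
  then show ?thesis by blast
qed

text \<open>A permutation other than the identity moves at least two points, hence it takes some
  \<open>j\<close> to a point other than \<open>j\<close> and \<open>k\<close>; the factor at
  \<open>j\<close> is then zero. The free column \<open>k\<close> lets a single entry be read off as
  a determinant in \<open>frame_degree\<close>.\<close>

lemma wedge_diagonal_except_column:
  assumes "\<And>i j. i \<in> {1..n} \<Longrightarrow> j \<in> {1..n} \<Longrightarrow> i \<noteq> j \<Longrightarrow> j \<noteq> k \<Longrightarrow> v i \<bullet> w j = 0"
  shows "wedge n v w = (\<Prod>i=1..n. v i \<bullet> w i)"
proof -
  have "wedge n v w = (\<Sum>q\<in>{id}. of_int (sign q) * (\<Prod>i=1..n. v i \<bullet> w (q i)))"
    unfolding wedge_def
  proof (rule sum.mono_neutral_right)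
    show "\<forall>q\<in>{q. q permutes {1..n}} - {id}. of_int (sign q) * (\<Prod>i=1..n. v i \<bullet> w (q i)) = 0"
    proof
      fix q assume "q \<in> {q. q permutes {1..n}} - {id}"
      then have q: "q permutes {1..n}" "q \<noteq> id" by auto
      then obtain i where i: "q i \<noteq> i" by (auto simp: fun_eq_iff)
      obtain j where j: "q j \<noteq> j" "q j \<noteq> k"
      proof (cases "q i = k")
        case True
        then have "q k \<noteq> k" using i injD[OF permutes_inj[OF q(1)], of k i] by auto
        then show ?thesis using that[of k] by simp
      qed (use that[of i] i in simp)
      then have "j \<in> {1..n}" "q j \<in> {1..n}" using q permutes_not_in permutes_in_image by metis+
      then have "(\<Prod>i=1..n. v i \<bullet> w (q i)) = 0"
        using assms[of j "q j"] j by (intro prod_zero bexI[of _ j]) auto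
      then show "of_int (sign q) * (\<Prod>i=1..n. v i \<bullet> w (q i)) = 0" by simp
    qed
  qed (auto simp: finite_permutations permutes_id)
  then show ?thesis by simp
qed

lemma wedge_orthogonal:
  assumes "\<And>i j. i \<in> {1..n} \<Longrightarrow> j \<in> {1..n} \<Longrightarrow> i \<noteq> j \<Longrightarrow> v i \<bullet> w j = 0"
  shows "wedge n v w = (\<Prod>i=1..n. v i \<bullet> w i)"
  using assms by (rule wedge_diagonal_except_column)

lemma vec_wedge_wedge:
  "vec_wedge n x (wedge n v) = wedge (Suc n) (\<lambda>i. if i = 1 then x else v (i - 1))"
proof
  fix w
  let ?v = "\<lambda>i. if i = 1 then x else v (i - 1)"
  let ?A = "mat (Suc n) (Suc n) (\<lambda>(i, j). ?v (Suc i) \<bullet> w (Suc j))"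
  have "wedge (Suc n) ?v w = (\<Sum>j<Suc n. ?A $$ (0, j) * cofactor ?A 0 j)"
    unfolding wedge_eq_det by (rule laplace_expansion_row) auto
  also have "\<dots> = (\<Sum>j<Suc n. (- 1) ^ (j + 2) * (x \<bullet> w (Suc j)) *
      wedge n v (\<lambda>i. if i < Suc j then w i else w (i + 1)))"
  proof (intro sum.cong refl)
    fix j assume "j \<in> {..<Suc n}"
    then have j: "j < Suc n" by simp
    have "mat_delete ?A 0 j =
       mat n n (\<lambda>(i, k). v (Suc i) \<bullet> (if Suc k < Suc j then w (Suc k) else w (Suc k + 1)))"
      using j by (intro eq_matI) (auto simp: mat_delete_def)
    then show "?A $$ (0, j) * cofactor ?A 0 j = (- 1) ^ (j + 2) * (x \<bullet> w (Suc j)) *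
      wedge n v (\<lambda>i. if i < Suc j then w i else w (i + 1))"
      using j by (simp add: cofactor_def wedge_eq_det)
  qed
  also have "\<dots> = vec_wedge n x (wedge n v) w"
    unfolding vec_wedge_def
    by (rule sum.reindex_bij_witness[of _ "\<lambda>j. j - 1" Suc]) auto
  finally show "vec_wedge n x (wedge n v) w = wedge (Suc n) ?v w" by simp
qed

text \<open>If the product with \<open>x\<close> vanishes, so does the product with
  \<open>x - p\<close>, where \<open>p\<close> is the orthogonal projection of \<open>x\<close> onto
  the span. Evaluated on its own family this is a Gram determinant of orthogonal vectors, equal to
  the squared norm of \<open>x - p\<close>; hence \<open>x = p\<close>.\<close>

lemma vec_wedge_orthonormal_eq_0_iff:
  assumes orth: "\<And>i j. i \<in> {1..n} \<Longrightarrow> j \<in> {1..n} \<Longrightarrow> v i \<bullet> v j = (if i = j then 1 else 0)"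
  shows "vec_wedge n x (wedge n v) = (\<lambda>w. 0) \<longleftrightarrow> x \<in> span (v ` {1..n})"
proof -
  let ?u = "\<lambda>x i. if i = Suc 0 then x else v (i - 1)"
  have lin: "linear (\<lambda>x. wedge (Suc n) (?u x) w)" for w
  proof -
    have "(?u 0)(Suc 0 := x) = ?u x" for x by auto
    then have "wedge (Suc n) w ((?u 0)(Suc 0 := x)) = wedge (Suc n) (?u x) w" for x
      by (simp only: wedge_commute[of "Suc n" w])
    then show ?thesis
      using alternating_form_linear[OF alternating_form_wedge, of "Suc 0" "Suc n" w "?u 0"] by simp
  qed
  have zero: "wedge (Suc n) (?u y) w = 0" if "y \<in> span (v ` {1..n})" for y w
  proof (rule linear_eq_0_on_span[OF lin _ that])
    fix y assume "y \<in> v ` {1..n}"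
    then obtain k where k: "k \<in> {1..n}" "y = v k" by auto
    have "wedge (Suc n) w (?u y) = 0"
      by (rule alternating_form_repeat[OF alternating_form_wedge, of "Suc 0" _ "Suc k"]) (use k in auto)
    then show "wedge (Suc n) (?u y) w = 0" by (simp add: wedge_commute)
  qed
  have "x \<in> span (v ` {1..n})" if *: "\<And>w. wedge (Suc n) (?u x) w = 0"
  proof -
    define p where "p = (\<Sum>i=1..n. (x \<bullet> v i) *\<^sub>R v i)"
    have p: "p \<in> span (v ` {1..n})"
      unfolding p_def by (intro span_sum span_scale span_base) auto
    have orth': "(x - p) \<bullet> v i = 0" if "i \<in> {1..n}" for i
    proof -
      have "p \<bullet> v i = (\<Sum>k=1..n. if k = i then x \<bullet> v i else 0)"
        unfolding p_def inner_sum_left using that orth by (intro sum.cong) auto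
      then show ?thesis using that by (simp add: inner_diff_left)
    qed
    have orth'': "?u (x - p) i \<bullet> ?u (x - p) j = 0"
      if ij: "i \<in> {1..Suc n}" "j \<in> {1..Suc n}" "i \<noteq> j" for i j
    proof -
      consider "i = 1" "j - 1 \<in> {1..n}" | "j = 1" "i - 1 \<in> {1..n}"
        | "i \<noteq> 1" "j \<noteq> 1" "i - 1 \<in> {1..n}" "j - 1 \<in> {1..n}" "i - 1 \<noteq> j - 1"
        using ij unfolding atLeastAtMost_iff by linarith
      then show ?thesis
      proof cases
        case 1
        then show ?thesis using orth'[of "j - 1"] ij by simp
      next
        case 2
        then show ?thesis using orth'[of "i - 1"] ij by (simp add: inner_commute)
      next
        case 3
        then show ?thesis using orth[of "i - 1" "j - 1"] by simp
      qed
    qed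
    have "wedge (Suc n) (?u (x - p)) (?u (x - p)) = 0"
      using linear_diff[OF lin, of x p] * zero[OF p] by simp
    moreover have "wedge (Suc n) (?u (x - p)) (?u (x - p)) = (\<Prod>i=1..Suc n. ?u (x - p) i \<bullet> ?u (x - p) i)"
      by (rule wedge_orthogonal[OF orth''])
    ultimately have "(\<Prod>i=1..Suc n. ?u (x - p) i \<bullet> ?u (x - p) i) = 0" by simp
    then obtain i where i: "i \<in> {1..Suc n}" "?u (x - p) i \<bullet> ?u (x - p) i = 0"
      by (auto simp only: prod_zero_iff finite_atLeastAtMost)
    have "i = 1"
    proof (rule ccontr)
      assume "i \<noteq> 1"
      then have "i - 1 \<in> {1..n}" using i(1) unfolding atLeastAtMost_iff by linarith
      then show False using orth[of "i - 1" "i - 1"] i(2) \<open>i \<noteq> 1\<close> by simp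
    qed
    then have "x - p = 0" using i(2) by simp
    then show ?thesis using p by simp
  qed
  then show ?thesis using zero by (auto simp: vec_wedge_wedge fun_eq_iff)
qed

section \<open>Graded bases and degrees\<close>

lemma partial_sum_Suc: "partial_sum c (Suc j) = partial_sum c j + c (Suc j)"
  by (simp add: partial_sum_def)

lemma partial_sum_step: "1 \<le> j \<Longrightarrow> partial_sum c j = partial_sum c (j - 1) + c j"
  using partial_sum_Suc[of c "j - 1"] by simp

lemma partial_sum_mono: "i \<le> j \<Longrightarrow> partial_sum c i \<le> partial_sum c j"
  unfolding partial_sum_def by (intro sum_mono2) auto

lemma block_eqI:
  assumes "1 \<le> j" "partial_sum c (j - 1) < i" "i \<le> partial_sum c j"
  shows "block c i = j"
  unfolding block_def
proof (rule the_equality)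
  fix k assume k: "1 \<le> k \<and> partial_sum c (k - 1) < i \<and> i \<le> partial_sum c k"
  show "k = j"
  proof (rule ccontr)
    assume "k \<noteq> j"
    then consider "k \<le> j - 1" | "j \<le> k - 1" by linarith
    then show False
      using partial_sum_mono[of k "j - 1" c] partial_sum_mono[of j "k - 1" c] assms k
      by cases linarith+
  qed
qed (use assms in auto)

text \<open>Blocks may be empty, since \<open>\<alpha> j\<close> may be zero. The least
  \<open>j\<close> with \<open>i \<le> partial_sum c j\<close> passes over the empty ones, and its
  minimality gives the strict lower bound.\<close>

lemma block_bounds:
  assumes "1 \<le> i" "i \<le> partial_sum c J"
  shows "1 \<le> block c i" "block c i \<le> J"
    "partial_sum c (block c i - 1) < i" "i \<le> partial_sum c (block c i)"
proof -
  define j where "j = (LEAST j. i \<le> partial_sum c j)"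
  have j: "i \<le> partial_sum c j" "j \<le> J"
    unfolding j_def using assms(2) by (auto intro: LeastI Least_le)
  have "j \<noteq> 0"
  proof
    assume "j = 0"
    then show False using j(1) assms(1) by (simp add: partial_sum_def)
  qed
  then have *: "1 \<le> j" "partial_sum c (j - 1) < i"
    using not_less_Least[of "j - 1" "\<lambda>j. i \<le> partial_sum c j"] by (auto simp flip: j_def)
  then have "block c i = j" using j by (intro block_eqI)
  then show "1 \<le> block c i" "block c i \<le> J"
    "partial_sum c (block c i - 1) < i" "i \<le> partial_sum c (block c i)"
    using j * by auto
qed

lemma mem_span_orthonormal:
  fixes e :: "nat \<Rightarrow> 'a::euclidean_space"
  assumes "finite K" and orth: "\<And>i j. i \<in> K \<Longrightarrow> j \<in> K \<Longrightarrow> e i \<bullet> e j = (if i = j then 1 else 0)"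
    and "x \<in> span (e ` K)"
  shows "x = (\<Sum>l\<in>K. (x \<bullet> e l) *\<^sub>R e l)"
proof -
  have lin: "linear (\<lambda>x. x - (\<Sum>l\<in>K. (x \<bullet> e l) *\<^sub>R e l))"
    by (rule linearI) (simp_all add: inner_add_left scaleR_add_left sum.distrib scaleR_sum_right algebra_simps)
  have "x - (\<Sum>l\<in>K. (x \<bullet> e l) *\<^sub>R e l) = 0"
  proof (rule linear_eq_0_on_span[OF lin _ assms(3)])
    fix y assume "y \<in> e ` K"
    then obtain i where i: "i \<in> K" "y = e i" by auto
    have "(\<Sum>l\<in>K. (y \<bullet> e l) *\<^sub>R e l) = (\<Sum>l\<in>K. if l = i then e l else 0)"
      using i orth by (intro sum.cong) auto
    then show "y - (\<Sum>l\<in>K. (y \<bullet> e l) *\<^sub>R e l) = 0" using i assms(1) by simp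
  qed
  then show ?thesis by simp
qed

text \<open>For \<open>J = K\<close> the matrix of scalar products is the identity. Otherwise, the
  cardinalities being equal, some element of \<open>J\<close> lies outside \<open>K\<close> and its
  row is zero.\<close>

lemma wedge_select_orthonormal:
  assumes orth: "\<And>i j. i \<in> A \<Longrightarrow> j \<in> A \<Longrightarrow> e i \<bullet> e j = (if i = j then 1 else 0)"
    and J: "J \<subseteq> A" "card J = n" "finite J" and K: "K \<subseteq> A" "card K = n" "finite K"
  shows "wedge n (select e J) (select e K) = (if J = K then 1 else 0)"
proof -
  define g where "g i = sorted_list_of_set J ! (i - 1)" for i
  define h where "h i = sorted_list_of_set K ! (i - 1)" for i
  have g: "bij_betw g {1..n} J" and h: "bij_betw h {1..n} K"
    using select_bij[OF J(3)] select_bij[OF K(3)] J(2) K(2) by (simp_all add: g_def[abs_def] h_def[abs_def])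
  have sel: "select e J = e \<circ> g" "select e K = e \<circ> h"
    by (auto simp: select_def g_def h_def)
  have gJ: "g i \<in> J" and hK: "h i \<in> K" if "i \<in> {1..n}" for i
    using g h that unfolding bij_betw_def by blast+
  show ?thesis
  proof (cases "J = K")
    case True
    then have "h = g" by (simp add: g_def[abs_def] h_def[abs_def])
    have inner: "e (g i) \<bullet> e (g j) = (if i = j then 1 else 0)" if "i \<in> {1..n}" "j \<in> {1..n}" for i j
    proof -
      have "g i = g j \<longleftrightarrow> i = j" using g that unfolding bij_betw_def inj_on_def by blast
      then show ?thesis using orth[of "g i" "g j"] J(1) gJ that by (simp add: subset_iff del: atLeastAtMost_iff)
    qed
    have "wedge n (e \<circ> g) (e \<circ> g) = (\<Prod>i=1..n. (e \<circ> g) i \<bullet> (e \<circ> g) i)"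
      by (rule wedge_orthogonal) (simp add: inner)
    also have "\<dots> = 1" using inner by (intro prod.neutral) simp
    finally show ?thesis using True by (simp add: sel \<open>h = g\<close>)
  next
    case False
    have "\<not> J \<subseteq> K" using False J K card_subset_eq by metis
    then obtain j where "j \<in> J" "j \<notin> K" by auto
    then obtain i where i: "i \<in> {1..n}" "g i = j" using g unfolding bij_betw_def by blast
    have "(\<Prod>i=1..n. select e J i \<bullet> select e K (q i)) = 0" if "q permutes {1..n}" for q
    proof -
      have "h (q i) \<in> K" using hK permutes_in_image[OF that] i by blast
      then have "e j \<bullet> e (h (q i)) = 0"
        using orth[of j "h (q i)"] \<open>j \<in> J\<close> \<open>j \<notin> K\<close> J(1) K(1) by (auto simp: subset_iff)
      then show ?thesis using i by (intro prod_zero bexI[of _ i]) (simp_all add: sel)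
    qed
    then have "wedge n (select e J) (select e K) = 0"
      unfolding wedge_def by (intro sum.neutral) (simp del: prod_zero_iff)
    then show ?thesis using False by simp
  qed
qed

section \<open>Coefficients of multivectors in a graded basis\<close>

context homogeneous_group
begin

abbreviation "deg \<equiv> index_degree H"

lemma dim_Union_layers: "dim (\<Union>j\<in>{1..J}. H j) = layer_sum H J"
proof (induction J)
  case 0
  show ?case by (simp add: partial_sum_def)
next
  case (Suc J)
  have "(\<Union>j\<in>{1..Suc J}. H j) = (\<Union>j\<in>{1..J}. H j) \<union> H (Suc J)"
    by (auto simp: atLeastAtMostSuc_conv)
  moreover have "dim ((\<Union>j\<in>{1..J}. H j) \<union> H (Suc J)) = dim (\<Union>j\<in>{1..J}. H j) + dim (H (Suc J))"
    by (rule dim_orthogonal_sum) (auto intro: layers_orthogonal[of _ "Suc J"])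
  ultimately show ?case using Suc by (simp add: partial_sum_Suc)
qed

lemma layer_sum_step: "layer_sum H \<iota> = DIM('a)"
  using dim_Union_layers[of \<iota>] layers_span dim_span[of "\<Union>j\<in>{1..\<iota>}. H j"] by simp

context
  fixes e :: "nat \<Rightarrow> 'a"
  assumes basis: "orthonormal_graded_basis H \<iota> e"
begin

lemma basis_inner:
  "i \<in> {1..DIM('a)} \<Longrightarrow> j \<in> {1..DIM('a)} \<Longrightarrow> e i \<bullet> e j = (if i = j then 1 else 0)"
  using basis by (auto simp: orthonormal_graded_basis_def)

lemma basis_span: "span (e ` {1..DIM('a)}) = UNIV"
  using basis by (auto simp: orthonormal_graded_basis_def)

lemma basis_layer: "j \<in> {1..\<iota>} \<Longrightarrow> span (e ` {layer_sum H (j - 1)<..layer_sum H j}) = H j"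
  using basis unfolding orthonormal_graded_basis_def by blast

lemma basis_sum: "x = (\<Sum>l=1..DIM('a). (x \<bullet> e l) *\<^sub>R e l)"
  by (rule mem_span_orthonormal) (use basis_inner basis_span in auto)

lemma combination_inner_basis:
  assumes s: "s \<in> {1..DIM('a)}"
  shows "(\<Sum>j=1..DIM('a). g j *\<^sub>R e j) \<bullet> e s = g s"
proof -
  have "(\<Sum>j=1..DIM('a). g j *\<^sub>R e j) \<bullet> e s = (\<Sum>j=1..DIM('a). if j = s then g s else 0)"
    unfolding inner_sum_left using basis_inner[OF _ s] by (intro sum.cong) auto
  then show ?thesis using s by simp
qed

lemma index_degree_bounds: "s \<in> {1..DIM('a)} \<Longrightarrow> deg s \<in> {1..\<iota>}"
  using block_bounds[of s "layer_dim H" \<iota>] layer_sum_step by auto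

lemma basis_mem_layer:
  assumes "s \<in> {1..DIM('a)}"
  shows "e s \<in> H (deg s)"
proof -
  have "s \<in> {layer_sum H (deg s - 1)<..layer_sum H (deg s)}"
    using block_bounds[of s "layer_dim H" \<iota>] layer_sum_step assms by auto
  then have "e s \<in> span (e ` {layer_sum H (deg s - 1)<..layer_sum H (deg s)})"
    by (intro span_base) auto
  then show ?thesis using basis_layer index_degree_bounds[OF assms] by metis
qed

lemma layer_indices:
  assumes "j \<in> {1..\<iota>}"
  shows "{layer_sum H (j - 1)<..layer_sum H j} = {s \<in> {1..DIM('a)}. deg s = j}"
proof (intro subset_antisym subsetI)
  fix s assume s: "s \<in> {layer_sum H (j - 1)<..layer_sum H j}"
  then have "deg s = j" using assms by (intro block_eqI) auto
  moreover have "layer_sum H j \<le> DIM('a)"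
    using partial_sum_mono[of j \<iota> "layer_dim H"] layer_sum_step assms by simp
  ultimately show "s \<in> {s \<in> {1..DIM('a)}. deg s = j}" using s by auto
next
  fix s assume "s \<in> {s \<in> {1..DIM('a)}. deg s = j}"
  then show "s \<in> {layer_sum H (j - 1)<..layer_sum H j}"
    using block_bounds[of s "layer_dim H" \<iota>] layer_sum_step by auto
qed

lemma layer_span_indices:
  "j \<in> {1..\<iota>} \<Longrightarrow> H j = span (e ` {s \<in> {1..DIM('a)}. deg s = j})"
  using basis_layer layer_indices by simp

lemma layer_inner_basis:
  assumes "1 \<le> j" "x \<in> H j" "s \<in> {1..DIM('a)}" "deg s \<noteq> j"
  shows "x \<bullet> e s = 0"
  using layers_orthogonal[of j "deg s" x "e s"] assms index_degree_bounds[OF assms(3)]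
    basis_mem_layer[OF assms(3)] by auto

text \<open>The difference \<open>?D\<close> of the two sides is alternating and vanishes on every
  \<open>select e K\<close>. A nonzero value could be moved to basis vectors by exchanging
  arguments, and then to some \<open>select e K\<close> by sorting.\<close>

lemma alternating_form_expansion:
  assumes alt: "alternating_form n D"
  shows "D w = (\<Sum>J | J \<subseteq> {1..DIM('a)} \<and> card J = n. D (select e J) * wedge n (select e J) w)"
proof -
  let ?S = "{J. J \<subseteq> {1..DIM('a)} \<and> card J = n}"
  let ?D = "\<lambda>w. D w - (\<Sum>J\<in>?S. D (select e J) * wedge n (select e J) w)"
  have alt': "alternating_form n ?D"
    unfolding alternating_form_def
  proof (intro conjI allI ballI impI)
    fix w i assume "i \<in> {1..n}"
    then show "linear (\<lambda>x. ?D (w(i := x)))"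
      using linear_compose_scale_right[where 'b = real, unfolded real_scaleR_def]
      by (intro linear_compose_sub linear_compose_sum ballI alternating_form_linear[OF alt])
        (blast intro: alternating_form_linear[OF alternating_form_wedge])+
  next
    fix w q assume "q permutes {1..n}"
    then show "?D (w \<circ> q) = of_int (sign q) * ?D w"
      by (simp add: alternating_form_permute[OF alt] alternating_form_permute[OF alternating_form_wedge]
          right_diff_distrib sum_distrib_left mult.left_commute)
  next
    fix w w' :: "nat \<Rightarrow> 'a" assume eq: "\<forall>i\<in>{1..n}. w i = w' i"
    then have "D w = D w'" "wedge n (select e J) w = wedge n (select e J) w'" for J
      using alternating_form_cong[OF alt] alternating_form_cong[OF alternating_form_wedge] by blast+
    then show "?D w = ?D w'" by simp
  qed
  have fin: "finite ?S" by simp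
  have "?D w = 0"
  proof (rule ccontr)
    assume nz: "?D w \<noteq> 0"
    have "w i \<in> span (e ` {1..DIM('a)})" for i using basis_span by simp
    then obtain r where r: "\<And>i. i \<in> {1..n} \<Longrightarrow> r i \<in> {1..DIM('a)}" "inj_on r {1..n}" "?D (e \<circ> r) \<noteq> 0"
      by (rule alternating_form_nonzero_on_spanning[OF alt' nz]) (rule that)
    let ?K = "r ` {1..n}"
    obtain q where "q permutes {1..n}" "?D (select e ?K) = of_int (sign q) * ?D (e \<circ> r)"
      by (rule alternating_form_select[OF alt' r(2)])
    then have nzK: "?D (select e ?K) \<noteq> 0" using r(3) by (simp add: sign_def)
    have K: "?K \<subseteq> {1..DIM('a)}" "card ?K = n" using r by (auto simp: card_image)
    have "(\<Sum>J\<in>?S. D (select e J) * wedge n (select e J) (select e ?K)) =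
       (\<Sum>J\<in>?S. if J = ?K then D (select e J) else 0)"
    proof (intro sum.cong refl)
      fix J assume "J \<in> ?S"
      then show "D (select e J) * wedge n (select e J) (select e ?K) = (if J = ?K then D (select e J) else 0)"
        using K by (subst wedge_select_orthonormal[of "{1..DIM('a)}"])
          (auto simp: basis_inner intro: finite_subset)
    qed
    also have "\<dots> = D (select e ?K)" using K fin by (simp add: sum.delta)
    finally show False using nzK by simp
  qed
  then show ?thesis by simp
qed

text \<open>Detects a degree: each argument is exchanged for a basis vector of its own layer, so the
  total degree is preserved.\<close>

lemma alternating_form_nonzero_graded:
  assumes alt: "alternating_form n D" and nz: "D w \<noteq> 0"
    and g: "\<And>i. i \<in> {1..n} \<Longrightarrow> g i \<in> {1..\<iota>}" "\<And>i. i \<in> {1..n} \<Longrightarrow> w i \<in> H (g i)"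
  obtains J where "J \<subseteq> {1..DIM('a)}" "card J = n" "(\<Sum>s\<in>J. deg s) = (\<Sum>i=1..n. g i)"
    "D (select e J) \<noteq> 0"
proof -
  have "w i \<in> span (e ` {s \<in> {1..DIM('a)}. deg s = g i})" if "i \<in> {1..n}" for i
    using g(2)[OF that] layer_span_indices[OF g(1)[OF that]] by simp
  then obtain r where r: "\<And>i. i \<in> {1..n} \<Longrightarrow> r i \<in> {s \<in> {1..DIM('a)}. deg s = g i}"
      "inj_on r {1..n}" "D (e \<circ> r) \<noteq> 0"
    by (rule alternating_form_nonzero_on_spanning[OF alt nz]) (assumption | rule that)+
  obtain q where "q permutes {1..n}" "D (select e (r ` {1..n})) = of_int (sign q) * D (e \<circ> r)"
    by (rule alternating_form_select[OF alt r(2)])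
  then have "D (select e (r ` {1..n})) \<noteq> 0" using r(3) by (simp add: sign_def)
  moreover have "(\<Sum>s\<in>r ` {1..n}. deg s) = (\<Sum>i=1..n. g i)"
    using r by (subst sum.reindex) auto
  moreover have "r ` {1..n} \<subseteq> {1..DIM('a)}" using r(1) by blast
  ultimately show ?thesis using that[of "r ` {1..n}"] card_image[OF r(2)] by simp
qed

lemma degree_part_nonzeroI:
  assumes J: "J \<subseteq> {1..DIM('a)}" "card J = n" "(\<Sum>s\<in>J. deg s) = M"
    and nz: "\<xi> (select e J) \<noteq> 0"
  shows "degree_part H e n M \<xi> \<noteq> (\<lambda>w. 0)"
proof -
  let ?S = "{J. J \<subseteq> {1..DIM('a)} \<and> card J = n \<and> (\<Sum>i\<in>J. deg i) = M}"
  have "degree_part H e n M \<xi> (select e J) = (\<Sum>I\<in>?S. if I = J then \<xi> (select e I) else 0)"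
    unfolding degree_part_def
  proof (intro sum.cong refl)
    fix I assume "I \<in> ?S"
    then show "\<xi> (select e I) * wedge n (select e I) (select e J) = (if I = J then \<xi> (select e I) else 0)"
      using J by (subst wedge_select_orthonormal[of "{1..DIM('a)}"])
        (auto simp: basis_inner intro: finite_subset)
  qed
  also have "\<dots> = \<xi> (select e J)" using J by simp
  finally show ?thesis using nz by (metis)
qed

text \<open>In the Leibniz expansion of a coefficient of \<open>v\<^sub>1 \<and> \<dots> \<and> v\<^sub>n\<close> of degree at least
  \<open>\<Sum> g i\<close>, every factor must pick the leading layer of its vector.\<close>

lemma degree_part_leading:
  fixes v v' :: "nat \<Rightarrow> 'a"
  assumes g: "\<And>i. i \<in> {1..n} \<Longrightarrow> g i \<in> {1..\<iota>}" "\<And>i. i \<in> {1..n} \<Longrightarrow> v' i \<in> H (g i)"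
    and lower: "\<And>i j x. i \<in> {1..n} \<Longrightarrow> g i \<le> j \<Longrightarrow> x \<in> H j \<Longrightarrow> (v i - v' i) \<bullet> x = 0"
    and M: "(\<Sum>i=1..n. g i) \<le> M"
  shows "degree_part H e n M (\<lambda>w. c * wedge n v w) =
    (\<lambda>w. if M = (\<Sum>i=1..n. g i) then c * wedge n v' w else 0)"
proof
  fix w
  let ?deg = "\<lambda>J. \<Sum>s\<in>J. deg s"
  let ?S = "{J. J \<subseteq> {1..DIM('a)} \<and> card J = n}"
  have *: "(\<Prod>i=1..n. v' i \<bullet> select e J (q i)) \<noteq> 0 \<Longrightarrow> ?deg J = (\<Sum>i=1..n. g i)"
      "(\<Sum>i=1..n. g i) \<le> ?deg J \<Longrightarrow>
        (\<Prod>i=1..n. v i \<bullet> select e J (q i)) = (\<Prod>i=1..n. v' i \<bullet> select e J (q i))"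
    if J: "J \<in> ?S" and q: "q permutes {1..n}" for J q
  proof -
    define h where "h i = sorted_list_of_set J ! (i - 1)" for i
    have "finite J" using J finite_subset by auto
    then have h: "bij_betw h {1..n} J"
      using select_bij[of J] J by (simp add: h_def[abs_def])
    have sel: "select e J = e \<circ> h" by (auto simp: select_def h_def)
    have "bij_betw (h \<circ> q) {1..n} J"
      by (rule bij_betw_trans[OF permutes_imp_bij[OF q] h])
    then have deg: "?deg J = (\<Sum>i=1..n. deg (h (q i)))"
      using sum.reindex_bij_betw[of "h \<circ> q" "{1..n}" J "deg"] by simp
    have mem: "h (q i) \<in> {1..DIM('a)}" if "i \<in> {1..n}" for i
      using \<open>bij_betw (h \<circ> q) {1..n} J\<close> J that unfolding bij_betw_def by fastforce
    show "?deg J = (\<Sum>i=1..n. g i)" if nz: "(\<Prod>i=1..n. v' i \<bullet> select e J (q i)) \<noteq> 0"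
      unfolding deg
    proof (intro sum.cong refl, rule ccontr)
      fix i assume i: "i \<in> {1..n}" and ne: "deg (h (q i)) \<noteq> g i"
      have "v' i \<bullet> e (h (q i)) = 0"
        using layer_inner_basis[of "g i" "v' i", OF _ g(2)[OF i] mem[OF i] ne] g(1)[OF i] by simp
      then have "(\<Prod>i=1..n. v' i \<bullet> select e J (q i)) = 0"
        using i by (intro prod_zero bexI[of _ i]) (simp_all add: sel)
      then show False using nz by simp
    qed
    show "(\<Prod>i=1..n. v i \<bullet> select e J (q i)) = (\<Prod>i=1..n. v' i \<bullet> select e J (q i))"
      if le: "(\<Sum>i=1..n. g i) \<le> ?deg J"
    proof (cases "\<forall>i\<in>{1..n}. deg (h (q i)) \<le> g i")
      case True
      \<comment> \<open>No degree exceeds its bound while the sum is at least the sum of the bounds,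
        so equality holds throughout.\<close>
      have "deg (h (q i)) = g i" if i: "i \<in> {1..n}" for i
      proof (rule ccontr)
        assume "deg (h (q i)) \<noteq> g i"
        then have "deg (h (q i)) < g i" using True i by force
        then have "?deg J < (\<Sum>i=1..n. g i)"
          unfolding deg using True i by (intro sum_strict_mono_ex1) auto
        then show False using le by simp
      qed
      then have "v i \<bullet> e (h (q i)) = v' i \<bullet> e (h (q i))" if "i \<in> {1..n}" for i
        using lower[OF that, of "g i" "e (h (q i))"] basis_mem_layer[OF mem[OF that]] that
        by (simp add: inner_diff_left)
      then show ?thesis by (intro prod.cong) (simp_all add: sel)
    next
      case False
      then obtain i where i: "i \<in> {1..n}" "g i < deg (h (q i))" by force
      \<comment> \<open>In a degree above \<open>g i\<close> neither \<open>v i\<close> nor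
        \<open>v' i\<close> has a component, so both products contain a zero factor.\<close>
      have "v' i \<bullet> e (h (q i)) = 0"
        using layer_inner_basis[of "g i" "v' i", OF _ g(2)[OF i(1)] mem[OF i(1)]] g(1)[OF i(1)] i by simp
      moreover have "v i \<bullet> e (h (q i)) = v' i \<bullet> e (h (q i))"
        using lower[OF i(1), of "deg (h (q i))"] basis_mem_layer[OF mem[OF i(1)]] i
        by (simp add: inner_diff_left)
      ultimately have "(\<Prod>i=1..n. v i \<bullet> select e J (q i)) = 0" "(\<Prod>i=1..n. v' i \<bullet> select e J (q i)) = 0"
        using i by (intro prod_zero bexI[of _ i]; simp add: sel)+
      then show ?thesis by (simp del: prod_zero_iff)
    qed
  qed
  have coeff: "wedge n v (select e J) = wedge n v' (select e J)"
    if "J \<in> ?S" "(\<Sum>i=1..n. g i) \<le> ?deg J" for J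
    unfolding wedge_def using *(2)[OF that(1) _ that(2)] by (intro sum.cong refl) simp
  have coeff0: "wedge n v' (select e J) = 0" if J: "J \<in> ?S" and ne: "?deg J \<noteq> (\<Sum>i=1..n. g i)" for J
    unfolding wedge_def
  proof (intro sum.neutral ballI)
    fix q assume "q \<in> {q. q permutes {1..n}}"
    then have "(\<Prod>i=1..n. v' i \<bullet> select e J (q i)) = 0" using *(1)[OF J] ne by blast
    then show "of_int (sign q) * (\<Prod>i=1..n. v' i \<bullet> select e J (q i)) = 0" by (simp del: prod_zero_iff)
  qed
  have "degree_part H e n M (\<lambda>w. c * wedge n v w) w =
      (\<Sum>J | J \<subseteq> {1..DIM('a)} \<and> card J = n \<and> ?deg J = M.
        c * (wedge n v' (select e J) * wedge n (select e J) w))"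
    unfolding degree_part_def using M coeff by (intro sum.cong refl) simp
  also have "\<dots> = (if M = (\<Sum>i=1..n. g i) then c * wedge n v' w else 0)"
  proof (cases "M = (\<Sum>i=1..n. g i)")
    case True
    have "(\<Sum>J | J \<subseteq> {1..DIM('a)} \<and> card J = n \<and> ?deg J = M.
        c * (wedge n v' (select e J) * wedge n (select e J) w)) =
      (\<Sum>J\<in>?S. c * (wedge n v' (select e J) * wedge n (select e J) w))"
      using coeff0 True by (intro sum.mono_neutral_left) auto
    also have "\<dots> = c * wedge n v' w"
      unfolding sum_distrib_left[symmetric]
      by (subst alternating_form_expansion[OF alternating_form_wedge, of n v' w]) simp
    finally show ?thesis using True by simp
  next
    case False
    then show ?thesis using coeff0 by (auto intro!: sum.neutral)
  qed
  finally show "degree_part H e n M (\<lambda>w. c * wedge n v w) w =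
    (if M = (\<Sum>i=1..n. g i) then c * wedge n v' w else 0)" .
qed

end

end

section \<open>Maps of class C1 and left invariant fields\<close>

abbreviation "fderiv F x \<equiv> frechet_derivative F (at x)"

text \<open>In finite dimension, continuity of the derivative in the operator norm amounts to
  continuity in each direction. The C1 property can then be checked without operators.\<close>

lemma C1_on_euclidean_iff:
  fixes F :: "'a::euclidean_space \<Rightarrow> 'b::real_normed_vector"
  shows "C1_on U F \<longleftrightarrow> (\<exists>F'. (\<forall>x\<in>U. (F has_derivative F' x) (at x)) \<and> (\<forall>h. continuous_on U (\<lambda>x. F' x h)))"
proof
  assume "C1_on U F"
  then obtain F' :: "'a \<Rightarrow> 'a \<Rightarrow>\<^sub>L 'b" where
    F': "\<forall>x\<in>U. (F has_derivative blinfun_apply (F' x)) (at x)" "continuous_on U F'"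
    by (auto simp: C1_on_def)
  then have "\<forall>h. continuous_on U (\<lambda>x. F' x h)" by (auto intro!: continuous_intros)
  then show "\<exists>F'. (\<forall>x\<in>U. (F has_derivative F' x) (at x)) \<and> (\<forall>h. continuous_on U (\<lambda>x. F' x h))"
    using F'(1) by (intro exI[of _ "\<lambda>x. blinfun_apply (F' x)"]) auto
next
  assume "\<exists>F'. (\<forall>x\<in>U. (F has_derivative F' x) (at x)) \<and> (\<forall>h. continuous_on U (\<lambda>x. F' x h))"
  then obtain F' where F': "\<And>x. x \<in> U \<Longrightarrow> (F has_derivative F' x) (at x)"
    "\<And>h. continuous_on U (\<lambda>x. F' x h)" by blast
  have app: "blinfun_apply (Blinfun (F' x)) = F' x" if "x \<in> U" for x
    using F'(1)[OF that] by (intro bounded_linear_Blinfun_apply has_derivative_bounded_linear)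
  have "continuous_on U (\<lambda>x. Blinfun (F' x))"
  proof (rule continuous_on_blinfun_componentwise)
    fix i :: 'a
    show "continuous_on U (\<lambda>x. blinfun_apply (Blinfun (F' x)) i)"
      using F'(2)[of i] by (rule continuous_on_cong[THEN iffD1, rotated 2]) (auto simp: app)
  qed
  then show "C1_on U F"
    unfolding C1_on_def using F'(1) app by (intro exI[of _ "\<lambda>x. Blinfun (F' x)"]) auto
qed

lemma C1_on_frechet_derivative:
  assumes "C1_on U F"
  shows "x \<in> U \<Longrightarrow> (F has_derivative fderiv F x) (at x)"
    and "continuous_on U (\<lambda>x. fderiv F x h)"
    and "continuous_on U F"
proof -
  obtain F' where F': "\<forall>x\<in>U. (F has_derivative blinfun_apply (F' x)) (at x)" "continuous_on U F'"
    using assms by (auto simp: C1_on_def)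
  then have eq: "fderiv F x = F' x" if "x \<in> U" for x
    using that frechet_derivative_at by metis
  show "x \<in> U \<Longrightarrow> (F has_derivative fderiv F x) (at x)"
    using F'(1) eq by simp
  have "continuous_on U (\<lambda>x. F' x h)" using F'(2) by (auto intro!: continuous_intros)
  then show "continuous_on U (\<lambda>x. fderiv F x h)"
    by (rule continuous_on_cong[THEN iffD1, rotated 2]) (auto simp: eq)
  show "continuous_on U F"
    using F'(1) by (meson continuous_at_imp_continuous_on has_derivative_continuous)
qed

lemma C1_on_subset: "C1_on U F \<Longrightarrow> V \<subseteq> U \<Longrightarrow> C1_on V F"
  unfolding C1_on_def by (meson continuous_on_subset subsetD)

lemma C1_on_compose:
  assumes "C1_on U F" "C1_on V G" "F ` U \<subseteq> V"
  shows "C1_on U (\<lambda>x. G (F x))"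
proof -
  obtain F' where F': "\<And>x. x \<in> U \<Longrightarrow> (F has_derivative blinfun_apply (F' x)) (at x)" "continuous_on U F'"
    using assms(1) by (auto simp: C1_on_def)
  obtain G' where G': "\<And>x. x \<in> V \<Longrightarrow> (G has_derivative blinfun_apply (G' x)) (at x)" "continuous_on V G'"
    using assms(2) by (auto simp: C1_on_def)
  have "((\<lambda>x. G (F x)) has_derivative blinfun_apply (G' (F x) o\<^sub>L F' x)) (at x)" if "x \<in> U" for x
    using has_derivative_compose[OF F'(1)[OF that] G'(1)] assms(3) that
    by (auto simp: blinfun_compose.rep_eq o_def)
  moreover have "continuous_on U (\<lambda>x. G' (F x) o\<^sub>L F' x)"
    by (rule bounded_bilinear.continuous_on[OF bounded_bilinear_blinfun_compose
          continuous_on_compose2[OF G'(2) C1_on_frechet_derivative(3)[OF assms(1)] assms(3)] F'(2)])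
  ultimately show ?thesis
    unfolding C1_on_def by (intro exI[of _ "\<lambda>x. G' (F x) o\<^sub>L F' x"]) simp
qed

lemma C1_on_const: "C1_on U (\<lambda>x. c)"
  unfolding C1_on_def by (rule exI[of _ "\<lambda>_. 0"]) (auto simp: zero_blinfun.rep_eq)

lemma C1_on_bounded_linear: "bounded_linear F \<Longrightarrow> C1_on U F"
  unfolding C1_on_def
  by (rule exI[of _ "\<lambda>_. Blinfun F"])
    (auto simp: bounded_linear_Blinfun_apply intro: bounded_linear_imp_has_derivative)

lemma C1_on_bilinear:
  fixes F :: "'a::euclidean_space \<Rightarrow> 'b::real_normed_vector" and G :: "'a \<Rightarrow> 'c::real_normed_vector"
    and B :: "'b \<Rightarrow> 'c \<Rightarrow> 'd::real_normed_vector"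
  assumes "bounded_bilinear B" "C1_on U F" "C1_on U G"
  shows "C1_on U (\<lambda>x. B (F x) (G x))"
proof -
  have "((\<lambda>x. B (F x) (G x)) has_derivative
      (\<lambda>h. B (F x) (fderiv G x h) + B (fderiv F x h) (G x))) (at x)"
    if "x \<in> U" for x
    using bounded_bilinear.FDERIV[OF assms(1) C1_on_frechet_derivative(1)[OF assms(2) that]
        C1_on_frechet_derivative(1)[OF assms(3) that]] .
  then show ?thesis
    unfolding C1_on_euclidean_iff
    using C1_on_frechet_derivative(2,3)[OF assms(2)] C1_on_frechet_derivative(2,3)[OF assms(3)]
    by (intro exI[of _ "\<lambda>x h. B (F x) (fderiv G x h) + B (fderiv F x h) (G x)"]
        conjI ballI allI continuous_on_add bounded_bilinear.continuous_on[OF assms(1)]) auto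
qed

lemma C1_on_sum:
  fixes F :: "'i \<Rightarrow> 'a::euclidean_space \<Rightarrow> 'b::real_normed_vector"
  assumes "\<And>i. i \<in> I \<Longrightarrow> C1_on U (F i)"
  shows "C1_on U (\<lambda>x. \<Sum>i\<in>I. F i x)"
  unfolding C1_on_euclidean_iff
  using C1_on_frechet_derivative[OF assms]
  by (intro exI[of _ "\<lambda>x h. \<Sum>i\<in>I. fderiv (F i) x h"] conjI ballI allI
      has_derivative_sum continuous_on_sum) auto

lemma C1_on_scaleR:
  fixes F :: "'a::euclidean_space \<Rightarrow> 'b::real_normed_vector"
  shows "C1_on U F \<Longrightarrow> C1_on U (\<lambda>x. c *\<^sub>R F x)"
  by (rule C1_on_bilinear[OF bounded_bilinear_scaleR C1_on_const])

lemma has_vector_derivative_monomial_0: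
  "((\<lambda>t::real. (t ^ m * c) *\<^sub>R x) has_vector_derivative ((if m = 1 then 1 else 0) * c) *\<^sub>R x) (at 0)"
proof -
  consider "m = 0" | "m = 1" | k where "m = Suc (Suc k)" by (metis One_nat_def not0_implies_Suc)
  then have "((\<lambda>t::real. t ^ m) has_real_derivative (if m = 1 then 1 else 0)) (at 0)"
  proof cases
    case 3
    then show ?thesis using DERIV_pow[of m "0::real"] by simp
  qed simp_all
  then have "((\<lambda>t::real. t ^ m * c) has_vector_derivative (if m = 1 then 1 else 0) * c) (at 0)"
    unfolding has_real_derivative_iff_has_vector_derivative[symmetric] by (rule DERIV_cmult_right)
  then show ?thesis
    by (rule bounded_linear.has_vector_derivative[OF bounded_linear_scaleR_left])
qed

lemma dynkin_word_map: "dynkin_word (h x) (h y) rs = map h (dynkin_word x y rs)"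
  by (simp add: dynkin_word_def map_concat comp_def case_prod_unfold)

text \<open>Encoding the second letter as \<open>True\<close> separates the combinatorics of a word
  from the vectors put into it; the degree in \<open>y\<close> becomes a count of
  \<open>True\<close>.\<close>

lemma dynkin_word_bool:
  "dynkin_word x y rs = map (\<lambda>b. if b then y else x) (dynkin_word False True rs)"
  using dynkin_word_map[of "\<lambda>b. if b then y else x" False True rs] by simp

lemma length_dynkin_word: "length (dynkin_word x y rs) = dynkin_degree rs"
  by (induction rs) (auto simp: dynkin_word_def dynkin_degree_def)

lemma one_True_split:
  assumes "length (filter id bs) = 1"
  obtains a b where "bs = replicate a False @ True # replicate b False"
proof -
  have all_False: "bs = replicate (length bs) False" if "filter id bs = []" for bs
    using that by (induction bs) (auto split: if_splits)
  have "\<exists>a b. bs = replicate a False @ True # replicate b False"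
    using assms
  proof (induction bs)
    case (Cons c bs)
    show ?case
    proof (cases c)
      case True
      then have "filter id bs = []" using Cons.prems by (simp add: id_def)
      then have "c # bs = replicate 0 False @ True # replicate (length bs) False"
        using all_False[of bs] True by simp
      then show ?thesis by blast
    next
      case False
      then obtain a b where "bs = replicate a False @ True # replicate b False" using Cons by auto
      then have "c # bs = replicate (Suc a) False @ True # replicate b False" using False by simp
      then show ?thesis by blast
    qed
  qed simp
  then show ?thesis using that by blast
qed

section \<open>Left translations and the Baker-Campbell-Hausdorff series\<close>

context homogeneous_group
begin

lemma bounded_bilinear_bracket: "bounded_bilinear br"
  using bracket_bilinear by (simp add: bilinear_conv_bounded_bilinear)

lemmas bracket_simps =
  bilinear_lzero[OF bracket_bilinear] bilinear_rzero[OF bracket_bilinear]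
  bilinear_lmul[OF bracket_bilinear] bilinear_rmul[OF bracket_bilinear]
  bilinear_ladd[OF bracket_bilinear] bilinear_radd[OF bracket_bilinear]

lemma bracket_anticommute: "br y x = - br x y"
proof -
  have "br (x + y) (x + y) = br x y + br y x"
    using bracket_alternating[of x] bracket_alternating[of y]
    by (simp add: bracket_simps del: bracket_alternating)
  then show ?thesis using bracket_alternating[of "x + y"] by (simp add: eq_neg_iff_add_eq_0 add.commute)
qed

lemma nested_bracket_Cons: "ws \<noteq> [] \<Longrightarrow> nested_bracket br (v # ws) = br v (nested_bracket br ws)"
  by (cases ws) auto

lemma C1_on_nested_bracket:
  assumes "\<And>g. g \<in> set gs \<Longrightarrow> C1_on U (g :: 'a \<Rightarrow> 'a)"
  shows "C1_on U (\<lambda>y. nested_bracket br (map (\<lambda>g. g y) gs))"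
  using assms
proof (induction gs)
  case Nil
  show ?case by (simp add: C1_on_const)
next
  case (Cons g gs)
  show ?case
  proof (cases "gs = []")
    case True
    then show ?thesis using Cons.prems by simp
  next
    case False
    have "C1_on U (\<lambda>y. br (g y) (nested_bracket br (map (\<lambda>g. g y) gs)))"
      using Cons by (intro C1_on_bilinear[OF bounded_bilinear_bracket]) auto
    then show ?thesis using False by (simp add: nested_bracket_Cons)
  qed
qed

lemma C1_on_gmul: "C1_on U (gmul a)"
proof -
  have "C1_on U (\<lambda>y. \<Sum>rs\<in>dynkin_index \<iota>.
      dynkin_coeff rs *\<^sub>R nested_bracket br (map (\<lambda>g. g y) (dynkin_word (\<lambda>_. a) (\<lambda>y. y) rs)))"
  proof (intro C1_on_sum C1_on_scaleR C1_on_nested_bracket)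
    fix rs g assume "g \<in> set (dynkin_word (\<lambda>_. a) (\<lambda>y. y) rs)"
    then have "g = (\<lambda>_. a) \<or> g = (\<lambda>y. y)" by (auto simp: dynkin_word_def split: if_splits)
    then show "C1_on U g" by (auto simp: C1_on_const intro: C1_on_bounded_linear bounded_linear_ident)
  qed
  then show ?thesis by (simp add: group_law_bch[abs_def] bch_def flip: dynkin_word_map)
qed

lemma gmul_assoc: "gmul (gmul x y) z = gmul x (gmul y z)"
  using semigroup.assoc[OF Groups.group.axioms(1)[OF group_law]] .

lemma gmul_zero_left [simp]: "gmul 0 x = x"
  using Groups.group.group_left_neutral[OF group_law] .

lemma gmul_minus_left [simp]: "gmul (- x) x = 0"
  using Groups.group.left_inverse[OF group_law] .

lemma gmul_minus_right [simp]: "gmul x (- x) = 0"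
  using gmul_minus_left[of "- x"] by simp

lemma gmul_zero_right [simp]: "gmul x 0 = x"
  using gmul_assoc[of x "- x" x] by simp

text \<open>The left invariant field with value \<open>v\<close> at the identity is
  \<open>\<lambda>x. ldiff x v\<close>.\<close>

definition ldiff :: "'a \<Rightarrow> 'a \<Rightarrow> 'a" where
  "ldiff x = fderiv (gmul x) 0"

lemma gmul_has_derivative: "(gmul a has_derivative fderiv (gmul a) x) (at x)"
  by (rule C1_on_frechet_derivative(1)[OF C1_on_gmul, of _ UNIV]) simp

lemma linear_ldiff: "linear (ldiff x)"
  unfolding ldiff_def using gmul_has_derivative[of x 0] has_derivative_linear by blast

text \<open>Chain rule for the translations by \<open>x\<close> and by \<open>a\<close>, whose
  composition is the translation by their product. It gives left invariance of the fields above and,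
  for \<open>a = - x\<close>, a left inverse of \<open>ldiff x\<close>.\<close>

lemma frechet_derivative_gmul_ldiff:
  "fderiv (gmul a) x (ldiff x v) = ldiff (gmul a x) v"
proof -
  have "((\<lambda>y. gmul a (gmul x y)) has_derivative
      (\<lambda>v. fderiv (gmul a) (gmul x 0) (ldiff x v))) (at 0)"
    unfolding ldiff_def by (rule has_derivative_compose[OF gmul_has_derivative gmul_has_derivative])
  moreover have "(\<lambda>y. gmul a (gmul x y)) = gmul (gmul a x)" by (auto simp: gmul_assoc)
  ultimately have "(\<lambda>v. fderiv (gmul a) x (ldiff x v)) = ldiff (gmul a x)"
    unfolding ldiff_def[of "gmul a x"] by (intro frechet_derivative_at) simp
  then show ?thesis by (rule fun_cong)
qed

lemma ldiff_zero [simp]: "ldiff 0 v = v"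
proof -
  have "gmul 0 = (\<lambda>x. x)" by auto
  then show ?thesis by (simp add: ldiff_def frechet_derivative_ident)
qed

lemma inj_ldiff: "inj (ldiff x)"
proof (rule inj_on_inverseI)
  fix v
  show "fderiv (gmul (- x)) x (ldiff x v) = v"
    by (simp add: frechet_derivative_gmul_ldiff)
qed

lemma surj_ldiff: "surj (ldiff x)"
  using linear_injective_imp_surjective[OF linear_ldiff inj_ldiff refl] .

lemma left_invariant_fields_eq: "left_invariant_fields gmul = range (\<lambda>v x. ldiff x v)"
proof (intro subset_antisym subsetI)
  fix X assume "X \<in> left_invariant_fields gmul"
  then have "\<forall>p x. X (gmul p x) = fderiv (gmul p) x (X x)"
    by (simp add: left_invariant_fields_def)
  then have "X p = ldiff p (X 0)" for p
    unfolding ldiff_def by (metis gmul_zero_right)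
  then have "X = (\<lambda>x. ldiff x (X 0))" by (rule ext)
  then show "X \<in> range (\<lambda>v x. ldiff x v)" by (rule range_eqI)
next
  fix X assume "X \<in> range (\<lambda>v x. ldiff x v)"
  then obtain v where "X = (\<lambda>x. ldiff x v)" by (rule rangeE)
  then show "X \<in> left_invariant_fields gmul"
    by (simp add: left_invariant_fields_def frechet_derivative_gmul_ldiff)
qed

lemma nested_bracket_scale_True:
  "nested_bracket br (map (\<lambda>b. if b then t *\<^sub>R y else x) bs) =
    t ^ length (filter id bs) *\<^sub>R nested_bracket br (map (\<lambda>b. if b then y else x) bs)"
proof (induction bs)
  case (Cons b bs)
  then show ?case by (cases "bs = []") (auto simp: nested_bracket_Cons bracket_simps)
qed simp

lemma nested_bracket_replicate: "2 \<le> b \<Longrightarrow> nested_bracket br (replicate b x) = 0"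
proof (induction b rule: dec_induct)
  case base
  show ?case by (simp add: numeral_2_eq_2 bracket_alternating)
next
  case (step b)
  then show ?case by (cases b) (auto simp: nested_bracket_Cons bracket_simps)
qed

text \<open>For a right-nested word with a single \<open>y\<close> followed by \<open>b\<close>
  letters \<open>x\<close>: for b = 1 the innermost bracket is [y, x] = -[x, y], and for larger
  \<open>b\<close> it is [x, x] = 0.\<close>

definition bracket_sign :: "nat \<Rightarrow> real" where
  "bracket_sign b = (if b = 0 then 1 else if b = 1 then - 1 else 0)"

lemma nested_bracket_one_letter:
  "nested_bracket br (replicate a x @ y # replicate b x) = bracket_sign b *\<^sub>R (br x ^^ (a + b)) y"
proof (induction a)
  case 0
  consider "b = 0" | "b = 1" | "2 \<le> b" by linarith
  then show ?case
  proof cases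
    case 3
    then have "replicate b x \<noteq> []" by auto
    then show ?thesis
      using 3 by (simp add: nested_bracket_Cons nested_bracket_replicate bracket_simps bracket_sign_def)
  qed (auto simp: bracket_sign_def bracket_anticommute[of y x])
next
  case (Suc a)
  have "nested_bracket br (replicate (Suc a) x @ y # replicate b x) =
      br x (nested_bracket br (replicate a x @ y # replicate b x))"
    by (simp add: nested_bracket_Cons)
  then show ?case using Suc by (simp add: bracket_simps)
qed

text \<open>Collects the words of degree k + 1 with exactly one \<open>y\<close>; the
  \<open>takeWhile\<close> counts the trailing \<open>x\<close>. For k < \<iota> these are the
  Taylor coefficients of z / (1 - exp (-z)), but only the values at 0 and 1 have to be
  known.\<close>

definition ad_coeff :: "nat \<Rightarrow> real" where
  "ad_coeff k = (\<Sum>rs | rs \<in> dynkin_index \<iota> \<and> length (filter id (dynkin_word False True rs)) = 1 \<and>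
      dynkin_degree rs = Suc k.
     dynkin_coeff rs * bracket_sign (length (takeWhile Not (rev (dynkin_word False True rs)))))"

lemma nested_bracket_word_one_True:
  assumes "length (filter id bs) = 1"
  shows "nested_bracket br (map (\<lambda>b. if b then y else x) bs) =
    bracket_sign (length (takeWhile Not (rev bs))) *\<^sub>R (br x ^^ (length bs - 1)) y"
proof -
  obtain a b where bs: "bs = replicate a False @ True # replicate b False"
    using one_True_split[OF assms] .
  have "length (takeWhile Not (rev bs)) = b"
    unfolding bs by (simp add: takeWhile_append)
  then show ?thesis using nested_bracket_one_letter[of a x y b] by (simp add: bs)
qed

text \<open>Only words with exactly one \<open>v\<close> have a nonzero derivative at t = 0, and
  each of them is a signed power of \<open>br x\<close> applied to \<open>v\<close>. The sum is
  regrouped by that power.\<close>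

lemma bch_has_vector_derivative:
  "((\<lambda>t. bch br \<iota> x (t *\<^sub>R v)) has_vector_derivative (\<Sum>k<\<iota>. ad_coeff k *\<^sub>R (br x ^^ k) v)) (at 0)"
proof -
  let ?W = "dynkin_word False True" and ?nb = "\<lambda>bs. nested_bracket br (map (\<lambda>b. if b then v else x) bs)"
  let ?c = "\<lambda>rs. length (filter id (?W rs))"
  have eq: "bch br \<iota> x (t *\<^sub>R v) = (\<Sum>rs\<in>dynkin_index \<iota>. (t ^ ?c rs * dynkin_coeff rs) *\<^sub>R ?nb (?W rs))" for t
    unfolding bch_def
    by (subst dynkin_word_bool, subst nested_bracket_scale_True) (simp add: mult.commute)
  have "((\<lambda>t. bch br \<iota> x (t *\<^sub>R v)) has_vector_derivative
      (\<Sum>rs\<in>dynkin_index \<iota>. ((if ?c rs = 1 then 1 else 0) * dynkin_coeff rs) *\<^sub>R ?nb (?W rs))) (at 0)"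
    unfolding eq
    by (intro has_vector_derivative_sum has_vector_derivative_monomial_0)
  also have "(\<Sum>rs\<in>dynkin_index \<iota>. ((if ?c rs = 1 then 1 else 0) * dynkin_coeff rs) *\<^sub>R ?nb (?W rs)) =
      (\<Sum>rs | rs \<in> dynkin_index \<iota> \<and> ?c rs = 1. dynkin_coeff rs *\<^sub>R ?nb (?W rs))"
    by (simp add: sum.inter_filter[OF finite_dynkin_index] if_distrib[of "\<lambda>c. c * _"]
        if_distrib[of "\<lambda>c. c *\<^sub>R _"] cong: if_cong)
  also have "\<dots> = (\<Sum>rs | rs \<in> dynkin_index \<iota> \<and> ?c rs = 1.
      (dynkin_coeff rs * bracket_sign (length (takeWhile Not (rev (?W rs))))) *\<^sub>R (br x ^^ (dynkin_degree rs - 1)) v)"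
    by (intro sum.cong refl) (simp add: nested_bracket_word_one_True length_dynkin_word)
  also have "\<dots> = (\<Sum>k<\<iota>. \<Sum>rs | rs \<in> {rs \<in> dynkin_index \<iota>. ?c rs = 1} \<and> dynkin_degree rs - 1 = k.
      (dynkin_coeff rs * bracket_sign (length (takeWhile Not (rev (?W rs))))) *\<^sub>R (br x ^^ (dynkin_degree rs - 1)) v)"
  proof (rule sum.group[symmetric])
    show "(\<lambda>rs. dynkin_degree rs - 1) ` {rs \<in> dynkin_index \<iota>. ?c rs = 1} \<subseteq> {..<\<iota>}"
      using step_pos by (auto simp: dynkin_index_def)
  qed (use finite_dynkin_index in auto)
  also have "\<dots> = (\<Sum>k<\<iota>. ad_coeff k *\<^sub>R (br x ^^ k) v)"
  proof (intro sum.cong refl)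
    fix k
    \<comment> \<open>A word containing \<open>True\<close> has positive degree, so the truncated
      subtraction is exact.\<close>
    have deg: "dynkin_degree rs - 1 = k \<longleftrightarrow> dynkin_degree rs = Suc k" if "?c rs = 1" for rs
    proof -
      have "1 \<le> dynkin_degree rs"
        using that length_filter_le[of id "?W rs"] by (simp add: length_dynkin_word)
      then show ?thesis by linarith
    qed
    have "{rs. rs \<in> {rs \<in> dynkin_index \<iota>. ?c rs = 1} \<and> dynkin_degree rs - 1 = k} =
       {rs. rs \<in> dynkin_index \<iota> \<and> ?c rs = 1 \<and> dynkin_degree rs = Suc k}"
      using deg by blast
    then show "(\<Sum>rs | rs \<in> {rs \<in> dynkin_index \<iota>. ?c rs = 1} \<and> dynkin_degree rs - 1 = k.
      (dynkin_coeff rs * bracket_sign (length (takeWhile Not (rev (?W rs))))) *\<^sub>R (br x ^^ (dynkin_degree rs - 1)) v)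
      = ad_coeff k *\<^sub>R (br x ^^ k) v"
      unfolding ad_coeff_def scaleR_sum_left by (intro sum.cong) auto
  qed
  finally show ?thesis .
qed

text \<open>The form of the differential on which the counting of orders rests: the term k = 0 is
  \<open>v\<close> itself, and every further term contains a bracket with \<open>x\<close>.\<close>

lemma ldiff_eq: "ldiff x v = (\<Sum>k<\<iota>. ad_coeff k *\<^sub>R (br x ^^ k) v)"
proof -
  have "((\<lambda>t. t *\<^sub>R v) has_derivative (\<lambda>t. t *\<^sub>R v)) (at (0::real))"
    by (intro derivative_eq_intros) auto
  then have "((\<lambda>t. gmul x (t *\<^sub>R v)) has_derivative (\<lambda>t. ldiff x (t *\<^sub>R v))) (at 0)"
    using has_derivative_compose[of "\<lambda>t. t *\<^sub>R v" "\<lambda>t. t *\<^sub>R v" 0 UNIV "gmul x" "ldiff x"]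
      gmul_has_derivative[of x 0] by (simp add: ldiff_def)
  then have "((\<lambda>t. gmul x (t *\<^sub>R v)) has_vector_derivative ldiff x v) (at 0)"
    by (simp add: has_vector_derivative_def linear_cmul[OF linear_ldiff])
  then show ?thesis
    using vector_derivative_unique_at bch_has_vector_derivative[of x v] by (simp add: group_law_bch)
qed

lemma dynkin_degree_ge_length: "\<forall>(r, s)\<in>set rs. 0 < r + s \<Longrightarrow> length rs \<le> dynkin_degree rs"
  by (induction rs) (auto simp: dynkin_degree_def)

lemma ad_coeff_0: "ad_coeff 0 = 1"
proof -
  have "{rs. rs \<in> dynkin_index \<iota> \<and> length (filter id (dynkin_word False True rs)) = 1 \<and>
      dynkin_degree rs = Suc 0} = {[(0, 1)]}"
  proof (intro subset_antisym subsetI)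
    fix rs assume "rs \<in> {rs. rs \<in> dynkin_index \<iota> \<and> length (filter id (dynkin_word False True rs)) = 1 \<and>
      dynkin_degree rs = Suc 0}"
    then have rs: "\<forall>(r, s)\<in>set rs. 0 < r + s" "rs \<noteq> []" "dynkin_degree rs = 1"
        "length (filter id (dynkin_word False True rs)) = 1"
      by (auto simp: dynkin_index_def)
    have "length rs \<le> 1" using dynkin_degree_ge_length[OF rs(1)] rs(3) by simp
    then obtain r s where "rs = [(r, s)]" using rs(2) by (cases rs) auto
    then show "rs \<in> {[(0, 1)]}" using rs by (auto simp: dynkin_degree_def dynkin_word_def)
  qed (use step_pos in \<open>auto simp: dynkin_index_def dynkin_degree_def dynkin_word_def\<close>)
  then show ?thesis
    unfolding ad_coeff_def by (simp add: dynkin_coeff_def dynkin_degree_def dynkin_word_def bracket_sign_def)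
qed

text \<open>The three lists are the ways to write the words xy and yx. They contribute 1/2, -1/4 and
  +1/4; in the last one the sign of [y, x] = -[x, y] cancels the sign of the Dynkin coefficient. In
  step one the truncation would remove these words.\<close>

lemma ad_coeff_1:
  assumes "2 \<le> \<iota>"
  shows "ad_coeff 1 = 1 / 2"
proof -
  have "{rs. rs \<in> dynkin_index \<iota> \<and> length (filter id (dynkin_word False True rs)) = 1 \<and>
      dynkin_degree rs = Suc 1} = {[(1, 1)], [(1, 0), (0, 1)], [(0, 1), (1, 0)]}"
  proof (intro subset_antisym subsetI)
    fix rs assume "rs \<in> {rs. rs \<in> dynkin_index \<iota> \<and> length (filter id (dynkin_word False True rs)) = 1 \<and>
      dynkin_degree rs = Suc 1}"
    then have rs: "\<forall>(r, s)\<in>set rs. 0 < r + s" "rs \<noteq> []" "dynkin_degree rs = 2"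
        "length (filter id (dynkin_word False True rs)) = 1"
      by (auto simp: dynkin_index_def)
    have "length rs \<le> 2" using dynkin_degree_ge_length[OF rs(1)] rs(3) by simp
    moreover obtain p ps where "rs = p # ps" using rs(2) by (cases rs) auto
    ultimately have "rs = [p] \<or> (\<exists>p'. rs = [p, p'])" by (cases ps) auto
    then consider r s where "rs = [(r, s)]" | r s r' s' where "rs = [(r, s), (r', s')]"
      by (metis surj_pair)
    then show "rs \<in> {[(1, 1)], [(1, 0), (0, 1)], [(0, 1), (1, 0)]}"
    proof cases
      case 1
      then show ?thesis using rs by (auto simp: dynkin_degree_def dynkin_word_def)
    next
      case (2 r s r' s')
      then have "r + s = 1" "r' + s' = 1" "s + s' = 1"
        using rs by (auto simp: dynkin_degree_def dynkin_word_def)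
      then have "(r = 1 \<and> s = 0 \<and> r' = 0 \<and> s' = 1) \<or> (r = 0 \<and> s = 1 \<and> r' = 1 \<and> s' = 0)"
        by linarith
      then show ?thesis using 2 by auto
    qed
  qed (use assms in \<open>auto simp: dynkin_index_def dynkin_degree_def dynkin_word_def\<close>)
  then show ?thesis
    unfolding ad_coeff_def by (simp add: dynkin_coeff_def dynkin_degree_def dynkin_word_def bracket_sign_def)
qed

lemma C1_on_ad_power: "C1_on U (\<lambda>x. (br x ^^ k) v)"
proof (induction k)
  case (Suc k)
  then show ?case
    using C1_on_bilinear[OF bounded_bilinear_bracket C1_on_bounded_linear[OF bounded_linear_ident]]
    by simp
qed (simp add: C1_on_const)

lemma C1_on_ldiff: "C1_on U (\<lambda>x. ldiff x v)"
  unfolding ldiff_eq by (intro C1_on_sum C1_on_scaleR C1_on_ad_power)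

lemma ad_power_scale: "(br (t *\<^sub>R x) ^^ k) v = t ^ k *\<^sub>R (br x ^^ k) v"
  by (induction k) (auto simp: bracket_simps)

text \<open>Complements \<open>ad_coeff_1\<close>: where the truncation removes the linear term of
  \<open>ldiff\<close>, that term is zero, because H 1 is the whole space and [H 1, H 1] lies in H 2
  = {0}.\<close>

lemma bracket_step_1:
  assumes "\<iota> = 1"
  shows "br x y = 0"
proof -
  have "span (H 1) = UNIV" using layers_span assms by simp
  moreover have "span (H 1) = H 1" by (intro span_eq_iff[THEN iffD2] layer_subspace) simp
  ultimately have "H 1 = UNIV" by metis
  then show ?thesis
    using bracket_graded[of 1 1 x y] layer_above_step[of 2] assms by (simp add: numeral_2_eq_2)
qed

text \<open>Along x = t w the k-th term of \<open>ldiff\<close> is homogeneous of degree k in t, so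
  only k = 1 survives, with coefficient 1/2.\<close>

lemma frechet_derivative_ldiff: "fderiv (\<lambda>x. ldiff x v) 0 w = (1 / 2) *\<^sub>R br w v"
proof -
  have "((\<lambda>t. t *\<^sub>R w) has_derivative (\<lambda>t. t *\<^sub>R w)) (at (0::real))"
    by (intro derivative_eq_intros) auto
  moreover have D: "((\<lambda>x. ldiff x v) has_derivative fderiv (\<lambda>x. ldiff x v) 0) (at 0)"
    by (rule C1_on_frechet_derivative(1)[OF C1_on_ldiff UNIV_I])
  ultimately have "((\<lambda>t. ldiff (t *\<^sub>R w) v) has_derivative
      (\<lambda>t. fderiv (\<lambda>x. ldiff x v) 0 (t *\<^sub>R w))) (at 0)"
    using has_derivative_compose[of "\<lambda>t. t *\<^sub>R w" "\<lambda>t. t *\<^sub>R w" 0 UNIV "\<lambda>x. ldiff x v"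
        "fderiv (\<lambda>x. ldiff x v) 0"]
    by (simp only: scaleR_zero_left)
  moreover have "linear (fderiv (\<lambda>x. ldiff x v) 0)"
    using D by (rule has_derivative_linear)
  ultimately have 1: "((\<lambda>t. ldiff (t *\<^sub>R w) v) has_vector_derivative
      fderiv (\<lambda>x. ldiff x v) 0 w) (at 0)"
    by (simp add: has_vector_derivative_def linear_cmul)
  have "((\<lambda>t. \<Sum>k<\<iota>. (t ^ k * ad_coeff k) *\<^sub>R (br w ^^ k) v) has_vector_derivative
      (\<Sum>k<\<iota>. ((if k = 1 then 1 else 0) * ad_coeff k) *\<^sub>R (br w ^^ k) v)) (at 0)"
    by (intro has_vector_derivative_sum has_vector_derivative_monomial_0)
  moreover have "(\<lambda>t. \<Sum>k<\<iota>. (t ^ k * ad_coeff k) *\<^sub>R (br w ^^ k) v) = (\<lambda>t. ldiff (t *\<^sub>R w) v)"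
    by (simp add: ldiff_eq ad_power_scale mult.commute)
  ultimately have "fderiv (\<lambda>x. ldiff x v) 0 w =
      (\<Sum>k<\<iota>. ((if k = 1 then 1 else 0) * ad_coeff k) *\<^sub>R (br w ^^ k) v)"
    using vector_derivative_unique_at[OF 1] by simp
  also have "\<dots> = (\<Sum>k<\<iota>. if k = 1 then ad_coeff 1 *\<^sub>R br w v else 0)"
    by (intro sum.cong) auto
  also have "\<dots> = (1 / 2) *\<^sub>R br w v"
    using ad_coeff_1 bracket_step_1[of w v] step_pos by (cases "\<iota> = 1") auto
  finally show ?thesis .
qed

text \<open>Each of the two derivatives contributes one half of [v, w], the second by antisymmetry.
  Algebraic regularity, stated for fields, can thus be read in the original bracket.\<close>

lemma field_bracket_ldiff: "field_bracket (\<lambda>x. ldiff x v) (\<lambda>x. ldiff x w) 0 = br v w"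
proof -
  have "field_bracket (\<lambda>x. ldiff x v) (\<lambda>x. ldiff x w) 0 = (1 / 2) *\<^sub>R br v w - (1 / 2) *\<^sub>R br w v"
    by (simp add: field_bracket_def frechet_derivative_ldiff)
  also have "\<dots> = (1 / 2 + 1 / 2) *\<^sub>R br v w"
    unfolding bracket_anticommute[of w v] scaleR_add_left by simp
  finally show ?thesis by simp
qed

end

section \<open>Tangent spaces and tangent multivectors\<close>

text \<open>Tested against the component \<open>z\<close> of \<open>v\<close> orthogonal to
  \<open>L\<close>, the curve is zero near 0; hence v \<bullet> z = 0, which is the squared norm of
  \<open>z\<close>.\<close>

lemma has_vector_derivative_in_subspace:
  fixes \<gamma> :: "real \<Rightarrow> 'a::euclidean_space"
  assumes "(\<gamma> has_vector_derivative v) (at 0)" "subspace L" "0 < \<epsilon>"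
    and "\<And>t. t \<in> {-\<epsilon><..<\<epsilon>} \<Longrightarrow> \<gamma> t \<in> L"
  shows "v \<in> L"
proof -
  obtain y z where yz: "y \<in> span L" "\<And>w. w \<in> span L \<Longrightarrow> z \<bullet> w = 0" "v = y + z"
    using orthogonal_subspace_decomp_exists[of L v]
    unfolding Linear_Algebra.orthogonal_def by blast
  have L: "span L = L" using assms(2) by (simp add: span_eq_iff)
  have "((\<lambda>t. \<gamma> t \<bullet> z) has_vector_derivative v \<bullet> z) (at 0)"
    by (rule bounded_linear.has_vector_derivative[OF bounded_linear_inner_left assms(1)])
  then have "((\<lambda>t. 0) has_vector_derivative v \<bullet> z) (at 0)"
    by (rule has_vector_derivative_transform_within_open[of _ _ _ "{-\<epsilon><..<\<epsilon>}"])
      (use assms(3,4) yz(2) L in \<open>auto simp: inner_commute[of _ z]\<close>)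
  then have "v \<bullet> z = 0"
    using vector_derivative_unique_at has_vector_derivative_const by blast
  moreover have "y \<bullet> z = 0" using yz(1,2) by (auto simp: inner_commute)
  ultimately have "z = 0" using yz(3) by (simp add: inner_add_left)
  then show ?thesis using yz(1,3) L by simp
qed

lemma tangent_spaceI:
  assumes "\<epsilon> > 0" "C1_on {-\<epsilon><..<\<epsilon>} \<gamma>" "\<gamma> ` {-\<epsilon><..<\<epsilon>} \<subseteq> S" "\<gamma> 0 = p"
    "(\<gamma> has_vector_derivative v) (at 0)"
  shows "v \<in> tangent_space S p"
  unfolding tangent_space_def
  by (rule CollectI, rule exI[of _ \<epsilon>], rule conjI[OF assms(1)], rule exI[of _ \<gamma>],
      intro conjI assms(2-5))

lemma tangent_space_image:
  assumes F: "C1_on UNIV F" and v: "v \<in> tangent_space S x"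
  shows "fderiv F x v \<in> tangent_space (F ` S) (F x)"
proof -
  obtain \<epsilon> \<gamma> where \<gamma>: "\<epsilon> > 0" "C1_on {-\<epsilon><..<\<epsilon>} \<gamma>" "\<gamma> ` {-\<epsilon><..<\<epsilon>} \<subseteq> S" "\<gamma> 0 = x"
      "(\<gamma> has_vector_derivative v) (at 0)"
    using v by (auto simp: tangent_space_def)
  have "C1_on {-\<epsilon><..<\<epsilon>} (\<lambda>t. F (\<gamma> t))"
    by (rule C1_on_compose[OF \<gamma>(2) F]) simp
  moreover have "((\<lambda>t. F (\<gamma> t)) has_vector_derivative fderiv F x v) (at 0)"
    using vector_derivative_diff_chain_within[OF \<gamma>(5), of F "fderiv F x"]
      C1_on_frechet_derivative(1)[OF F UNIV_I, of x] \<gamma>(4)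
    by (simp add: o_def has_derivative_at_withinI)
  moreover have "(\<lambda>t. F (\<gamma> t)) ` {-\<epsilon><..<\<epsilon>} \<subseteq> F ` S" using \<gamma>(3) by blast
  ultimately show ?thesis
    using \<gamma>(1,4) by (intro tangent_spaceI[of \<epsilon> "\<lambda>t. F (\<gamma> t)"]) simp_all
qed

text \<open>\<open>tangent_space\<close> is defined by curves and is not a priori linear. Flattening
  by the chart puts the velocities into \<open>L\<close>, and the derivative of the inverse chart
  carries them back. An upper bound is enough, since a parametrization supplies n independent
  tangent vectors in \<open>tangent_space_chart\<close>.\<close>

lemma tangent_space_subset_subspace:
  fixes S :: "'a::euclidean_space set"
  assumes "C1_submanifold n S" "p \<in> S"
  obtains W where "subspace W" "dim W \<le> n" "tangent_space S p \<subseteq> W"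
proof -
  from bspec[OF assms(1)[unfolded C1_submanifold_def] assms(2)]
  obtain V F G L and W :: "'a set" where c: "open V" "p \<in> V" "open W" "homeomorphism V W F G"
      "C1_on V F" "C1_on W G" "subspace L" "dim L = n" "F ` (S \<inter> V) = L \<inter> W"
    by blast
  let ?DF = "fderiv F p" and ?DG = "fderiv G (F p)"
  have Fp: "F p \<in> W" using c(2,4) by (auto simp: homeomorphism_def)
  have DF: "(F has_derivative ?DF) (at p)" and DG: "(G has_derivative ?DG) (at (F p))"
    using C1_on_frechet_derivative(1)[OF c(5,2)] C1_on_frechet_derivative(1)[OF c(6) Fp] .
  have lin: "linear ?DG" using DG has_derivative_linear by blast
  have "tangent_space S p \<subseteq> ?DG ` L"
  proof
    fix v assume "v \<in> tangent_space S p"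
    then obtain \<epsilon> \<gamma> where \<gamma>: "\<epsilon> > 0" "C1_on {-\<epsilon><..<\<epsilon>} \<gamma>" "\<gamma> ` {-\<epsilon><..<\<epsilon>} \<subseteq> S" "\<gamma> 0 = p"
        "(\<gamma> has_vector_derivative v) (at 0)"
      by (auto simp: tangent_space_def)
    have "continuous (at 0) \<gamma>" using \<gamma>(5) has_vector_derivative_continuous by blast
    then have "\<forall>\<^sub>F t in nhds 0. \<gamma> t \<in> V"
      using c(1,2) \<gamma>(4) by (metis continuous_at tendsto_nhds_iff topological_tendstoD)
    then obtain \<delta> where \<delta>: "\<delta> > 0" "\<And>t. dist t 0 < \<delta> \<Longrightarrow> \<gamma> t \<in> V"
      unfolding eventually_nhds_metric by blast
    have der: "((\<lambda>t. F (\<gamma> t)) has_vector_derivative ?DF v) (at 0)"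
      using vector_derivative_diff_chain_within[OF \<gamma>(5), of F ?DF] DF \<gamma>(4)
      by (simp add: o_def has_derivative_at_withinI)
    have "?DF v \<in> L"
    proof (rule has_vector_derivative_in_subspace[OF der c(7)])
      show "0 < min \<epsilon> \<delta>" using \<gamma>(1) \<delta>(1) by simp
      fix t assume "t \<in> {-min \<epsilon> \<delta><..<min \<epsilon> \<delta>}"
      then have "\<gamma> t \<in> S \<inter> V" using \<gamma>(3) \<delta>(2)[of t] by (auto simp: dist_real_def)
      then show "F (\<gamma> t) \<in> L" using c(9) by blast
    qed
    moreover have "?DG (?DF v) = v"
    proof -
      have "((\<lambda>x. G (F x)) has_derivative (\<lambda>v. ?DG (?DF v))) (at p)"
        by (rule has_derivative_compose[OF DF DG])
      moreover have "((\<lambda>x. x) has_derivative (\<lambda>v. v)) (at p)" by simp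
      then have "((\<lambda>x. G (F x)) has_derivative (\<lambda>v. v)) (at p)"
        by (rule has_derivative_transform_within_open[OF _ c(1,2)])
          (use c(4) in \<open>auto simp: homeomorphism_def\<close>)
      ultimately have "(\<lambda>v. ?DG (?DF v)) = (\<lambda>v. v)" by (rule has_derivative_unique)
      then show ?thesis by (rule fun_cong)
    qed
    ultimately show "v \<in> ?DG ` L" by (intro image_eqI[of _ _ "?DF v"]) simp_all
  qed
  moreover have "subspace (?DG ` L)" using linear_subspace_image[OF lin c(7)] .
  moreover have "dim (?DG ` L) \<le> n" using dim_image_le[OF lin, of L] c(8) by simp
  ultimately show ?thesis using that by blast
qed

lemma range_derivative_subset_tangent_space:
  fixes \<Psi> :: "'b::euclidean_space \<Rightarrow> 'a::euclidean_space"
  assumes U: "open U" "y \<in> U" and \<Psi>: "C1_on U \<Psi>" "\<Psi> ` U \<subseteq> S"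
  shows "range (fderiv \<Psi> y) \<subseteq> tangent_space S (\<Psi> y)"
proof
  fix v assume "v \<in> range (fderiv \<Psi> y)"
  then obtain h where v: "v = fderiv \<Psi> y h" by blast
  have line: "((\<lambda>t. y + t *\<^sub>R h) has_vector_derivative h) (at t)" for t :: real
    by (auto intro!: derivative_eq_intros)
  have "open ((\<lambda>t::real. y + t *\<^sub>R h) -` U)"
    by (intro open_vimage U(1) continuous_intros)
  moreover have "0 \<in> (\<lambda>t::real. y + t *\<^sub>R h) -` U" using U(2) by simp
  ultimately obtain \<epsilon> where \<epsilon>: "\<epsilon> > 0" "\<And>t. dist t 0 < \<epsilon> \<Longrightarrow> y + t *\<^sub>R h \<in> U"
    unfolding open_dist by blast
  let ?\<gamma> = "\<lambda>t. \<Psi> (y + t *\<^sub>R h)"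
  have sub: "(\<lambda>t. y + t *\<^sub>R h) ` {-\<epsilon><..<\<epsilon>} \<subseteq> U" using \<epsilon>(2) by (auto simp: dist_real_def)
  have "C1_on {-\<epsilon><..<\<epsilon>} (\<lambda>t. y + t *\<^sub>R h)"
    unfolding C1_on_euclidean_iff using line
    by (intro exI[of _ "\<lambda>t a. a *\<^sub>R h"]) (auto simp: has_vector_derivative_def)
  then have "C1_on {-\<epsilon><..<\<epsilon>} ?\<gamma>" using C1_on_compose[OF _ \<Psi>(1) sub] by blast
  moreover have "(?\<gamma> has_vector_derivative v) (at 0)"
    using vector_derivative_diff_chain_within[OF line[of 0], of \<Psi> "fderiv \<Psi> y"]
      C1_on_frechet_derivative(1)[OF \<Psi>(1) U(2)] v
    by (simp add: o_def has_derivative_at_withinI)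
  moreover have "?\<gamma> ` {-\<epsilon><..<\<epsilon>} \<subseteq> S" using sub \<Psi>(2) by blast
  ultimately show "v \<in> tangent_space S (\<Psi> y)"
    using \<epsilon>(1) by (intro tangent_spaceI[of \<epsilon> ?\<gamma>]) simp_all
qed

text \<open>If \<open>u i\<close> were a combination of the others, it could be exchanged for one of
  them while the remaining vectors stay in place. The resulting index map takes a value twice,
  although the exchange makes it injective.\<close>

lemma wedge_nonzero_independent:
  assumes "wedge n u w \<noteq> 0"
  shows "inj_on u {1..n}" "independent (u ` {1..n})"
proof -
  have nz: "wedge n w u \<noteq> 0" using assms by (simp add: wedge_commute)
  show inj: "inj_on u {1..n}"
    using alternating_form_repeat[OF alternating_form_wedge, of _ n _ u w] nz by (fastforce intro!: inj_onI)
  show "independent (u ` {1..n})"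
  proof
    assume "dependent (u ` {1..n})"
    then obtain i where i: "i \<in> {1..n}" "u i \<in> span (u ` {1..n} - {u i})"
      unfolding dependent_def by blast
    have "u ` {1..n} - {u i} = u ` ({1..n} - {i})"
      using inj_on_image_set_diff[OF inj, of "{1..n}" "{i}"] i(1) by simp
    then have "u j \<in> span (u ` (if j = i then {1..n} - {i} else {j}))" if "j \<in> {1..n}" for j
      using i by (auto intro: span_base)
    then obtain r where r: "\<And>j. j \<in> {1..n} \<Longrightarrow> r j \<in> (if j = i then {1..n} - {i} else {j})" "inj_on r {1..n}"
      by (rule alternating_form_nonzero_on_spanning[OF alternating_form_wedge nz]) (assumption | rule that)+
    then have "r i \<in> {1..n}" "r i \<noteq> i" "r (r i) = r i"
      using r(1)[OF i(1)] r(1)[of "r i"] by auto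
    then show False using inj_onD[OF r(2), of "r i" i] i(1) by simp
  qed
qed

section \<open>Translation and choice of the tangent multivector\<close>

context homogeneous_group
begin

lemma linear_frechet_gmul: "linear (fderiv (gmul a) x)"
  using gmul_has_derivative has_derivative_linear by blast

lemma frechet_gmul_inverse:
  "fderiv (gmul (- a)) (gmul a x) (fderiv (gmul a) x v) = v"
proof -
  obtain u where "v = ldiff x u" using surj_ldiff[of x] by (metis surjD)
  then show ?thesis by (simp add: frechet_derivative_gmul_ldiff flip: gmul_assoc)
qed

lemma inj_frechet_gmul: "inj (fderiv (gmul a) x)"
  using frechet_gmul_inverse by (rule inj_on_inverseI)

lemma tangent_space_translate:
  "tangent_space (gmul a ` S) (gmul a x) = fderiv (gmul a) x ` tangent_space S x"
proof (intro subset_antisym subsetI)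
  fix v assume v: "v \<in> tangent_space (gmul a ` S) (gmul a x)"
  obtain u where u: "v = ldiff (gmul a x) u" using surj_ldiff[of "gmul a x"] by (metis surjD)
  have "gmul (- a) ` gmul a ` S = S" by (simp add: image_image flip: gmul_assoc)
  then have "ldiff x u \<in> tangent_space S x"
    using tangent_space_image[OF C1_on_gmul v, of "- a"] u
    by (simp add: frechet_derivative_gmul_ldiff flip: gmul_assoc)
  moreover have "v = fderiv (gmul a) x (ldiff x u)"
    by (simp add: u frechet_derivative_gmul_ldiff)
  ultimately show "v \<in> fderiv (gmul a) x ` tangent_space S x" by blast
next
  fix v assume "v \<in> fderiv (gmul a) x ` tangent_space S x"
  then show "v \<in> tangent_space (gmul a ` S) (gmul a x)"
    using tangent_space_image[OF C1_on_gmul] by blast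
qed

text \<open>The differential of the translation carries left invariant fields to themselves and one
  tangent space to the other. The predicate under \<open>SOME\<close> is therefore the same at both
  points, and the choice returns the same multivector, not only a proportional one.\<close>

lemma tangent_multivector_translate:
  "tangent_multivector gmul n (gmul a ` S) (gmul a x) = tangent_multivector gmul n S x"
proof -
  let ?L = "fderiv (gmul a) x"
  have "inj_on (\<lambda>i. X i (gmul a x)) {1..n} \<longleftrightarrow> inj_on (\<lambda>i. X i x) {1..n}"
    "independent ((\<lambda>i. X i (gmul a x)) ` {1..n}) \<longleftrightarrow> independent ((\<lambda>i. X i x) ` {1..n})"
    "span ((\<lambda>i. X i (gmul a x)) ` {1..n}) = tangent_space (gmul a ` S) (gmul a x) \<longleftrightarrow>
      span ((\<lambda>i. X i x) ` {1..n}) = tangent_space S x"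
    if X: "\<forall>i\<in>{1..n}. X i \<in> left_invariant_fields gmul" for X :: "nat \<Rightarrow> 'a \<Rightarrow> 'a"
  proof -
    have eq: "X i (gmul a x) = ?L (X i x)" if "i \<in> {1..n}" for i
      using X that by (auto simp: left_invariant_fields_def)
    have im: "(\<lambda>i. X i (gmul a x)) ` {1..n} = ?L ` (\<lambda>i. X i x) ` {1..n}"
      using eq by (auto simp: image_image)
    show "inj_on (\<lambda>i. X i (gmul a x)) {1..n} \<longleftrightarrow> inj_on (\<lambda>i. X i x) {1..n}"
      unfolding inj_on_def by (simp add: eq inj_eq[OF inj_frechet_gmul] del: atLeastAtMost_iff)
    show "independent ((\<lambda>i. X i (gmul a x)) ` {1..n}) \<longleftrightarrow> independent ((\<lambda>i. X i x) ` {1..n})"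
      unfolding im
    proof
      assume "independent (?L ` (\<lambda>i. X i x) ` {1..n})"
      then show "independent ((\<lambda>i. X i x) ` {1..n})"
        using linear_independent_injective_image[OF linear_frechet_gmul[of "- a" "gmul a x"] _
            inj_on_subset[OF inj_frechet_gmul subset_UNIV], of "?L ` (\<lambda>i. X i x) ` {1..n}"]
        by (simp add: image_image frechet_gmul_inverse)
    next
      assume "independent ((\<lambda>i. X i x) ` {1..n})"
      then show "independent (?L ` (\<lambda>i. X i x) ` {1..n})"
        using linear_independent_injective_image[OF linear_frechet_gmul]
          inj_on_subset[OF inj_frechet_gmul subset_UNIV] by blast
    qed
    show "span ((\<lambda>i. X i (gmul a x)) ` {1..n}) = tangent_space (gmul a ` S) (gmul a x) \<longleftrightarrow>
      span ((\<lambda>i. X i x) ` {1..n}) = tangent_space S x"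
      unfolding im tangent_space_translate linear_span_image[OF linear_frechet_gmul]
      using inj_frechet_gmul by (simp add: inj_image_eq_iff)
  qed
  note iff = this
  show ?thesis
    unfolding tangent_multivector_def
  proof (rule arg_cong[where f = Eps], rule ext, rule ex_cong1)
    fix \<xi> :: "'a multivector" and X :: "nat \<Rightarrow> 'a \<Rightarrow> 'a"
    show "((\<forall>i\<in>{1..n}. X i \<in> left_invariant_fields gmul) \<and>
        inj_on (\<lambda>i. X i (gmul a x)) {1..n} \<and> independent ((\<lambda>i. X i (gmul a x)) ` {1..n}) \<and>
        span ((\<lambda>i. X i (gmul a x)) ` {1..n}) = tangent_space (gmul a ` S) (gmul a x) \<and>
        \<xi> = wedge n (\<lambda>i. X i 0)) \<longleftrightarrow>
      ((\<forall>i\<in>{1..n}. X i \<in> left_invariant_fields gmul) \<and>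
        inj_on (\<lambda>i. X i x) {1..n} \<and> independent ((\<lambda>i. X i x) ` {1..n}) \<and>
        span ((\<lambda>i. X i x) ` {1..n}) = tangent_space S x \<and>
        \<xi> = wedge n (\<lambda>i. X i 0))"
      by (cases "\<forall>i\<in>{1..n}. X i \<in> left_invariant_fields gmul") (simp_all only: iff simp_thms)
  qed
qed

text \<open>Whatever family \<open>SOME\<close> selects, translated to the identity it spans the
  same space as \<open>u\<close>. The two wedges are then multiples of each other, and one of them
  is nonzero. This makes the arbitrary choice computable.\<close>

lemma tangent_multivector_eq:
  assumes T: "ldiff x ` span (u ` {1..n}) = tangent_space S x" and nz: "wedge n u w \<noteq> 0"
  shows "\<exists>c. c \<noteq> 0 \<and> tangent_multivector gmul n S x = (\<lambda>w. c * wedge n u w)"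
proof -
  let ?P = "\<lambda>\<xi>. \<exists>X. (\<forall>i\<in>{1..n}. X i \<in> left_invariant_fields gmul) \<and>
        inj_on (\<lambda>i. X i x) {1..n} \<and> independent ((\<lambda>i. X i x) ` {1..n}) \<and>
        span ((\<lambda>i. X i x) ` {1..n}) = tangent_space S x \<and> \<xi> = wedge n (\<lambda>i. X i 0)"
  have "?P (wedge n u)"
  proof (intro exI[of _ "\<lambda>i x. ldiff x (u i)"] conjI ballI)
    show "inj_on (\<lambda>i. ldiff x (u i)) {1..n}"
      using comp_inj_on[OF wedge_nonzero_independent(1)[OF nz] inj_on_subset[OF inj_ldiff[of x] subset_UNIV]]
      by (simp add: o_def)
    show "independent ((\<lambda>i. ldiff x (u i)) ` {1..n})"
      using linear_independent_injective_image[OF linear_ldiff[of x] wedge_nonzero_independent(2)[OF nz]]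
        inj_on_subset[OF inj_ldiff[of x] subset_UNIV] by (simp add: image_image)
    show "span ((\<lambda>i. ldiff x (u i)) ` {1..n}) = tangent_space S x"
      using T linear_span_image[OF linear_ldiff[of x], of "u ` {1..n}"] by (simp add: image_image)
  qed (auto simp: left_invariant_fields_eq)
  then have "?P (tangent_multivector gmul n S x)"
    unfolding tangent_multivector_def by (rule someI[of ?P])
  then obtain X where X: "\<forall>i\<in>{1..n}. X i \<in> left_invariant_fields gmul"
      "span ((\<lambda>i. X i x) ` {1..n}) = tangent_space S x"
      "tangent_multivector gmul n S x = wedge n (\<lambda>i. X i 0)" by blast
  have "X i x = ldiff x (X i 0)" if i: "i \<in> {1..n}" for i
  proof -
    obtain v where "X i = (\<lambda>x. ldiff x v)"
      using bspec[OF X(1) i] unfolding left_invariant_fields_eq by (rule rangeE)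
    then show ?thesis by simp
  qed
  then have "(\<lambda>i. X i x) ` {1..n} = ldiff x ` (\<lambda>i. X i 0) ` {1..n}" by (auto simp: image_image)
  then have "ldiff x ` span ((\<lambda>i. X i 0) ` {1..n}) = ldiff x ` span (u ` {1..n})"
    using X(2) T linear_span_image[OF linear_ldiff[of x]] by simp
  then have span: "span ((\<lambda>i. X i 0) ` {1..n}) = span (u ` {1..n})"
    using inj_ldiff by (simp add: inj_image_eq_iff)
  obtain c where c: "\<And>w. wedge n (\<lambda>i. X i 0) w = c * wedge n u w"
    using wedge_scale_basis[of n "\<lambda>i. X i 0" u] unfolding span[symmetric]
    by (metis (lifting) image_eqI span_base)
  obtain c' where c': "\<And>w. wedge n u w = c' * wedge n (\<lambda>i. X i 0) w"
    using wedge_scale_basis[of n u "\<lambda>i. X i 0"] unfolding span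
    by (metis (lifting) image_eqI span_base)
  have "c \<noteq> 0" using c[of w] c'[of w] nz by auto
  then show ?thesis using X(3) c by (intro exI[of _ c]) auto
qed

context
  fixes e :: "nat \<Rightarrow> 'a"
  assumes basis: "orthonormal_graded_basis H \<iota> e"
begin

lemma degree_part_support:
  assumes "degree_part H e n M \<xi> \<noteq> (\<lambda>w. 0)"
  shows "M \<in> sum (deg) ` Pow {1..DIM('a)}"
proof (rule ccontr)
  assume "M \<notin> sum (deg) ` Pow {1..DIM('a)}"
  then have "{I. I \<subseteq> {1..DIM('a)} \<and> card I = n \<and> (\<Sum>i\<in>I. deg i) = M} = {}" by auto
  then have "degree_part H e n M \<xi> = (\<lambda>w. 0)" unfolding degree_part_def by (simp only: sum.empty)
  then show False using assms by simp
qed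

lemma finite_degrees: "finite {M. degree_part H e n M \<xi> \<noteq> (\<lambda>w. 0)}"
  by (rule finite_subset[of _ "sum (deg) ` Pow {1..DIM('a)}"]) (use degree_part_support in auto)

lemma pointwise_degree_le:
  assumes "x \<in> S"
  shows "pointwise_degree gmul H e n S x \<le> submanifold_degree gmul H e n S"
  unfolding submanifold_degree_def
proof (rule Max_ge)
  \<comment> \<open>Where no degree part is nonzero, the pointwise degree is the unspecified number
    \<open>Max {}\<close>. Counting it as one more possible value keeps the set of pointwise degrees
    finite.\<close>
  have "pointwise_degree gmul H e n S y \<in> insert (Max {}) (sum (deg) ` Pow {1..DIM('a)})" for y
  proof (cases "{M. degree_part H e n M (tangent_multivector gmul n S y) \<noteq> (\<lambda>w. 0)} = {}")
    case True
    then show ?thesis by (simp add: pointwise_degree_def)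
  next
    case False
    from Max_in[OF finite_degrees this] show ?thesis
      using degree_part_support by (auto simp: pointwise_degree_def)
  qed
  then show "finite (pointwise_degree gmul H e n S ` S)"
    by (intro finite_subset[OF image_subsetI]) (assumption, simp)
qed (use assms in simp)

lemma degree_part_le_pointwise_degree:
  assumes "degree_part H e n M (tangent_multivector gmul n S x) \<noteq> (\<lambda>w. 0)"
  shows "M \<le> pointwise_degree gmul H e n S x"
  unfolding pointwise_degree_def using assms by (intro Max_ge finite_degrees) simp

text \<open>The frame \<open>v\<close> consists of leading vectors \<open>v'\<close> in the layers
  \<open>g i\<close> plus terms of lower degree. No coefficient has a degree above the sum of the
  \<open>g i\<close>, and the part in that degree is carried by the leading vectors alone.\<close>

lemma pointwise_degree_leading:
  assumes \<xi>: "tangent_multivector gmul n S x = (\<lambda>w. c * wedge n v w)" "c \<noteq> 0" "wedge n v' w \<noteq> 0"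
    and g: "\<And>i. i \<in> {1..n} \<Longrightarrow> g i \<in> {1..\<iota>}" "\<And>i. i \<in> {1..n} \<Longrightarrow> v' i \<in> H (g i)"
    and lower: "\<And>i j x. i \<in> {1..n} \<Longrightarrow> g i \<le> j \<Longrightarrow> x \<in> H j \<Longrightarrow> (v i - v' i) \<bullet> x = 0"
  shows "pointwise_degree gmul H e n S x = (\<Sum>i=1..n. g i)"
    and "degree_part H e n (pointwise_degree gmul H e n S x) (tangent_multivector gmul n S x) =
      (\<lambda>w. c * wedge n v' w)"
proof -
  have eq: "degree_part H e n M (tangent_multivector gmul n S x) =
      (\<lambda>w. if M = (\<Sum>i=1..n. g i) then c * wedge n v' w else 0)" if "(\<Sum>i=1..n. g i) \<le> M" for M
    unfolding \<xi>(1) by (rule degree_part_leading[OF basis]) (assumption | rule g lower that)+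
  have nz: "degree_part H e n (\<Sum>i=1..n. g i) (tangent_multivector gmul n S x) \<noteq> (\<lambda>w. 0)"
    using eq[OF order_refl] \<xi>(2,3) by (auto dest: fun_cong[of _ _ w])
  show deg: "pointwise_degree gmul H e n S x = (\<Sum>i=1..n. g i)"
    unfolding pointwise_degree_def
  proof (rule Max_eqI[OF finite_degrees])
    fix M assume M: "M \<in> {M. degree_part H e n M (tangent_multivector gmul n S x) \<noteq> (\<lambda>w. 0)}"
    show "M \<le> (\<Sum>i=1..n. g i)"
    proof (rule ccontr)
      assume "\<not> M \<le> (\<Sum>i=1..n. g i)"
      then have "degree_part H e n M (tangent_multivector gmul n S x) = (\<lambda>w. 0)"
        using eq[of M] by simp
      then show False using M by simp
    qed
  qed (use nz in simp)
  show "degree_part H e n (pointwise_degree gmul H e n S x) (tangent_multivector gmul n S x) =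
      (\<lambda>w. c * wedge n v' w)"
    using eq[of "\<Sum>i=1..n. g i"] deg by simp
qed

end

lemma pointwise_degree_translate:
  "pointwise_degree gmul H e n (gmul a ` S) (gmul a x) = pointwise_degree gmul H e n S x"
  by (simp add: pointwise_degree_def tangent_multivector_translate)

lemma tangent_fields_translate:
  "tangent_fields gmul H e n (gmul a ` S) (gmul a x) = tangent_fields gmul H e n S x"
  by (simp add: tangent_fields_def tangent_multivector_translate pointwise_degree_translate)

end

section \<open>Curves tangent to a graded distribution\<close>

text \<open>Uniformity in \<tau>: Landau symbols over such a product filter are estimates along
  whole curves, with constants independent of \<tau>.\<close>

lemma eventually_prod_principal:
  "eventually P (F \<times>\<^sub>F principal A) \<longleftrightarrow> (\<forall>\<^sub>F t in F. \<forall>\<tau>\<in>A. P (t, \<tau>))"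
proof
  assume "eventually P (F \<times>\<^sub>F principal A)"
  then obtain Pf Pg where "eventually Pf F" "\<forall>\<tau>\<in>A. Pg \<tau>" "\<And>x y. Pf x \<Longrightarrow> Pg y \<Longrightarrow> P (x, y)"
    unfolding eventually_prod_filter eventually_principal by blast
  then show "\<forall>\<^sub>F t in F. \<forall>\<tau>\<in>A. P (t, \<tau>)" by (auto elim: eventually_mono)
next
  assume ev: "\<forall>\<^sub>F t in F. \<forall>\<tau>\<in>A. P (t, \<tau>)"
  show "eventually P (F \<times>\<^sub>F principal A)"
    unfolding eventually_prod_filter eventually_principal
    by (rule exI[of _ "\<lambda>t. \<forall>\<tau>\<in>A. P (t, \<tau>)"], rule exI[of _ "\<lambda>\<tau>. \<tau> \<in> A"]) (use ev in auto)
qed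

lemma increment_bound:
  fixes f f' :: "real \<Rightarrow> real"
  assumes "\<And>\<tau>. \<tau> \<in> {0..1} \<Longrightarrow> (f has_real_derivative f' \<tau>) (at \<tau> within {0..1})" "f 0 = 0"
    and "\<And>\<tau>. \<tau> \<in> {0..1} \<Longrightarrow> norm (f' \<tau>) \<le> B" and "\<tau> \<in> {0..1}"
  shows "norm (f \<tau>) \<le> B"
proof -
  have "norm (f \<tau> - f 0) \<le> B * norm (\<tau> - 0)"
    using assms by (intro field_differentiable_bound[of "{0..1}" f f']) auto
  moreover have "0 \<le> B" using assms(3)[of 0] norm_ge_zero order_trans by (metis atLeastAtMost_iff order_refl zero_le_one)
  moreover have "B * norm (\<tau> - 0) \<le> B * 1" using \<open>0 \<le> B\<close> assms(4) by (intro mult_left_mono) auto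
  ultimately show ?thesis using assms(2) by simp
qed

context
  fixes f f' :: "'t \<times> real \<Rightarrow> real" and F :: "'t filter" and g :: "'t \<Rightarrow> real"
  assumes deriv: "\<forall>\<^sub>F t in F. \<forall>\<tau>\<in>{0..1}. ((\<lambda>\<tau>. f (t, \<tau>)) has_real_derivative f' (t, \<tau>)) (at \<tau> within {0..1})"
    and start: "\<forall>\<^sub>F t in F. f (t, 0) = 0"
begin

text \<open>Mean value inequality on an interval of length 1, for a comparison function that does
  not depend on \<tau>. The constant \<open>c\<close> is preserved, so this serves big O and small o
  alike.\<close>

lemma integrate_norm_le:
  assumes "\<forall>\<^sub>F p in F \<times>\<^sub>F principal {0..1}. norm (f' p) \<le> c * norm (g (fst p))"
  shows "\<forall>\<^sub>F p in F \<times>\<^sub>F principal {0..1}. norm (f p) \<le> c * norm (g (fst p))"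
  unfolding eventually_prod_principal
  using deriv start assms[unfolded eventually_prod_principal]
proof eventually_elim
  case (elim t)
  show ?case
  proof
    fix \<tau> :: real assume "\<tau> \<in> {0..1}"
    then show "norm (f (t, \<tau>)) \<le> c * norm (g (fst (t, \<tau>)))"
      by (rule increment_bound[where f' = "\<lambda>\<tau>. f' (t, \<tau>)", rotated 3]) (use elim in auto)
  qed
qed

lemma integrate_bigo:
  "f' \<in> O[F \<times>\<^sub>F principal {0..1}](\<lambda>p. g (fst p)) \<Longrightarrow> f \<in> O[F \<times>\<^sub>F principal {0..1}](\<lambda>p. g (fst p))"
  unfolding bigo_def using integrate_norm_le by blast

lemma integrate_smallo:
  "f' \<in> o[F \<times>\<^sub>F principal {0..1}](\<lambda>p. g (fst p)) \<Longrightarrow> f \<in> o[F \<times>\<^sub>F principal {0..1}](\<lambda>p. g (fst p))"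
  unfolding smallo_def using integrate_norm_le by blast

end

lemma power_bigo_mono:
  fixes \<rho> :: "'p \<Rightarrow> real"
  assumes "(\<rho> \<longlongrightarrow> 0) F" "b \<le> a"
  shows "(\<lambda>p. \<rho> p ^ a) \<in> O[F](\<lambda>p. \<rho> p ^ b)"
proof (rule bigoI[of _ 1])
  have "\<forall>\<^sub>F p in F. norm (\<rho> p) < 1"
    using order_tendstoD(2)[OF tendsto_norm[OF assms(1)], of 1] by simp
  then show "\<forall>\<^sub>F p in F. norm (\<rho> p ^ a) \<le> 1 * norm (\<rho> p ^ b)"
  proof eventually_elim
    case (elim p)
    then show ?case using power_decreasing[OF assms(2), of "\<bar>\<rho> p\<bar>"] by (simp add: power_abs)
  qed
qed

lemma power_smallo_mono:
  fixes \<rho> :: "'p \<Rightarrow> real"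
  assumes "(\<rho> \<longlongrightarrow> 0) F" "b < a"
  shows "(\<lambda>p. \<rho> p ^ a) \<in> o[F](\<lambda>p. \<rho> p ^ b)"
proof -
  have "(\<lambda>p. \<rho> p ^ (a - b)) \<in> o[F](\<lambda>p. 1)"
    using tendsto_power[OF assms(1), of "a - b"] assms(2) by (intro smalloI_tendsto) (auto simp: power_0_left)
  then have "(\<lambda>p. \<rho> p ^ (a - b) * \<rho> p ^ b) \<in> o[F](\<lambda>p. 1 * \<rho> p ^ b)"
    by (rule landau_o.small_big_mult) simp
  then show ?thesis using assms(2) by (simp flip: power_add)
qed

section \<open>Orders of vanishing of brackets and of curves\<close>

context homogeneous_group
begin

context
  fixes e :: "nat \<Rightarrow> 'a"
  assumes basis: "orthonormal_graded_basis H \<iota> e"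
begin

lemma bracket_basis_degree:
  assumes "i \<in> {1..DIM('a)}" "j \<in> {1..DIM('a)}" "s \<in> {1..DIM('a)}"
    and "deg s \<noteq> deg i + deg j"
  shows "br (e i) (e j) \<bullet> e s = 0"
proof (rule layer_inner_basis[OF basis _ _ assms(3,4)])
  show "br (e i) (e j) \<in> H (deg i + deg j)"
    using assms index_degree_bounds[OF basis] basis_mem_layer[OF basis]
    by (intro bracket_graded) auto
qed (use assms index_degree_bounds[OF basis assms(1)] in auto)

lemma bracket_coordinate:
  "br x v \<bullet> e s = (\<Sum>i=1..DIM('a). \<Sum>j=1..DIM('a). (x \<bullet> e i) * (v \<bullet> e j) * (br (e i) (e j) \<bullet> e s))"
proof -
  have "br x v = br (\<Sum>i=1..DIM('a). (x \<bullet> e i) *\<^sub>R e i) (\<Sum>j=1..DIM('a). (v \<bullet> e j) *\<^sub>R e j)"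
    by (rule arg_cong2[OF basis_sum[OF basis] basis_sum[OF basis]])
  also have "\<dots> = (\<Sum>i=1..DIM('a). \<Sum>j=1..DIM('a). br ((x \<bullet> e i) *\<^sub>R e i) ((v \<bullet> e j) *\<^sub>R e j))"
    by (simp only: bilinear_sum[OF bracket_bilinear] sum.cartesian_product)
  finally have "br x v = (\<Sum>i=1..DIM('a). \<Sum>j=1..DIM('a). br ((x \<bullet> e i) *\<^sub>R e i) ((v \<bullet> e j) *\<^sub>R e j))" .
  then show ?thesis by (simp add: inner_sum_left bracket_simps mult.assoc mult.left_commute)
qed

lemma bracket_bigo:
  assumes "s \<in> {1..DIM('a)}"
    and "\<And>i j. i \<in> {1..DIM('a)} \<Longrightarrow> j \<in> {1..DIM('a)} \<Longrightarrow>
      deg s = deg i + deg j \<Longrightarrow>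
      (\<lambda>p. (x p \<bullet> e i) * (v p \<bullet> e j)) \<in> O[F](g)"
  shows "(\<lambda>p. br (x p) (v p) \<bullet> e s) \<in> O[F](g)"
proof (subst bracket_coordinate, rule big_sum_in_bigo, rule big_sum_in_bigo)
  fix i j assume ij: "i \<in> {1..DIM('a)}" "j \<in> {1..DIM('a)}"
  show "(\<lambda>p. (x p \<bullet> e i) * (v p \<bullet> e j) * (br (e i) (e j) \<bullet> e s)) \<in> O[F](g)"
  proof (cases "br (e i) (e j) \<bullet> e s = 0")
    case False
    then have "deg s = deg i + deg j"
      using bracket_basis_degree[OF ij assms(1)] by blast
    from assms(2)[OF ij this] False show ?thesis by simp
  qed simp
qed

text \<open>The premise may also assume a nonzero structure constant; this lets the subalgebra
  property exclude pairs of indices.\<close>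

lemma bracket_smallo:
  assumes "s \<in> {1..DIM('a)}"
    and "\<And>i j. i \<in> {1..DIM('a)} \<Longrightarrow> j \<in> {1..DIM('a)} \<Longrightarrow>
      deg s = deg i + deg j \<Longrightarrow> br (e i) (e j) \<bullet> e s \<noteq> 0 \<Longrightarrow>
      (\<lambda>p. (x p \<bullet> e i) * (v p \<bullet> e j)) \<in> o[F](g)"
  shows "(\<lambda>p. br (x p) (v p) \<bullet> e s) \<in> o[F](g)"
proof (subst bracket_coordinate, rule big_sum_in_smallo, rule big_sum_in_smallo)
  fix i j assume ij: "i \<in> {1..DIM('a)}" "j \<in> {1..DIM('a)}"
  show "(\<lambda>p. (x p \<bullet> e i) * (v p \<bullet> e j) * (br (e i) (e j) \<bullet> e s)) \<in> o[F](g)"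
  proof (cases "br (e i) (e j) \<bullet> e s = 0")
    case False
    then have "deg s = deg i + deg j"
      using bracket_basis_degree[OF ij assms(1)] by blast
    from assms(2)[OF ij this False] False show ?thesis by simp
  qed simp
qed

lemma ldiff_minus_coordinate:
  "(ldiff x v - v) \<bullet> e s = (\<Sum>k=1..<\<iota>. ad_coeff k * ((br x ^^ k) v \<bullet> e s))"
proof -
  have "ldiff x v = (\<Sum>k=0..<\<iota>. ad_coeff k *\<^sub>R (br x ^^ k) v)" by (simp add: ldiff_eq atLeast0LessThan)
  also have "\<dots> = v + (\<Sum>k=1..<\<iota>. ad_coeff k *\<^sub>R (br x ^^ k) v)"
    using step_pos by (subst sum.atLeast_Suc_lessThan) (auto simp: ad_coeff_0)
  finally show ?thesis by (simp add: inner_sum_left)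
qed

text \<open>Every term of \<open>ldiff x v - v\<close> contains a bracket with \<open>x\<close>. One
  bracket raises the truncation of the orders from \<open>D\<close> to \<open>Suc D\<close>, and
  further brackets do not lower it.\<close>

lemma ldiff_minus_bigo:
  fixes \<rho> :: "'p \<Rightarrow> real" and x v :: "'p \<Rightarrow> 'a"
  assumes \<rho>: "(\<rho> \<longlongrightarrow> 0) F" and D: "1 \<le> D"
    and x: "\<And>l. l \<in> {1..DIM('a)} \<Longrightarrow> (\<lambda>p. x p \<bullet> e l) \<in> O[F](\<lambda>p. \<rho> p ^ min (deg l) D)"
    and v: "\<And>l. l \<in> {1..DIM('a)} \<Longrightarrow> (\<lambda>p. v p \<bullet> e l) \<in> O[F](\<lambda>p. \<rho> p ^ min (deg l) D)"
    and s: "s \<in> {1..DIM('a)}"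
  shows "(\<lambda>p. (ldiff (x p) (v p) - v p) \<bullet> e s) \<in> O[F](\<lambda>p. \<rho> p ^ min (deg s) (Suc D))"
proof -
  have step: "(\<lambda>p. br (x p) (z p) \<bullet> e s) \<in> O[F](\<lambda>p. \<rho> p ^ min (deg s) (Suc D))"
    if z: "\<And>l. l \<in> {1..DIM('a)} \<Longrightarrow> (\<lambda>p. z p \<bullet> e l) \<in> O[F](\<lambda>p. \<rho> p ^ min (deg l) D)"
      and s: "s \<in> {1..DIM('a)}" for z s
  proof (rule bracket_bigo[OF s])
    fix i j assume ij: "i \<in> {1..DIM('a)}" "j \<in> {1..DIM('a)}"
      and deg: "deg s = deg i + deg j"
    have "1 \<le> deg i" "1 \<le> deg j"
      using index_degree_bounds[OF basis] ij by auto
    \<comment> \<open>If one of the degrees exceeds \<open>D\<close>, it contributes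
      \<open>D\<close> and the other at least 1; otherwise nothing is truncated and the sum is the
      degree of \<open>s\<close>.\<close>
    then have "min (deg s) (Suc D) \<le> min (deg i) D + min (deg j) D"
      using D deg by linarith
    then have "(\<lambda>p. \<rho> p ^ min (deg i) D * \<rho> p ^ min (deg j) D) \<in>
        O[F](\<lambda>p. \<rho> p ^ min (deg s) (Suc D))"
      unfolding power_add[symmetric] by (rule power_bigo_mono[OF \<rho>])
    then show "(\<lambda>p. (x p \<bullet> e i) * (z p \<bullet> e j)) \<in> O[F](\<lambda>p. \<rho> p ^ min (deg s) (Suc D))"
      using landau_o.big.mult[OF x[OF ij(1)] z[OF ij(2)]] landau_o.big_trans by blast
  qed
  have ad: "(\<lambda>p. (br (x p) ^^ k) (v p) \<bullet> e l) \<in> O[F](\<lambda>p. \<rho> p ^ min (deg l) D)"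
    if "l \<in> {1..DIM('a)}" for k l
    using that
  proof (induction k arbitrary: l)
    case (Suc k)
    have "(\<lambda>p. \<rho> p ^ min (deg l) (Suc D)) \<in> O[F](\<lambda>p. \<rho> p ^ min (deg l) D)"
      by (rule power_bigo_mono[OF \<rho>]) auto
    then show ?case using landau_o.big_trans[OF step[OF Suc.IH Suc.prems]] by simp
  qed (simp add: v)
  show ?thesis
    unfolding ldiff_minus_coordinate
  proof (rule big_sum_in_bigo)
    fix k assume "k \<in> {1..<\<iota>}"
    then obtain k' where k': "k = Suc k'" by (cases k) auto
    have "(\<lambda>p. (br (x p) ^^ k) (v p) \<bullet> e s) \<in> O[F](\<lambda>p. \<rho> p ^ min (deg s) (Suc D))"
      unfolding k' using step[OF ad s, of k'] by simp
    then show "(\<lambda>p. ad_coeff k * ((br (x p) ^^ k) (v p) \<bullet> e s)) \<in>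
        O[F](\<lambda>p. \<rho> p ^ min (deg s) (Suc D))" by (cases "ad_coeff k = 0") auto
  qed
qed

text \<open>A nonzero structure constant into an index outside \<open>I\<close> forces one of the
  two factors outside \<open>I\<close>, and that factor is of small o. Its degree is below that of
  \<open>s\<close>, the other degree being positive, so small o for \<open>x\<close> is needed in
  lower layers only. This fits an induction over the layers.\<close>

lemma ldiff_minus_smallo:
  fixes \<rho> :: "'p \<Rightarrow> real" and x v :: "'p \<Rightarrow> 'a"
  assumes subalgebra: "\<And>i j s. i \<in> I \<Longrightarrow> j \<in> I \<Longrightarrow> s \<in> {1..DIM('a)} - I \<Longrightarrow> br (e i) (e j) \<bullet> e s = 0"
    and x: "\<And>l. l \<in> {1..DIM('a)} \<Longrightarrow> (\<lambda>p. x p \<bullet> e l) \<in> O[F](\<lambda>p. \<rho> p ^ deg l)"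
      "\<And>l. l \<in> {1..DIM('a)} - I \<Longrightarrow> deg l < m \<Longrightarrow> (\<lambda>p. x p \<bullet> e l) \<in> o[F](\<lambda>p. \<rho> p ^ deg l)"
    and v: "\<And>l. l \<in> {1..DIM('a)} \<Longrightarrow> (\<lambda>p. v p \<bullet> e l) \<in> O[F](\<lambda>p. \<rho> p ^ deg l)"
      "\<And>l. l \<in> {1..DIM('a)} - I \<Longrightarrow> (\<lambda>p. v p \<bullet> e l) \<in> o[F](\<lambda>p. \<rho> p ^ deg l)"
    and s: "s \<in> {1..DIM('a)} - I" "deg s \<le> m"
  shows "(\<lambda>p. (ldiff (x p) (v p) - v p) \<bullet> e s) \<in> o[F](\<lambda>p. \<rho> p ^ deg s)"
proof -
  have bigo: "(\<lambda>p. (br (x p) ^^ k) (v p) \<bullet> e l) \<in> O[F](\<lambda>p. \<rho> p ^ deg l)"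
    if "l \<in> {1..DIM('a)}" for k l
    using that
  proof (induction k arbitrary: l)
    case (Suc k)
    have "(\<lambda>p. br (x p) ((br (x p) ^^ k) (v p)) \<bullet> e l) \<in> O[F](\<lambda>p. \<rho> p ^ deg l)"
    proof (rule bracket_bigo[OF Suc.prems])
      fix i j assume ij: "i \<in> {1..DIM('a)}" "j \<in> {1..DIM('a)}"
        and deg: "deg l = deg i + deg j"
      then show "(\<lambda>p. (x p \<bullet> e i) * ((br (x p) ^^ k) (v p) \<bullet> e j)) \<in> O[F](\<lambda>p. \<rho> p ^ deg l)"
        using landau_o.big.mult[OF x(1)[OF ij(1)] Suc.IH[OF ij(2)]] by (simp add: power_add)
    qed
    then show ?case by simp
  qed (simp add: v)
  have smallo: "(\<lambda>p. (br (x p) ^^ k) (v p) \<bullet> e l) \<in> o[F](\<lambda>p. \<rho> p ^ deg l)"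
    if "l \<in> {1..DIM('a)} - I" "deg l \<le> m" for k l
    using that
  proof (induction k arbitrary: l)
    case (Suc k)
    have l: "l \<in> {1..DIM('a)}" using Suc.prems by simp
    have "(\<lambda>p. br (x p) ((br (x p) ^^ k) (v p)) \<bullet> e l) \<in> o[F](\<lambda>p. \<rho> p ^ deg l)"
    proof (rule bracket_smallo[OF l])
      fix i j assume ij: "i \<in> {1..DIM('a)}" "j \<in> {1..DIM('a)}"
        and deg: "deg l = deg i + deg j"
        and nz: "br (e i) (e j) \<bullet> e l \<noteq> 0"
      have pos: "1 \<le> deg i" "1 \<le> deg j"
        using index_degree_bounds[OF basis] ij by auto
      consider "i \<notin> I" | "j \<notin> I" using subalgebra[of i j l] nz Suc.prems(1) by blast
      then show "(\<lambda>p. (x p \<bullet> e i) * ((br (x p) ^^ k) (v p) \<bullet> e j)) \<in> o[F](\<lambda>p. \<rho> p ^ deg l)"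
      proof cases
        case 1
        then have "(\<lambda>p. x p \<bullet> e i) \<in> o[F](\<lambda>p. \<rho> p ^ deg i)"
          using x(2)[of i] ij deg pos Suc.prems(2) by auto
        from landau_o.small_big_mult[OF this bigo[OF ij(2), of k]] show ?thesis by (simp add: power_add deg)
      next
        case 2
        then have "(\<lambda>p. (br (x p) ^^ k) (v p) \<bullet> e j) \<in> o[F](\<lambda>p. \<rho> p ^ deg j)"
          using Suc.IH[of j] ij deg pos Suc.prems(2) by auto
        from landau_o.big_small_mult[OF x(1)[OF ij(1)] this] show ?thesis by (simp add: power_add deg)
      qed
    qed
    then show ?case by simp
  qed (simp add: v)
  show ?thesis
    unfolding ldiff_minus_coordinate
  proof (rule big_sum_in_smallo)
    fix k
    show "(\<lambda>p. ad_coeff k * ((br (x p) ^^ k) (v p) \<bullet> e s)) \<in> o[F](\<lambda>p. \<rho> p ^ deg s)"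
      using smallo[OF s, of k] by (cases "ad_coeff k = 0") auto
  qed
qed

text \<open>The tangential coordinates of the velocity are controlled by hypothesis. Passing to the
  left translated velocity \<open>\<omega>\<close> costs brackets with \<open>\<gamma>\<close>, which gain one order because every degree is
  positive; the relation \<open>graph\<close> then transfers the gain to the remaining coordinates. Once the
  optimal orders are reached, the remaining coordinates improve layer by layer to small o, since
  the leading terms stay in the subalgebra spanned by the \<open>e l\<close> with \<open>l \<in> I\<close>.\<close>

theorem tangential_curve_smallo:
  fixes F :: "'t filter" and \<rho> :: "'t \<Rightarrow> real" and \<gamma> \<omega> \<gamma>' :: "'t \<times> real \<Rightarrow> 'a"
    and c :: "nat \<Rightarrow> nat \<Rightarrow> 't \<times> real \<Rightarrow> real"
  defines "G \<equiv> F \<times>\<^sub>F principal {0..1::real}"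
  assumes \<rho>: "(\<rho> \<longlongrightarrow> 0) F" and I: "I \<subseteq> {1..DIM('a)}"
    and subalgebra: "\<And>i j s. i \<in> I \<Longrightarrow> j \<in> I \<Longrightarrow> s \<in> {1..DIM('a)} - I \<Longrightarrow> br (e i) (e j) \<bullet> e s = 0"
    and deriv: "\<forall>\<^sub>F t in F. \<forall>\<tau>\<in>{0..1}.
      ((\<lambda>\<tau>. \<gamma> (t, \<tau>)) has_vector_derivative \<gamma>' (t, \<tau>)) (at \<tau> within {0..1})"
    and start: "\<forall>\<^sub>F t in F. \<gamma> (t, 0) = 0"
    and field: "\<forall>\<^sub>F p in G. \<gamma>' p = ldiff (\<gamma> p) (\<omega> p)"
    and base: "\<And>l. l \<in> {1..DIM('a)} \<Longrightarrow> (\<lambda>p. \<gamma> p \<bullet> e l) \<in> O[G](\<lambda>p. \<rho> (fst p))"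
      "\<And>l. l \<in> {1..DIM('a)} \<Longrightarrow> (\<lambda>p. \<omega> p \<bullet> e l) \<in> O[G](\<lambda>p. \<rho> (fst p))"
    and tangential: "\<And>k. k \<in> I \<Longrightarrow> (\<lambda>p. \<gamma>' p \<bullet> e k) \<in> O[G](\<lambda>p. \<rho> (fst p) ^ deg k)"
    and graph: "\<And>l. l \<in> {1..DIM('a)} - I \<Longrightarrow> \<forall>\<^sub>F p in G.
      \<omega> p \<bullet> e l = (\<Sum>k | k \<in> I \<and> deg l \<le> deg k. (\<omega> p \<bullet> e k) * c k l p)"
    and c_bigo: "\<And>k l. k \<in> I \<Longrightarrow> l \<in> {1..DIM('a)} - I \<Longrightarrow> c k l \<in> O[G](\<lambda>_. 1)"
    and c_smallo: "\<And>k l. k \<in> I \<Longrightarrow> l \<in> {1..DIM('a)} - I \<Longrightarrow> deg k = deg l \<Longrightarrow>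
      c k l \<in> o[G](\<lambda>_. 1)"
    and s: "s \<in> {1..DIM('a)} - I"
  shows "(\<lambda>p. \<gamma> p \<bullet> e s) \<in> o[G](\<lambda>p. \<rho> (fst p) ^ deg s)"
proof -
  let ?d = "deg"
  have "filterlim fst F G" unfolding G_def by (rule filterlim_fst)
  from filterlim_compose[OF \<rho> this] have \<rho>G: "((\<lambda>p. \<rho> (fst p)) \<longlongrightarrow> 0) G" .
  have deriv': "\<forall>\<^sub>F t in F. \<forall>\<tau>\<in>{0..1}.
      ((\<lambda>\<tau>. \<gamma> (t, \<tau>) \<bullet> e l) has_real_derivative \<gamma>' (t, \<tau>) \<bullet> e l) (at \<tau> within {0..1})" for l
    using deriv by eventually_elim
      (auto simp: has_real_derivative_iff_has_vector_derivative
        intro: bounded_linear.has_vector_derivative[OF bounded_linear_inner_left])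
  have start': "\<forall>\<^sub>F t in F. \<gamma> (t, 0) \<bullet> e l = 0" for l
    using start by eventually_elim simp
  note bigo = integrate_bigo[OF deriv' start', where g = "\<lambda>t. \<rho> t ^ m" for m, folded G_def]
  note smallo = integrate_smallo[OF deriv' start', where g = "\<lambda>t. \<rho> t ^ m" for m, folded G_def]
  have split: "\<forall>\<^sub>F p in G. \<gamma>' p \<bullet> e l = \<omega> p \<bullet> e l + (ldiff (\<gamma> p) (\<omega> p) - \<omega> p) \<bullet> e l" for l
    using field by eventually_elim (simp add: inner_diff_left)
  have pos: "1 \<le> ?d l" if "l \<in> {1..DIM('a)}" for l
    using index_degree_bounds[OF basis that] by simp
  \<comment> \<open>The orders are truncated at \<open>D\<close>, starting from the linear bounds at
    D = 1. One round of the bootstrap passes from \<open>D\<close> to \<open>Suc D\<close>, and at D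
    = \<iota> the truncation is void.\<close>
  have orders: "(\<forall>l\<in>{1..DIM('a)}. (\<lambda>p. \<gamma> p \<bullet> e l) \<in> O[G](\<lambda>p. \<rho> (fst p) ^ min (?d l) D)) \<and>
      (\<forall>l\<in>{1..DIM('a)}. (\<lambda>p. \<omega> p \<bullet> e l) \<in> O[G](\<lambda>p. \<rho> (fst p) ^ min (?d l) D))" if "1 \<le> D" for D
    using that
  proof (induction D rule: dec_induct)
    case base
    have "min (?d l) 1 = 1" if "l \<in> {1..DIM('a)}" for l using pos[OF that] by simp
    then show ?case using assms(8,9) by simp
  next
    case (step D)
    let ?g = "\<lambda>l p. \<rho> (fst p) ^ min (?d l) (Suc D)"
    have br: "(\<lambda>p. (ldiff (\<gamma> p) (\<omega> p) - \<omega> p) \<bullet> e l) \<in> O[G](?g l)" if "l \<in> {1..DIM('a)}" for l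
      using step that by (intro ldiff_minus_bigo[OF \<rho>G]) auto
    \<comment> \<open>The velocity is \<omega> plus brackets that already have the new order, so the
      known order of the velocity passes to \<omega>.\<close>
    have \<omega>I: "(\<lambda>p. \<omega> p \<bullet> e k) \<in> O[G](?g k)" if k: "k \<in> I" for k
    proof -
      have "(\<lambda>p. \<gamma>' p \<bullet> e k) \<in> O[G](?g k)"
        using landau_o.big_trans[OF tangential[OF k] power_bigo_mono[OF \<rho>G, of "min (?d k) (Suc D)" "?d k"]]
        by simp
      from sum_in_bigo(2)[OF this br[of k]] have
        "(\<lambda>p. \<gamma>' p \<bullet> e k - (ldiff (\<gamma> p) (\<omega> p) - \<omega> p) \<bullet> e k) \<in> O[G](?g k)" using k I by blast
      moreover have "\<forall>\<^sub>F p in G. \<gamma>' p \<bullet> e k - (ldiff (\<gamma> p) (\<omega> p) - \<omega> p) \<bullet> e k = \<omega> p \<bullet> e k"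
        using split[of k] by eventually_elim simp
      ultimately show ?thesis by (simp cong: landau_o.big.in_cong)
    qed
    have \<omega>: "(\<lambda>p. \<omega> p \<bullet> e l) \<in> O[G](?g l)" if l: "l \<in> {1..DIM('a)}" for l
    proof (cases "l \<in> I")
      case False
      then have l': "l \<in> {1..DIM('a)} - I" using l by simp
      have "(\<lambda>p. \<Sum>k | k \<in> I \<and> ?d l \<le> ?d k. (\<omega> p \<bullet> e k) * c k l p) \<in> O[G](?g l)"
      proof (rule big_sum_in_bigo)
        fix k assume k: "k \<in> {k. k \<in> I \<and> ?d l \<le> ?d k}"
        then have "(\<lambda>p. (\<omega> p \<bullet> e k) * c k l p) \<in> O[G](\<lambda>p. ?g k p * 1)"
          using \<omega>I c_bigo l' by (intro landau_o.big.mult) auto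
        also have "(\<lambda>p. ?g k p * 1) \<in> O[G](?g l)"
          using power_bigo_mono[OF \<rho>G min.mono[of "?d l" "?d k" "Suc D" "Suc D"]] k by simp
        finally show "(\<lambda>p. (\<omega> p \<bullet> e k) * c k l p) \<in> O[G](?g l)" .
      qed
      then show ?thesis by (subst landau_o.big.in_cong[OF graph[OF l']])
    qed (rule \<omega>I)
    have "(\<lambda>p. \<gamma> p \<bullet> e l) \<in> O[G](?g l)" if l: "l \<in> {1..DIM('a)}" for l
    proof (rule bigo)
      show "(\<lambda>p. \<gamma>' p \<bullet> e l) \<in> O[G](?g l)"
        by (subst landau_o.big.in_cong[OF split]) (rule sum_in_bigo(1)[OF \<omega>[OF l] br[OF l]])
    qed
    then show ?case using \<omega> by simp
  qed
  have min: "min (?d l) \<iota> = ?d l" if "l \<in> {1..DIM('a)}" for l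
    using index_degree_bounds[OF basis that] by simp
  have \<gamma>O: "(\<lambda>p. \<gamma> p \<bullet> e l) \<in> O[G](\<lambda>p. \<rho> (fst p) ^ ?d l)"
    and \<omega>O: "(\<lambda>p. \<omega> p \<bullet> e l) \<in> O[G](\<lambda>p. \<rho> (fst p) ^ ?d l)" if "l \<in> {1..DIM('a)}" for l
    using orders[OF step_pos] that min[OF that] by metis+
  \<comment> \<open>For equal degrees the coefficient tends to zero; for a larger degree of
    \<open>k\<close> the power of \<rho> is higher.\<close>
  have \<omega>o: "(\<lambda>p. \<omega> p \<bullet> e l) \<in> o[G](\<lambda>p. \<rho> (fst p) ^ ?d l)" if l: "l \<in> {1..DIM('a)} - I" for l
  proof (subst landau_o.small.in_cong[OF graph[OF l]], rule big_sum_in_smallo)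
    fix k assume k: "k \<in> {k. k \<in> I \<and> ?d l \<le> ?d k}"
    then have kq: "k \<in> {1..DIM('a)}" using I by auto
    show "(\<lambda>p. (\<omega> p \<bullet> e k) * c k l p) \<in> o[G](\<lambda>p. \<rho> (fst p) ^ ?d l)"
    proof (cases "?d k = ?d l")
      case True
      then show ?thesis
        using landau_o.big_small_mult[OF \<omega>O[OF kq] c_smallo[of k l]] k l by simp
    next
      case False
      have "(\<lambda>p. (\<omega> p \<bullet> e k) * c k l p) \<in> O[G](\<lambda>p. \<rho> (fst p) ^ ?d k * 1)"
        using \<omega>O[OF kq] c_bigo k l by (intro landau_o.big.mult) auto
      moreover have "(\<lambda>p. \<rho> (fst p) ^ ?d k * 1) \<in> o[G](\<lambda>p. \<rho> (fst p) ^ ?d l)"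
        using power_smallo_mono[OF \<rho>G, of "?d l" "?d k"] False k by simp
      ultimately show ?thesis by (rule landau_o.big_small_trans)
    qed
  qed
  \<comment> \<open>In degree \<open>m\<close> the brackets require small o only for lower layers of
    \<gamma>, which the induction hypothesis covers.\<close>
  have "\<forall>l\<in>{1..DIM('a)} - I. ?d l < m \<longrightarrow> (\<lambda>p. \<gamma> p \<bullet> e l) \<in> o[G](\<lambda>p. \<rho> (fst p) ^ ?d l)" for m
  proof (induction m)
    case (Suc m)
    show ?case
    proof (intro ballI impI)
      fix l assume l: "l \<in> {1..DIM('a)} - I" and lm: "?d l < Suc m"
      have "(\<lambda>p. (ldiff (\<gamma> p) (\<omega> p) - \<omega> p) \<bullet> e l) \<in> o[G](\<lambda>p. \<rho> (fst p) ^ ?d l)"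
        by (rule ldiff_minus_smallo[OF subalgebra, where m = m]) (use \<gamma>O \<omega>O \<omega>o Suc l lm in auto)
      note br = this
      show "(\<lambda>p. \<gamma> p \<bullet> e l) \<in> o[G](\<lambda>p. \<rho> (fst p) ^ ?d l)"
      proof (rule smallo)
        show "(\<lambda>p. \<gamma>' p \<bullet> e l) \<in> o[G](\<lambda>p. \<rho> (fst p) ^ ?d l)"
          by (subst landau_o.small.in_cong[OF split]) (rule sum_in_smallo(1)[OF \<omega>o[OF l] br])
      qed
    qed
  qed simp
  then show ?thesis using s by blast
qed

end

end

section \<open>Special charts\<close>

text \<open>Convergence on the finitely many basis vectors bounds the operator norm of the
  difference. It turns the pointwise limits of \<open>D y\<close> and of \<open>ldiff\<close> into
  estimates uniform in the vector.\<close>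

lemma linear_family_uniform:
  fixes L :: "'p \<Rightarrow> 'a::euclidean_space \<Rightarrow> 'b::real_normed_vector"
  assumes lin: "\<forall>\<^sub>F y in F. linear (L y)" "linear L0"
    and lim: "\<And>h. ((\<lambda>y. L y h) \<longlongrightarrow> L0 h) F" and "0 < \<epsilon>"
  shows "\<forall>\<^sub>F y in F. \<forall>h. norm (L y h - L0 h) \<le> \<epsilon> * norm h"
proof -
  have "((\<lambda>y. \<Sum>i\<in>Basis. norm (L y i - L0 i)) \<longlongrightarrow> (\<Sum>i\<in>(Basis::'a set). norm (L0 i - L0 i))) F"
    by (intro tendsto_sum tendsto_norm tendsto_diff lim tendsto_const)
  then have "\<forall>\<^sub>F y in F. (\<Sum>i\<in>(Basis::'a set). norm (L y i - L0 i)) < \<epsilon>"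
    using order_tendstoD(2)[of _ 0 F \<epsilon>] assms(4) by simp
  then show ?thesis
    using lin(1)
  proof eventually_elim
    case (elim y)
    show ?case
    proof
      fix h :: 'a
      have lin': "linear (\<lambda>h. L y h - L0 h)" using elim(2) lin(2) by (intro linear_compose_sub)
      have "L y h - L0 h = (\<lambda>h. L y h - L0 h) (\<Sum>i\<in>Basis. (h \<bullet> i) *\<^sub>R i)"
        by (simp add: euclidean_representation)
      also have "\<dots> = (\<Sum>i\<in>Basis. (h \<bullet> i) *\<^sub>R (L y i - L0 i))"
        unfolding linear_sum[OF lin'] linear_cmul[OF lin'] ..
      finally have "L y h - L0 h = (\<Sum>i\<in>Basis. (h \<bullet> i) *\<^sub>R (L y i - L0 i))" .
      then have "norm (L y h - L0 h) \<le> (\<Sum>i\<in>Basis. norm ((h \<bullet> i) *\<^sub>R (L y i - L0 i)))"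
        by (metis norm_sum)
      also have "\<dots> \<le> (\<Sum>i\<in>Basis. norm h * norm (L y i - L0 i))"
        by (intro sum_mono) (simp add: mult_right_mono Basis_le_norm)
      also have "\<dots> \<le> \<epsilon> * norm h"
        unfolding sum_distrib_left[symmetric] using elim(1)
        by (subst mult.commute) (intro mult_right_mono, auto)
      finally show "norm (L y h - L0 h) \<le> \<epsilon> * norm h" .
    qed
  qed
qed

text \<open>Special coordinates freed from the block arithmetic: \<open>ix k\<close> is the basis
  index belonging to column \<open>k\<close>, and \<open>b k\<close> their common degree. By
  \<open>deriv_ix\<close> the rows \<open>ix j\<close> of the Jacobian matrix at 0 form the
  identity; by \<open>deriv_upper\<close> a column vanishes in all other rows of its own degree or
  higher.\<close>

locale special_chart = homogeneous_group br H \<iota> gmul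
  for br gmul :: "'a::euclidean_space \<Rightarrow> 'a \<Rightarrow> 'a" and H \<iota> +
  fixes e :: "nat \<Rightarrow> 'a" and idx :: "nat \<Rightarrow> 'n::finite" and ix b :: "nat \<Rightarrow> nat" and n :: nat
    and U :: "(real^'n) set" and \<Psi> :: "real^'n \<Rightarrow> 'a" and S :: "'a set"
  assumes basis: "orthonormal_graded_basis H \<iota> e"
    and idx: "bij_betw idx {1..n} UNIV"
    and ix: "k \<in> {1..n} \<Longrightarrow> ix k \<in> {1..DIM('a)}" "inj_on ix {1..n}"
    and degree_ix: "k \<in> {1..n} \<Longrightarrow> index_degree H (ix k) = b k"
    and U: "open U" "0 \<in> U"
    and C1: "C1_on U \<Psi>" and inj_deriv: "y \<in> U \<Longrightarrow> inj (fderiv \<Psi> y)"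
    and image: "\<Psi> ` U \<subseteq> S" and zero: "\<Psi> 0 = 0"
    and deriv_ix: "k \<in> {1..n} \<Longrightarrow> j \<in> {1..n} \<Longrightarrow>
      fderiv \<Psi> 0 (axis (idx k) 1) \<bullet> e (ix j) = (if j = k then 1 else 0)"
    and deriv_upper: "k \<in> {1..n} \<Longrightarrow> l \<in> {1..DIM('a)} - ix ` {1..n} \<Longrightarrow>
      b k \<le> index_degree H l \<Longrightarrow> fderiv \<Psi> 0 (axis (idx k) 1) \<bullet> e l = 0"
    and coordinate: "y \<in> U \<Longrightarrow> k \<in> {1..n} \<Longrightarrow> \<Psi> y \<bullet> e (ix k) = y $ idx k"
begin

abbreviation "D \<equiv> \<lambda>y. fderiv \<Psi> y"

abbreviation "ax \<equiv> \<lambda>k. axis (idx k) (1::real)"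

lemma n_eq: "n = CARD('n)"
  using bij_betw_same_card[OF idx] by simp

text \<open>\<open>D 0\<close> is a right inverse of this projection, so the range of
  \<open>D 0\<close> is a graph over the coordinates \<open>ix k\<close>.\<close>

definition proj :: "'a \<Rightarrow> real^'n" where
  "proj w = (\<Sum>k=1..n. (w \<bullet> e (ix k)) *\<^sub>R ax k)"

lemma idx_eq: "k \<in> {1..n} \<Longrightarrow> j \<in> {1..n} \<Longrightarrow> idx k = idx j \<longleftrightarrow> k = j"
  using idx unfolding bij_betw_def inj_on_def by blast

lemma ax_nth: "j \<in> {1..n} \<Longrightarrow> k \<in> {1..n} \<Longrightarrow> ax k $ idx j = (if j = k then 1 else 0)"
  using idx_eq by (simp add: axis_def)

lemma sum_axis_nth:
  assumes "j \<in> {1..n}"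
  shows "(\<Sum>k=1..n. f k *\<^sub>R ax k) $ idx j = f j"
proof -
  have "(\<Sum>k=1..n. f k *\<^sub>R ax k) $ idx j = (\<Sum>k=1..n. if k = j then f j else 0)"
    unfolding sum_component
    by (intro sum.cong refl) (use assms idx_eq in \<open>auto simp: axis_def\<close>)
  then show ?thesis using assms by simp
qed

lemma vec_eq_idxI:
  assumes "\<And>k. k \<in> {1..n} \<Longrightarrow> x $ idx k = y $ idx k"
  shows "x = (y :: real^'n)"
proof -
  have "x $ i = y $ i" for i
  proof -
    obtain k where "k \<in> {1..n}" "i = idx k" using idx unfolding bij_betw_def by blast
    then show ?thesis using assms by simp
  qed
  then show ?thesis by (simp add: Finite_Cartesian_Product.vec_eq_iff)
qed

lemma sum_axis: "(\<Sum>k=1..n. (y $ idx k) *\<^sub>R ax k) = y"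
  by (rule vec_eq_idxI) (rule sum_axis_nth)

lemma proj_nth: "k \<in> {1..n} \<Longrightarrow> proj w $ idx k = w \<bullet> e (ix k)"
  unfolding proj_def by (rule sum_axis_nth)

lemma linear_proj: "linear proj"
  unfolding proj_def
  by (rule linearI) (simp_all add: inner_add_left scaleR_add_left sum.distrib scaleR_sum_right)

lemma deriv: "y \<in> U \<Longrightarrow> (\<Psi> has_derivative D y) (at y)"
  by (rule C1_on_frechet_derivative(1)[OF C1])

lemma linear_D: "y \<in> U \<Longrightarrow> linear (D y)"
  using deriv has_derivative_linear by blast

lemma proj_D: "proj (D 0 h) = h"
proof -
  have lin: "linear (\<lambda>h. proj (D 0 h) - h)"
    by (intro linear_compose_sub linear_compose[OF linear_D[OF U(2)] linear_proj, unfolded o_def] linear_id[unfolded id_def])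
  have "proj (D 0 (ax k)) - ax k = 0" if k: "k \<in> {1..n}" for k
  proof -
    have "proj (D 0 (ax k)) = ax k"
    proof (rule vec_eq_idxI)
      fix j assume j: "j \<in> {1..n}"
      show "proj (D 0 (ax k)) $ idx j = ax k $ idx j"
        using proj_nth[OF j, of "D 0 (ax k)"] deriv_ix[OF k j] ax_nth[OF j k] by simp
    qed
    then show ?thesis by simp
  qed
  then have "(\<Sum>k=1..n. (h $ idx k) *\<^sub>R (proj (D 0 (ax k)) - ax k)) = 0"
    by (intro sum.neutral) simp
  also have "(\<Sum>k=1..n. (h $ idx k) *\<^sub>R (proj (D 0 (ax k)) - ax k)) =
      (\<lambda>h. proj (D 0 h) - h) (\<Sum>k=1..n. (h $ idx k) *\<^sub>R ax k)"
    unfolding linear_sum[OF lin] linear_cmul[OF lin] ..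
  finally show ?thesis unfolding sum_axis by simp
qed

lemma continuous_\<Psi>: "(\<Psi> \<longlongrightarrow> 0) (nhds 0)"
proof -
  have "isCont \<Psi> 0" using deriv[OF U(2)] has_derivative_continuous by blast
  then show ?thesis using zero by (simp add: continuous_at tendsto_nhds_iff)
qed

lemma eventually_U: "\<forall>\<^sub>F y in nhds 0. y \<in> U"
  using U eventually_nhds by blast

lemma tendsto_D: "((\<lambda>y. D y h) \<longlongrightarrow> D 0 h) (nhds 0)"
proof -
  have "isCont (\<lambda>y. D y h) 0"
    using C1_on_frechet_derivative(2)[OF C1, of h] U by (simp add: continuous_on_eq_continuous_at)
  then show ?thesis by (simp add: continuous_at tendsto_nhds_iff)
qed

lemma tendsto_ldiff: "((\<lambda>x. ldiff x v) \<longlongrightarrow> v) (nhds 0)"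
proof -
  have "isCont (\<lambda>x. ldiff x v) 0"
    using C1_on_frechet_derivative(3)[OF C1_on_ldiff, of UNIV v] by (simp add: continuous_on_eq_continuous_at)
  then show ?thesis by (simp add: continuous_at tendsto_nhds_iff)
qed

text \<open>\<open>D y\<close> is close to \<open>D 0\<close> and \<open>ldiff (\<Psi> y)\<close> to
  the identity. The distance from the range of \<open>D 0\<close> is measured against
  \<open>proj w\<close> alone, so \<open>proj w = 0\<close> forces \<open>w = 0\<close>: the
  translated tangent space is a graph.\<close>

lemma left_tangent_near:
  assumes "0 < \<epsilon>"
  shows "\<forall>\<^sub>F y in nhds 0. \<forall>w. ldiff (\<Psi> y) w \<in> range (D y) \<longrightarrow> norm (w - D 0 (proj w)) \<le> \<epsilon> * norm (proj w)"
proof -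
  obtain K where K: "0 < K" "\<And>h. norm (D 0 h) \<le> K * norm h"
    using linear_bounded_pos[OF linear_D[OF U(2)]] by blast
  obtain C where C: "0 < C" "\<And>w. norm (proj w) \<le> C * norm w"
    using linear_bounded_pos[OF linear_proj] by blast
  \<comment> \<open>The bound 1/2 absorbs the term with \<open>norm w\<close> and gives
    \<open>norm w \<le> (2 * K + 1) * norm h\<close>; the second bound makes \<open>proj w\<close>
    and \<open>h\<close> differ by at most half of \<open>norm h\<close>; the third brings the final
    constant down to \<epsilon>.\<close>
  define \<delta> where "\<delta> = min (1 / 2) (min (1 / (2 * C * (2 * K + 2))) (\<epsilon> / (2 * (2 * K + 2) * (1 + K * C))))"
  have pos: "0 < 2 * C * (2 * K + 2)" "0 < 2 * (2 * K + 2) * (1 + K * C)"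
    using K(1) C(1) by (simp_all add: add_pos_pos)
  have \<delta>: "0 < \<delta>" "\<delta> \<le> 1 / 2" "\<delta> * (2 * C * (2 * K + 2)) \<le> 1" "\<delta> * (2 * (2 * K + 2) * (1 + K * C)) \<le> \<epsilon>"
  proof -
    show "0 < \<delta>" using pos assms by (simp add: \<delta>_def)
    show "\<delta> \<le> 1 / 2" unfolding \<delta>_def by (rule min.cobounded1)
    have "\<delta> \<le> 1 / (2 * C * (2 * K + 2))" by (simp add: \<delta>_def)
    then show "\<delta> * (2 * C * (2 * K + 2)) \<le> 1" using pos(1) by (simp add: pos_le_divide_eq)
    have "\<delta> \<le> \<epsilon> / (2 * (2 * K + 2) * (1 + K * C))" by (simp add: \<delta>_def)
    then show "\<delta> * (2 * (2 * K + 2) * (1 + K * C)) \<le> \<epsilon>" using pos(2) by (simp only: pos_le_divide_eq)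
  qed
  have "\<forall>\<^sub>F y in nhds 0. linear (D y)" using eventually_U by eventually_elim (rule linear_D)
  from linear_family_uniform[OF this linear_D[OF U(2)] tendsto_D \<delta>(1)]
  have ev1: "\<forall>\<^sub>F y in nhds 0. \<forall>h. norm (D y h - D 0 h) \<le> \<delta> * norm h" .
  have "((\<lambda>y. ldiff (\<Psi> y) w) \<longlongrightarrow> w) (nhds 0)" for w
    using filterlim_compose[OF tendsto_ldiff continuous_\<Psi>] .
  from linear_family_uniform[OF always_eventually[OF allI[OF linear_ldiff]] linear_id[unfolded id_def] this \<delta>(1)]
  have ev2: "\<forall>\<^sub>F y in nhds 0. \<forall>w. norm (ldiff (\<Psi> y) w - w) \<le> \<delta> * norm w" .
  show ?thesis
    using ev1 ev2
  proof eventually_elim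
    case (elim y)
    show ?case
    proof (intro allI impI)
      fix w assume "ldiff (\<Psi> y) w \<in> range (D y)"
      then obtain h where h: "ldiff (\<Psi> y) w = D y h" by blast
      let ?r = "w - D 0 h"
      have "norm ?r = norm ((D y h - D 0 h) - (ldiff (\<Psi> y) w - w))" using h by simp
      also have "\<dots> \<le> norm (D y h - D 0 h) + norm (ldiff (\<Psi> y) w - w)" by (rule norm_triangle_ineq4)
      also have "\<dots> \<le> \<delta> * norm h + \<delta> * norm w" using elim by (intro add_mono) auto
      finally have r: "norm ?r \<le> \<delta> * norm h + \<delta> * norm w" .
      have "norm w \<le> norm (D 0 h) + norm ?r" using norm_triangle_ineq[of "D 0 h" ?r] by simp
      then have "norm w \<le> K * norm h + (1 / 2) * norm h + (1 / 2) * norm w"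
        using K(2)[of h] r mult_right_mono[OF \<delta>(2), of "norm h"] mult_right_mono[OF \<delta>(2), of "norm w"] by simp
      then have w: "norm w \<le> (2 * K + 1) * norm h" by (simp add: algebra_simps)
      have r': "norm ?r \<le> \<delta> * (2 * K + 2) * norm h"
      proof -
        have "\<delta> * norm w \<le> \<delta> * ((2 * K + 1) * norm h)" using w \<delta>(1) by (intro mult_left_mono) auto
        then show ?thesis using r by (simp add: algebra_simps)
      qed
      have diff: "proj w - h = proj ?r" by (simp add: linear_diff[OF linear_proj] proj_D)
      have hr: "norm (proj w - h) \<le> C * (\<delta> * (2 * K + 2) * norm h)"
        unfolding diff by (rule order_trans[OF C(2) mult_left_mono[OF r']]) (use C(1) in simp)
      have "C * (\<delta> * (2 * K + 2) * norm h) = \<delta> * (2 * C * (2 * K + 2)) * norm h / 2" by simp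
      also have "\<dots> \<le> norm h / 2" using mult_right_mono[OF \<delta>(3), of "norm h"] by simp
      finally have "norm (proj w - h) \<le> norm h / 2" using hr by simp
      then have h2: "norm h \<le> 2 * norm (proj w)"
        using norm_triangle_ineq2[of h "proj w"] by (simp add: norm_minus_commute)
      have "w - D 0 (proj w) = ?r - D 0 (proj w - h)" by (simp add: linear_diff[OF linear_D[OF U(2)]])
      then have "norm (w - D 0 (proj w)) \<le> norm ?r + norm (D 0 (proj w - h))"
        by (metis norm_triangle_ineq4)
      also have "norm (D 0 (proj w - h)) \<le> K * (C * (\<delta> * (2 * K + 2) * norm h))"
        by (rule order_trans[OF K(2) mult_left_mono[OF hr]]) (use K(1) in simp)
      also have "norm ?r + K * (C * (\<delta> * (2 * K + 2) * norm h)) \<le> (\<delta> * (2 * (2 * K + 2) * (1 + K * C)) / 2) * norm h"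
        using r' by (simp add: algebra_simps)
      also have "\<dots> \<le> \<epsilon> / 2 * norm h" using \<delta>(4) by (intro mult_right_mono divide_right_mono) auto
      also have "\<dots> \<le> \<epsilon> / 2 * (2 * norm (proj w))" using h2 assms by (intro mult_left_mono) auto
      finally show "norm (w - D 0 (proj w)) \<le> \<epsilon> * norm (proj w)" by simp
    qed
  qed
qed

lemma subspace_left_tangent: "y \<in> U \<Longrightarrow> subspace {w. ldiff (\<Psi> y) w \<in> range (D y)}"
  using linear_subspace_vimage[OF linear_ldiff[of "\<Psi> y"] linear_subspace_image[OF linear_D subspace_UNIV, of y]]
  by (simp add: vimage_def)

text \<open>The lift of the k-th coordinate axis to the graph. It exists and is unique for
  \<open>y\<close> near 0; elsewhere \<open>SOME\<close> may return an unspecified vector, so the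
  statements about it are eventual.\<close>

definition frame :: "nat \<Rightarrow> real^'n \<Rightarrow> 'a" where
  "frame k y = (SOME w. ldiff (\<Psi> y) w \<in> range (D y) \<and> proj w = ax k)"

text \<open>By the estimate with constant 1, \<open>proj\<close> is injective on the translated
  tangent space. Composed with the injective \<open>D y\<close> it yields an injective, hence
  surjective, endomorphism of \<open>real^'n\<close>, so the lifts exist. A tangent vector and the
  combination of lifts with its coordinates have the same projection, hence agree.\<close>

lemma eventually_frame:
  "\<forall>\<^sub>F y in nhds 0. (\<forall>k\<in>{1..n}. ldiff (\<Psi> y) (frame k y) \<in> range (D y) \<and> proj (frame k y) = ax k) \<and>
    (\<forall>w. ldiff (\<Psi> y) w \<in> range (D y) \<longrightarrow> w = (\<Sum>k=1..n. (w \<bullet> e (ix k)) *\<^sub>R frame k y))"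
proof -
  have "\<forall>\<^sub>F y in nhds 0. \<forall>w. ldiff (\<Psi> y) w \<in> range (D y) \<longrightarrow> norm (w - D 0 (proj w)) \<le> 1 * norm (proj w)"
    by (rule left_tangent_near) simp
  then show ?thesis
    using eventually_U
proof eventually_elim
  case (elim y)
  let ?T = "{w. ldiff (\<Psi> y) w \<in> range (D y)}"
  have sub: "subspace ?T" using subspace_left_tangent[OF elim(2)] .
  have inj: "w = 0" if "w \<in> ?T" "proj w = 0" for w
    using elim(1) that linear_0[OF linear_D[OF U(2)]] by auto
  obtain g where g: "linear g" "\<And>v. g (ldiff (\<Psi> y) v) = v"
    using linear_injective_left_inverse[OF linear_ldiff inj_ldiff, of "\<Psi> y"] by (auto simp: fun_eq_iff)
  have lg: "ldiff (\<Psi> y) (g v) = v" for v using surj_ldiff[of "\<Psi> y"] g(2) by (metis surjD)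
  let ?M = "\<lambda>h. proj (g (D y h))"
  have linM: "linear ?M"
    using linear_compose[OF linear_compose[OF linear_D[OF elim(2)] g(1)] linear_proj] by (simp add: o_def)
  have "inj ?M"
    unfolding linear_injective_0[OF linM]
  proof (intro allI impI)
    fix h assume "?M h = 0"
    then have "g (D y h) = 0" using inj[of "g (D y h)"] lg by auto
    then have "D y h = 0" using lg[of "D y h"] linear_0[OF linear_ldiff] by simp
    then show "h = 0" using inj_deriv[OF elim(2)] linear_injective_0[OF linear_D[OF elim(2)]] by blast
  qed
  then have "surj ?M" using linear_injective_imp_surjective[OF linM _ refl] by blast
  have ex: "\<exists>w. ldiff (\<Psi> y) w \<in> range (D y) \<and> proj w = ax k" for k
  proof -
    obtain h where "ax k = ?M h" using surjD[OF \<open>surj ?M\<close>] by blast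
    then show ?thesis by (intro exI[of _ "g (D y h)"]) (simp add: lg)
  qed
  have frame: "ldiff (\<Psi> y) (frame k y) \<in> range (D y) \<and> proj (frame k y) = ax k" for k
    unfolding frame_def by (rule someI_ex[OF ex])
  have "w = (\<Sum>k=1..n. (w \<bullet> e (ix k)) *\<^sub>R frame k y)" if w: "w \<in> ?T" for w
  proof -
    have "(\<Sum>k=1..n. (w \<bullet> e (ix k)) *\<^sub>R frame k y) \<in> ?T"
      using frame by (intro subspace_sum[OF sub] subspace_scale[OF sub]) auto
    then have "w - (\<Sum>k=1..n. (w \<bullet> e (ix k)) *\<^sub>R frame k y) \<in> ?T"
      using w by (intro subspace_diff[OF sub])
    moreover have "proj (\<Sum>k=1..n. (w \<bullet> e (ix k)) *\<^sub>R frame k y) = proj w"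
      using frame by (simp add: linear_sum[OF linear_proj] linear_cmul[OF linear_proj]) (simp add: proj_def)
    then have "proj (w - (\<Sum>k=1..n. (w \<bullet> e (ix k)) *\<^sub>R frame k y)) = 0"
      by (simp add: linear_diff[OF linear_proj])
    ultimately have "w - (\<Sum>k=1..n. (w \<bullet> e (ix k)) *\<^sub>R frame k y) = 0" using inj by blast
    then show ?thesis by simp
  qed
  then show ?case using frame by blast
qed
qed

lemma tendsto_frame:
  assumes "k \<in> {1..n}"
  shows "((\<lambda>y. frame k y) \<longlongrightarrow> D 0 (ax k)) (nhds 0)"
proof (rule tendstoI)
  fix \<epsilon> :: real assume "0 < \<epsilon>"
  then have "0 < \<epsilon> / 2" by simp
  from left_tangent_near[OF this] eventually_frame
  show "\<forall>\<^sub>F y in nhds 0. dist (frame k y) (D 0 (ax k)) < \<epsilon>"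
  proof eventually_elim
    case (elim y)
    then have "norm (frame k y - D 0 (proj (frame k y))) \<le> \<epsilon> / 2 * norm (proj (frame k y))"
      "proj (frame k y) = ax k" using assms by blast+
    then show ?case using \<open>0 < \<epsilon>\<close> by (simp add: dist_norm)
  qed
qed

lemma eventually_frame_nonzero:
  "\<forall>\<^sub>F y in nhds 0. \<forall>j\<in>{1..n}. \<forall>k\<in>{1..n}. frame k y \<bullet> e (ix j) = (if j = k then 1 else 0)"
  using eventually_frame
proof eventually_elim
  case (elim y)
  show ?case
  proof (intro ballI)
    fix j k assume jk: "j \<in> {1..n}" "k \<in> {1..n}"
    have "frame k y \<bullet> e (ix j) = ax k $ idx j" using elim jk proj_nth[OF jk(1), of "frame k y"] by metis
    also have "\<dots> = (if j = k then 1 else 0)" using jk by (rule ax_nth)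
    finally show "frame k y \<bullet> e (ix j) = (if j = k then 1 else 0)" .
  qed
qed

end

section \<open>The origin of the chart and the maximal degree\<close>

context special_chart
begin

lemma span_ax: "span (ax ` {1..n}) = UNIV"
proof -
  have "y \<in> span (ax ` {1..n})" for y
    using sum_axis[of y, symmetric] by (metis (no_types, lifting) imageI span_base span_scale span_sum)
  then show ?thesis by blast
qed

text \<open>The range of \<open>D y\<close> lies in the tangent space, which lies in
  \<open>W\<close>; the dimension n of the range is at least that of \<open>W\<close>, so all three
  agree.\<close>

lemma tangent_space_chart:
  assumes y: "y \<in> U" and W: "subspace W" "dim W \<le> n" "tangent_space S (\<Psi> y) \<subseteq> W"
  shows "tangent_space S (\<Psi> y) = range (D y)"
proof -
  have sub: "range (D y) \<subseteq> tangent_space S (\<Psi> y)"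
    by (rule range_derivative_subset_tangent_space[OF U(1) y C1 image])
  have "dim (range (D y)) = n"
    using dim_image_eq[OF linear_D[OF y], of UNIV] inj_deriv[OF y] by (simp add: n_eq)
  then have "range (D y) = W"
    using W sub by (intro subspace_dim_equal linear_subspace_image linear_D y) auto
  then show ?thesis using sub W(3) by blast
qed

lemma ix_inner:
  "i \<in> {1..n} \<Longrightarrow> j \<in> {1..n} \<Longrightarrow> e (ix i) \<bullet> e (ix j) = (if i = j then 1 else 0)"
  using basis_inner[OF basis ix(1) ix(1)] inj_on_eq_iff[OF ix(2)] by simp

lemma wedge_basis_ix: "wedge n (e \<circ> ix) (e \<circ> ix) = 1"
proof -
  have "wedge n (e \<circ> ix) (e \<circ> ix) = (\<Prod>i=1..n. (e \<circ> ix) i \<bullet> (e \<circ> ix) i)"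
    by (rule wedge_orthogonal) (simp add: ix_inner)
  also have "\<dots> = 1" using ix_inner by (intro prod.neutral) simp
  finally show ?thesis .
qed

lemma tangent_multivector_zero:
  assumes "tangent_space S 0 = range (D 0)"
  shows "\<exists>c. c \<noteq> 0 \<and> tangent_multivector gmul n S 0 = (\<lambda>w. c * wedge n (\<lambda>k. D 0 (ax k)) w)"
proof (rule tangent_multivector_eq)
  have "span ((\<lambda>k. D 0 (ax k)) ` {1..n}) = D 0 ` span (ax ` {1..n})"
    using linear_span_image[OF linear_D[OF U(2)], of "ax ` {1..n}"] by (simp add: image_image)
  then show "ldiff 0 ` span ((\<lambda>k. D 0 (ax k)) ` {1..n}) = tangent_space S 0"
    using assms span_ax by simp
  have "wedge n (\<lambda>k. D 0 (ax k)) (e \<circ> ix) = (\<Prod>k=1..n. D 0 (ax k) \<bullet> (e \<circ> ix) k)"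
    by (rule wedge_orthogonal) (simp add: deriv_ix)
  also have "\<dots> = 1" using deriv_ix by (intro prod.neutral) simp
  finally show "wedge n (\<lambda>k. D 0 (ax k)) (e \<circ> ix) \<noteq> 0" by simp
qed

lemma b_layer: "k \<in> {1..n} \<Longrightarrow> b k \<in> {1..\<iota>}"
  using index_degree_bounds[OF basis ix(1)] degree_ix by metis

lemma e_ix_layer: "k \<in> {1..n} \<Longrightarrow> e (ix k) \<in> H (b k)"
  using basis_mem_layer[OF basis ix(1)] degree_ix by metis

text \<open>The k-th column of the Jacobian matrix is \<open>e (ix k)\<close> plus a vector with
  components in degrees below \<open>b k\<close> only.\<close>

lemma deriv_leading:
  assumes k: "k \<in> {1..n}" and j: "b k \<le> j" and x: "x \<in> H j"
  shows "(D 0 (ax k) - e (ix k)) \<bullet> x = 0"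
proof (cases "j \<le> \<iota>")
  case True
  have j': "j \<in> {1..\<iota>}" using True j b_layer[OF k] by simp
  have span: "x \<in> span (e ` {s \<in> {1..DIM('a)}. deg s = j})"
    using x layer_span_indices[OF basis j'] by simp
  have lin: "linear (\<lambda>x. (D 0 (ax k) - e (ix k)) \<bullet> x)"
    by (rule linearI) (simp_all add: inner_add_right)
  show ?thesis
  proof (rule linear_eq_0_on_span[OF lin _ span])
    fix y assume "y \<in> e ` {s \<in> {1..DIM('a)}. deg s = j}"
    then obtain l where l: "l \<in> {1..DIM('a)}" "deg l = j" "y = e l" by blast
    show "(D 0 (ax k) - e (ix k)) \<bullet> y = 0"
    proof (cases "l \<in> ix ` {1..n}")
      case True
      then obtain i where i: "i \<in> {1..n}" "l = ix i" by blast
      then show ?thesis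
        using deriv_ix[OF k i(1)] basis_inner[OF basis ix(1)[OF k] ix(1)[OF i(1)]] inj_on_eq_iff[OF ix(2) k i(1)] l(3)
        by (auto simp: inner_diff_left)
    next
      case False
      then have "D 0 (ax k) \<bullet> e l = 0" using deriv_upper[OF k, of l] l j by blast
      moreover have "e (ix k) \<bullet> e l = 0" using basis_inner[OF basis ix(1)[OF k] l(1)] False k by auto
      ultimately show ?thesis using l(3) by (simp add: inner_diff_left)
    qed
  qed
next
  case False
  then have "x = 0" using layer_above_step[of j] x by auto
  then show ?thesis by simp
qed

context
  fixes f :: "nat \<Rightarrow> 'a"
  assumes basis': "orthonormal_graded_basis H \<iota> f" and tangent: "tangent_space S 0 = range (D 0)"
begin

text \<open>The degree refers to the basis \<open>f\<close>, the chart to the basis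
  \<open>e\<close>; both resolve the same layers. By \<open>deriv_leading\<close> the leading part
  of the tangent multivector is a multiple of the wedge of the orthonormal vectors
  \<open>e (ix k)\<close>, and the vectors annihilating it form their span.\<close>

lemma
  shows pointwise_degree_zero: "pointwise_degree gmul H f n S 0 = (\<Sum>k=1..n. b k)"
    and tangent_fields_zero: "tangent_fields gmul H f n S 0 = (\<lambda>v x. ldiff x v) ` span (e ` ix ` {1..n})"
proof -
  obtain c where c: "c \<noteq> 0" "tangent_multivector gmul n S 0 = (\<lambda>w. c * wedge n (\<lambda>k. D 0 (ax k)) w)"
    using tangent_multivector_zero[OF tangent] by blast
  have lead: "k \<in> {1..n} \<Longrightarrow> (e \<circ> ix) k \<in> H (b k)"
      "k \<in> {1..n} \<Longrightarrow> b k \<le> j \<Longrightarrow> x \<in> H j \<Longrightarrow> (D 0 (ax k) - (e \<circ> ix) k) \<bullet> x = 0" for k j x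
    using e_ix_layer deriv_leading by simp_all
  have nz: "wedge n (e \<circ> ix) (e \<circ> ix) \<noteq> 0" using wedge_basis_ix by simp
  note deg = pointwise_degree_leading[OF basis' c(2,1) nz b_layer lead]
  show "pointwise_degree gmul H f n S 0 = (\<Sum>k=1..n. b k)" by (rule deg(1))
  have "vec_wedge n x (\<lambda>w. c * wedge n (e \<circ> ix) w) = (\<lambda>w. c * vec_wedge n x (wedge n (e \<circ> ix)) w)" for x
    by (rule ext) (unfold vec_wedge_def sum_distrib_left, intro sum.cong refl, simp only: mult_ac)
  moreover have "vec_wedge n x (wedge n (e \<circ> ix)) = (\<lambda>w. 0) \<longleftrightarrow> x \<in> span ((e \<circ> ix) ` {1..n})" for x
    by (intro vec_wedge_orthonormal_eq_0_iff) (simp add: ix_inner)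
  ultimately have iff: "vec_wedge n x (\<lambda>w. c * wedge n (e \<circ> ix) w) = (\<lambda>w. 0) \<longleftrightarrow> x \<in> span (e ` ix ` {1..n})" for x
    using c(1) by (simp add: fun_eq_iff image_comp)
  show "tangent_fields gmul H f n S 0 = (\<lambda>v x. ldiff x v) ` span (e ` ix ` {1..n})"
  proof -
    have "degree_part H f n (pointwise_degree gmul H f n S 0) (tangent_multivector gmul n S 0) =
        (\<lambda>w. c * wedge n (e \<circ> ix) w)" by (rule deg(2))
    then have "tangent_fields gmul H f n S 0 =
        {X \<in> range (\<lambda>v x. ldiff x v). X 0 \<in> span (e ` ix ` {1..n})}"
      unfolding tangent_fields_def left_invariant_fields_eq by (simp only: iff)
    then show ?thesis by auto
  qed
qed

lemma homogeneous_tangent_space_zero: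
  "homogeneous_tangent_space gmul H f n S 0 = span (e ` ix ` {1..n})"
  unfolding homogeneous_tangent_space_def tangent_fields_zero by (simp add: image_image)

text \<open>The bracket of the fields through \<open>e i\<close> and \<open>e j\<close> is again one
  of the fields found in \<open>tangent_fields_zero\<close>, and its value at 0 is
  \<open>br (e i) (e j)\<close>.\<close>

lemma regular_imp_subalgebra:
  assumes reg: "algebraically_regular gmul H f n S 0"
    and ij: "i \<in> ix ` {1..n}" "j \<in> ix ` {1..n}" and s: "s \<in> {1..DIM('a)} - ix ` {1..n}"
  shows "br (e i) (e j) \<bullet> e s = 0"
proof -
  have "(\<lambda>x. ldiff x (e l)) \<in> tangent_fields gmul H f n S 0" if "l \<in> ix ` {1..n}" for l
    unfolding tangent_fields_zero using that by (intro imageI span_base)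
  then have "field_bracket (\<lambda>x. ldiff x (e i)) (\<lambda>x. ldiff x (e j)) \<in> tangent_fields gmul H f n S 0"
    using reg ij unfolding algebraically_regular_def by blast
  then obtain v where v: "v \<in> span (e ` ix ` {1..n})"
    "field_bracket (\<lambda>x. ldiff x (e i)) (\<lambda>x. ldiff x (e j)) = (\<lambda>x. ldiff x v)"
    unfolding tangent_fields_zero by blast
  have "br (e i) (e j) = v" using fun_cong[OF v(2), of 0] by (simp add: field_bracket_ldiff)
  moreover have "v \<bullet> e s = 0"
  proof (rule linear_eq_0_on_span[OF _ _ v(1)])
    show "linear (\<lambda>v. v \<bullet> e s)" by (rule linearI) (simp_all add: inner_add_left)
    fix y assume "y \<in> e ` ix ` {1..n}"
    then obtain k where k: "k \<in> {1..n}" "y = e (ix k)" by blast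
    then show "y \<bullet> e s = 0" using basis_inner[OF basis ix(1)[OF k(1)], of s] s by auto
  qed
  ultimately show ?thesis by simp
qed

text \<open>The place where the bound on the degree is used. A component of \<open>frame k y\<close>
  in a layer above \<open>b k\<close> would be a nonzero value of the wedge on vectors of degrees
  \<open>b\<close>, with the k-th degree raised to \<open>deg l\<close>; some coefficient of a
  degree above the bound would then be nonzero.\<close>

lemma frame_degree:
  assumes "\<And>y. y \<in> U \<Longrightarrow> tangent_space S (\<Psi> y) = range (D y)"
    and "\<And>y. y \<in> U \<Longrightarrow> pointwise_degree gmul H f n S (\<Psi> y) \<le> (\<Sum>k=1..n. b k)"
  shows "\<forall>\<^sub>F y in nhds 0. \<forall>k\<in>{1..n}. \<forall>l\<in>{1..DIM('a)}.
    b k < deg l \<longrightarrow> frame k y \<bullet> e l = 0"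
  using eventually_frame eventually_frame_nonzero eventually_U
proof eventually_elim
  case (elim y)
  let ?u = "\<lambda>k. frame k y"
  have span: "span (?u ` {1..n}) = {w. ldiff (\<Psi> y) w \<in> range (D y)}"
  proof (intro subset_antisym)
    show "span (?u ` {1..n}) \<subseteq> {w. ldiff (\<Psi> y) w \<in> range (D y)}"
      using elim(1) by (intro span_minimal subspace_left_tangent elim(3)) blast
    show "{w. ldiff (\<Psi> y) w \<in> range (D y)} \<subseteq> span (?u ` {1..n})"
    proof
      fix w assume "w \<in> {w. ldiff (\<Psi> y) w \<in> range (D y)}"
      then have "w = (\<Sum>k=1..n. (w \<bullet> e (ix k)) *\<^sub>R frame k y)" using elim(1) by blast
      moreover have "(\<Sum>k=1..n. (w \<bullet> e (ix k)) *\<^sub>R frame k y) \<in> span (?u ` {1..n})"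
        by (intro span_sum span_scale span_base imageI)
      ultimately show "w \<in> span (?u ` {1..n})" by metis
    qed
  qed
  have T: "ldiff (\<Psi> y) ` span (?u ` {1..n}) = tangent_space S (\<Psi> y)"
  proof -
    have "ldiff (\<Psi> y) ` {w. ldiff (\<Psi> y) w \<in> range (D y)} = range (D y)"
      using surj_ldiff[of "\<Psi> y"] by (auto simp: image_iff) (metis surjD)
    then show ?thesis unfolding span assms(1)[OF elim(3)] .
  qed
  \<comment> \<open>The frame is dual to the vectors \<open>e (ix j)\<close>, so the matrix is the
    identity outside column \<open>k\<close>, and its determinant is the diagonal entry of that
    column.\<close>
  have one: "wedge n ?u ((e \<circ> ix)(k := x)) = ?u k \<bullet> x" if k: "k \<in> {1..n}" for k x
  proof -
    have "wedge n ?u ((e \<circ> ix)(k := x)) = (\<Prod>i=1..n. ?u i \<bullet> ((e \<circ> ix)(k := x)) i)"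
      by (rule wedge_diagonal_except_column[where k = k]) (use elim(2) in auto)
    also have "\<dots> = (\<Prod>i=1..n. if i = k then ?u k \<bullet> x else 1)"
      using elim(2) by (intro prod.cong) auto
    also have "\<dots> = ?u k \<bullet> x" using k by simp
    finally show ?thesis .
  qed
  show ?case
  proof (intro ballI impI, rule ccontr)
    fix k l assume k: "k \<in> {1..n}" and l: "l \<in> {1..DIM('a)}" and less: "b k < deg l"
      and nz: "frame k y \<bullet> e l \<noteq> 0"
    let ?w = "(e \<circ> ix)(k := e l)" and ?g = "b(k := deg l)"
    have nz': "wedge n ?u ?w \<noteq> 0" using one[OF k] nz by simp
    obtain c where c: "c \<noteq> 0" "tangent_multivector gmul n S (\<Psi> y) = (\<lambda>w. c * wedge n ?u w)"
      using tangent_multivector_eq[OF T nz'] by blast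
    have g: "?g i \<in> {1..\<iota>}" "?w i \<in> H (?g i)" if "i \<in> {1..n}" for i
      using b_layer[OF that] e_ix_layer[OF that] index_degree_bounds[OF basis l] basis_mem_layer[OF basis l] by auto
    \<comment> \<open>The vectors of \<open>?w\<close> come from \<open>e\<close>, while the degree
      is measured in \<open>f\<close>; exchange within the common layers passes from one basis to
      the other.\<close>
    obtain J where J: "J \<subseteq> {1..DIM('a)}" "card J = n" "(\<Sum>s\<in>J. deg s) = (\<Sum>i=1..n. ?g i)"
        "wedge n ?u (select f J) \<noteq> 0"
      by (rule alternating_form_nonzero_graded[OF basis' alternating_form_wedge nz', of ?g])
        (assumption | rule g that)+
    have "degree_part H f n (\<Sum>i=1..n. ?g i) (tangent_multivector gmul n S (\<Psi> y)) \<noteq> (\<lambda>w. 0)"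
      by (rule degree_part_nonzeroI[OF basis' J(1-3)]) (use c J(4) in simp)
    from degree_part_le_pointwise_degree[OF basis' this]
    have "(\<Sum>i=1..n. ?g i) \<le> (\<Sum>i=1..n. b i)" using assms(2)[OF elim(3)] by simp
    moreover have "(\<Sum>i=1..n. b i) < (\<Sum>i=1..n. ?g i)"
      using k less by (intro sum_strict_mono_ex1) auto
    ultimately show False by simp
  qed
qed

end

end

section \<open>Curves through the origin of the chart\<close>

context special_chart
begin

lemma deriv_coordinate:
  assumes y: "y \<in> U" and k: "k \<in> {1..n}"
  shows "D y h \<bullet> e (ix k) = h $ idx k"
proof -
  have "((\<lambda>y. \<Psi> y \<bullet> e (ix k)) has_derivative (\<lambda>h. D y h \<bullet> e (ix k))) (at y)"
    by (rule has_derivative_inner_left[OF deriv[OF y]])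
  moreover have "((\<lambda>y. y $ idx k) has_derivative (\<lambda>h. h $ idx k)) (at y)"
    by (rule bounded_linear_imp_has_derivative[OF bounded_linear_vec_nth])
  then have "((\<lambda>y. \<Psi> y \<bullet> e (ix k)) has_derivative (\<lambda>h. h $ idx k)) (at y)"
    by (rule has_derivative_transform_within_open[OF _ U(1) y]) (simp add: coordinate[OF _ k])
  ultimately have "(\<lambda>h. D y h \<bullet> e (ix k)) = (\<lambda>h. h $ idx k)" by (rule has_derivative_unique)
  then show ?thesis by (rule fun_cong)
qed

lemma norm_combination_le: "norm (\<Sum>k=1..n. a k *\<^sub>R ax k) \<le> (\<Sum>k=1..n. \<bar>a k\<bar>)"
  by (rule order_trans[OF norm_sum]) (simp add: sum_mono)

text \<open>For \<open>h\<close> the components of \<eta>, the argument of \<open>\<Psi>\<close> is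
  \<eta>(t). The claim is the value at \<tau> = 1 of an estimate uniform along curves that start at
  the origin.\<close>

theorem graph_coordinate_smallo:
  fixes h :: "nat \<Rightarrow> real^'n \<Rightarrow> real"
  assumes h: "\<And>k t. k \<in> {1..n} \<Longrightarrow> \<bar>h k t\<bar> \<le> norm t ^ b k"
    and subalgebra: "\<And>i j s. i \<in> ix ` {1..n} \<Longrightarrow> j \<in> ix ` {1..n} \<Longrightarrow>
      s \<in> {1..DIM('a)} - ix ` {1..n} \<Longrightarrow> br (e i) (e j) \<bullet> e s = 0"
    and degree: "\<forall>\<^sub>F y in nhds 0. \<forall>k\<in>{1..n}. \<forall>l\<in>{1..DIM('a)}.
      b k < deg l \<longrightarrow> frame k y \<bullet> e l = 0"
    and s: "s \<in> {1..DIM('a)} - ix ` {1..n}"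
  shows "(\<lambda>t. \<Psi> (\<Sum>k=1..n. h k t *\<^sub>R ax k) \<bullet> e s) \<in> o[at 0](\<lambda>t. norm t ^ deg s)"
proof -
  let ?d = "deg"
  \<comment> \<open>The factor \<open>snd p ^ b k\<close> vanishes at \<tau> = 0, because
    \<open>b k\<close> is positive, and its derivative is bounded on [0, 1]; position and velocity
    therefore inherit the weight of \<open>h k\<close>.\<close>
  define u where "u p = (\<Sum>k=1..n. (snd p ^ b k * h k (fst p)) *\<^sub>R ax k)" for p :: "(real^'n) \<times> real"
  define u' where "u' p = (\<Sum>k=1..n. (real (b k) * snd p ^ (b k - 1) * h k (fst p)) *\<^sub>R ax k)" for p :: "(real^'n) \<times> real"
  define \<gamma> where "\<gamma> p = \<Psi> (u p)" for p
  define \<gamma>' where "\<gamma>' p = D (u p) (u' p)" for p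
  \<comment> \<open>The velocity translated back to the identity; it exists and is unique because
    \<open>ldiff x\<close> is bijective.\<close>
  define \<omega> where "\<omega> p = (SOME w. ldiff (\<gamma> p) w = \<gamma>' p)" for p
  define G where "G = (at (0::real^'n)) \<times>\<^sub>F principal {0..1::real}"
  have b1: "1 \<le> b k" if "k \<in> {1..n}" for k using b_layer[OF that] by simp
  have \<omega>: "ldiff (\<gamma> p) (\<omega> p) = \<gamma>' p" for p
    unfolding \<omega>_def by (rule someI_ex) (metis surj_ldiff surjD)
  have \<rho>: "((\<lambda>t. norm t) \<longlongrightarrow> 0) (at (0::real^'n))" by (rule tendsto_norm_zero) (rule tendsto_ident_at)
  have "filterlim fst (at (0::real^'n)) G" unfolding G_def by (rule filterlim_fst)
  from filterlim_compose[OF \<rho> this] have \<rho>G: "((\<lambda>p. norm (fst p)) \<longlongrightarrow> 0) G" .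
  have unit: "\<forall>\<^sub>F p in G. snd p \<in> {0..1}"
    unfolding G_def eventually_prod_principal by simp
  have small: "\<forall>\<^sub>F p in G. norm (fst p) < 1"
    using order_tendstoD(2)[OF \<rho>G, of 1] by simp
  have u_le: "\<forall>\<^sub>F p in G. norm (u p) \<le> real n * norm (fst p)"
    and u'_le: "\<forall>\<^sub>F p in G. norm (u' p) \<le> (\<Sum>k=1..n. real (b k)) * norm (fst p)"
    and u'_nth: "\<forall>\<^sub>F p in G. \<forall>k\<in>{1..n}. \<bar>u' p $ idx k\<bar> \<le> real (b k) * norm (fst p) ^ b k"
  proof -
    have pow: "norm t ^ b k \<le> norm t" if "norm t < 1" "k \<in> {1..n}" for t :: "real^'n" and k
      using power_decreasing[OF b1[OF that(2)], of "norm t"] that(1) by simp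
    show "\<forall>\<^sub>F p in G. norm (u p) \<le> real n * norm (fst p)"
      using unit small
    proof eventually_elim
      case (elim p)
      have "norm (u p) \<le> (\<Sum>k=1..n. \<bar>snd p ^ b k * h k (fst p)\<bar>)"
        unfolding u_def by (rule norm_combination_le)
      also have "\<dots> \<le> (\<Sum>k=1..n. norm (fst p))"
      proof (rule sum_mono)
        fix k assume k: "k \<in> {1..n}"
        have "\<bar>snd p ^ b k * h k (fst p)\<bar> \<le> 1 * norm (fst p)"
          unfolding abs_mult using elim h[OF k, of "fst p"] pow[OF elim(2) k]
          by (intro mult_mono) (auto simp: power_le_one)
        then show "\<bar>snd p ^ b k * h k (fst p)\<bar> \<le> norm (fst p)" by simp
      qed
      finally show ?case by simp
    qed
    have term_le: "\<bar>real (b k) * snd p ^ (b k - 1) * h k (fst p)\<bar> \<le> real (b k) * norm (fst p) ^ b k"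
      if "snd p \<in> {0..1}" and k: "k \<in> {1..n}" for p and k
    proof -
      have "\<bar>snd p ^ (b k - 1)\<bar> * \<bar>h k (fst p)\<bar> \<le> 1 * norm (fst p) ^ b k"
        using that h[OF k, of "fst p"] by (intro mult_mono) (auto simp: power_le_one)
      then show ?thesis using mult_left_mono[of _ _ "real (b k)"] by (simp add: abs_mult mult.assoc)
    qed
    show "\<forall>\<^sub>F p in G. norm (u' p) \<le> (\<Sum>k=1..n. real (b k)) * norm (fst p)"
      using unit small
    proof eventually_elim
      case (elim p)
      have "norm (u' p) \<le> (\<Sum>k=1..n. \<bar>real (b k) * snd p ^ (b k - 1) * h k (fst p)\<bar>)"
        unfolding u'_def by (rule norm_combination_le)
      also have "\<dots> \<le> (\<Sum>k=1..n. real (b k) * norm (fst p))"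
      proof (rule sum_mono)
        fix k assume k: "k \<in> {1..n}"
        show "\<bar>real (b k) * snd p ^ (b k - 1) * h k (fst p)\<bar> \<le> real (b k) * norm (fst p)"
          by (rule order_trans[OF term_le[OF elim(1) k] mult_left_mono[OF pow[OF elim(2) k]]]) simp
      qed
      finally show ?case by (simp add: sum_distrib_right)
    qed
    show "\<forall>\<^sub>F p in G. \<forall>k\<in>{1..n}. \<bar>u' p $ idx k\<bar> \<le> real (b k) * norm (fst p) ^ b k"
      using unit
    proof eventually_elim
      case (elim p)
      show ?case
      proof
        fix k assume k: "k \<in> {1..n}"
        show "\<bar>u' p $ idx k\<bar> \<le> real (b k) * norm (fst p) ^ b k"
          unfolding u'_def sum_axis_nth[OF k] by (rule term_le[OF elim k])
      qed
    qed
  qed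
  have "((\<lambda>p. real n * norm (fst p)) \<longlongrightarrow> real n * 0) G" by (intro tendsto_intros \<rho>G)
  then have u_lim: "filterlim u (nhds 0) G"
    using u_le by (intro Lim_null_comparison[of u]) auto
  have uU: "\<forall>\<^sub>F p in G. u p \<in> U"
    by (rule eventually_compose_filterlim[OF eventually_U u_lim])
  have deriv_u: "((\<lambda>\<tau>. u (t, \<tau>)) has_vector_derivative u' (t, \<tau>)) (at \<tau> within {0..1})" for t \<tau>
  proof -
    have "((\<lambda>\<tau>. \<tau> ^ b k * h k t) has_real_derivative real (b k) * \<tau> ^ (b k - 1) * h k t) (at \<tau> within {0..1})" for k
      using DERIV_cmult_right[OF DERIV_pow[of "b k" \<tau> "{0..1}"]] by simp
    then have "((\<lambda>\<tau>. (\<tau> ^ b k * h k t) *\<^sub>R ax k) has_vector_derivative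
        (real (b k) * \<tau> ^ (b k - 1) * h k t) *\<^sub>R ax k) (at \<tau> within {0..1})" for k
      unfolding has_real_derivative_iff_has_vector_derivative
      by (rule bounded_linear.has_vector_derivative[OF bounded_linear_scaleR_left])
    then show ?thesis unfolding u_def u'_def fst_conv snd_conv by (rule has_vector_derivative_sum)
  qed
  have deriv_\<gamma>: "\<forall>\<^sub>F t in at 0. \<forall>\<tau>\<in>{0..1}.
      ((\<lambda>\<tau>. \<gamma> (t, \<tau>)) has_vector_derivative \<gamma>' (t, \<tau>)) (at \<tau> within {0..1})"
    using uU unfolding G_def eventually_prod_principal
  proof eventually_elim
    case (elim t)
    show ?case
    proof
      fix \<tau> :: real assume "\<tau> \<in> {0..1}"
      then have "(\<Psi> has_derivative D (u (t, \<tau>))) (at (u (t, \<tau>)))" using elim deriv by blast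
      then have "(\<Psi> has_derivative D (u (t, \<tau>))) (at (u (t, \<tau>)) within (\<lambda>\<tau>. u (t, \<tau>)) ` {0..1})"
        by (rule has_derivative_at_withinI)
      from vector_derivative_diff_chain_within[OF deriv_u this]
      show "((\<lambda>\<tau>. \<gamma> (t, \<tau>)) has_vector_derivative \<gamma>' (t, \<tau>)) (at \<tau> within {0..1})"
        by (simp add: \<gamma>_def \<gamma>'_def o_def)
    qed
  qed
  have start: "\<gamma> (t, 0) = 0" for t
  proof -
    have "u (t, 0) = 0"
      unfolding u_def
    proof (intro sum.neutral ballI)
      fix k assume "k \<in> {1..n}"
      then show "(snd (t, 0) ^ b k * h k (fst (t, 0))) *\<^sub>R ax k = 0" using b1[of k] by (simp add: power_0_left)
    qed
    then show ?thesis by (simp add: \<gamma>_def zero)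
  qed
  obtain K where K: "0 < K" "\<And>h. norm (D 0 h) \<le> K * norm h"
    using linear_bounded_pos[OF linear_D[OF U(2)]] by blast
  have pos: "(0::real) < 1" "(0::real) < 1 / 2" by simp_all
  have "\<forall>\<^sub>F y in nhds 0. linear (D y)" using eventually_U by eventually_elim (rule linear_D)
  from eventually_compose_filterlim[OF
      linear_family_uniform[OF this linear_D[OF U(2)] tendsto_D pos(1)] u_lim]
  have D_near: "\<forall>\<^sub>F p in G. \<forall>h. norm (D (u p) h - D 0 h) \<le> 1 * norm h" .
  have \<gamma>'_le: "\<forall>\<^sub>F p in G. norm (\<gamma>' p) \<le> (K + 1) * (\<Sum>k=1..n. real (b k)) * norm (fst p)"
    using D_near u'_le
  proof eventually_elim
    case (elim p)
    have "norm (\<gamma>' p) \<le> norm (D 0 (u' p)) + norm (D (u p) (u' p) - D 0 (u' p))"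
      using norm_triangle_ineq[of "D 0 (u' p)" "D (u p) (u' p) - D 0 (u' p)"] by (simp add: \<gamma>'_def)
    also have "\<dots> \<le> K * norm (u' p) + 1 * norm (u' p)" using K(2) elim(1) by (intro add_mono) auto
    also have "\<dots> = (K + 1) * norm (u' p)" by (simp add: algebra_simps)
    also have "\<dots> \<le> (K + 1) * ((\<Sum>k=1..n. real (b k)) * norm (fst p))"
      using elim(2) K(1) by (intro mult_left_mono) auto
    finally show ?case by (simp add: mult.assoc)
  qed
  have norm_e: "\<bar>x \<bullet> e l\<bar> \<le> norm x" if "l \<in> {1..DIM('a)}" for x l
    using Cauchy_Schwarz_ineq2[of x "e l"] basis_inner[OF basis that that] by (simp add: norm_eq_sqrt_inner)
  have \<gamma>'_bigo: "(\<lambda>p. \<gamma>' p \<bullet> e l) \<in> O[G](\<lambda>p. norm (fst p))" if l: "l \<in> {1..DIM('a)}" for l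
  proof (rule bigoI)
    show "\<forall>\<^sub>F p in G. norm (\<gamma>' p \<bullet> e l) \<le> ((K + 1) * (\<Sum>k=1..n. real (b k))) * norm (norm (fst p))"
      using \<gamma>'_le
    proof eventually_elim
      case (elim p)
      then show ?case using norm_e[OF l, of "\<gamma>' p"] by simp
    qed
  qed
  have \<gamma>_bigo: "(\<lambda>p. \<gamma> p \<bullet> e l) \<in> O[G](\<lambda>p. norm (fst p))" if l: "l \<in> {1..DIM('a)}" for l
    unfolding G_def
  proof (rule integrate_bigo[where f' = "\<lambda>p. \<gamma>' p \<bullet> e l"])
    show "\<forall>\<^sub>F t in at 0. \<forall>\<tau>\<in>{0..1}.
        ((\<lambda>\<tau>. \<gamma> (t, \<tau>) \<bullet> e l) has_real_derivative \<gamma>' (t, \<tau>) \<bullet> e l) (at \<tau> within {0..1})"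
      using deriv_\<gamma> by eventually_elim
        (auto simp: has_real_derivative_iff_has_vector_derivative
          intro: bounded_linear.has_vector_derivative[OF bounded_linear_inner_left])
  qed (use start \<gamma>'_bigo[OF l, unfolded G_def] in auto)
  \<comment> \<open>Within distance 1/2 of the identity, \<open>ldiff\<close> is bounded below, so
    the norm of \<omega> is at most twice that of the velocity.\<close>
  have "((\<lambda>y. ldiff (\<Psi> y) w) \<longlongrightarrow> w) (nhds 0)" for w
    using filterlim_compose[OF tendsto_ldiff continuous_\<Psi>] .
  from eventually_compose_filterlim[OF linear_family_uniform[OF always_eventually[OF allI[OF linear_ldiff]]
        linear_id[unfolded id_def] this pos(2)] u_lim]
  have ldiff_near: "\<forall>\<^sub>F p in G. \<forall>w. norm (ldiff (\<Psi> (u p)) w - w) \<le> 1 / 2 * norm w" .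
  have \<omega>_bigo: "(\<lambda>p. \<omega> p \<bullet> e l) \<in> O[G](\<lambda>p. norm (fst p))" if l: "l \<in> {1..DIM('a)}" for l
  proof (rule bigoI)
    show "\<forall>\<^sub>F p in G. norm (\<omega> p \<bullet> e l) \<le> (2 * ((K + 1) * (\<Sum>k=1..n. real (b k)))) * norm (norm (fst p))"
      using \<gamma>'_le ldiff_near
    proof eventually_elim
      case (elim p)
      have "norm (\<omega> p) \<le> norm (\<gamma>' p) + norm (ldiff (\<gamma> p) (\<omega> p) - \<omega> p)"
        using norm_triangle_ineq4[of "\<gamma>' p" "ldiff (\<gamma> p) (\<omega> p) - \<omega> p"] by (simp add: \<omega>)
      moreover have "norm (ldiff (\<gamma> p) (\<omega> p) - \<omega> p) \<le> 1 / 2 * norm (\<omega> p)"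
        using elim(2) unfolding \<gamma>_def by blast
      ultimately have "norm (\<omega> p) \<le> 2 * norm (\<gamma>' p)" by simp
      then show ?case using norm_e[OF l, of "\<omega> p"] elim(1) by simp
    qed
  qed
  \<comment> \<open>By \<open>deriv_coordinate\<close> the tangential components of the velocity are
    those of \<open>u'\<close>, whose weights are known.\<close>
  have tangential: "(\<lambda>p. \<gamma>' p \<bullet> e k) \<in> O[G](\<lambda>p. norm (fst p) ^ ?d k)" if k: "k \<in> ix ` {1..n}" for k
  proof -
    obtain i where i: "i \<in> {1..n}" "k = ix i" using k by blast
    show ?thesis
    proof (rule bigoI)
      show "\<forall>\<^sub>F p in G. norm (\<gamma>' p \<bullet> e k) \<le> real (b i) * norm (norm (fst p) ^ ?d k)"
        using u'_nth uU
      proof eventually_elim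
        case (elim p)
        have "\<gamma>' p \<bullet> e k = u' p $ idx i" unfolding \<gamma>'_def i(2) by (rule deriv_coordinate[OF elim(2) i(1)])
        then show ?case using elim(1) i degree_ix[OF i(1)] by simp
      qed
    qed
  qed
  \<comment> \<open>Graph coefficients are indexed by basis indices here; \<open>inv_into\<close>
    recovers the column.\<close>
  define c where "c k l p = frame (inv_into {1..n} ix k) (u p) \<bullet> e l" for k l p
  have c_lim: "((\<lambda>p. c (ix i) l p) \<longlongrightarrow> D 0 (ax i) \<bullet> e l) G" if i: "i \<in> {1..n}" for i l
    unfolding c_def inv_into_f_f[OF ix(2) i]
    by (intro tendsto_inner tendsto_const filterlim_compose[OF tendsto_frame[OF i] u_lim])
  have c_bigo: "c k l \<in> O[G](\<lambda>_. 1)" if k: "k \<in> ix ` {1..n}" for k l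
  proof -
    obtain i where i: "i \<in> {1..n}" "k = ix i" using k by blast
    show ?thesis
      by (rule bigoI_tendsto[where c = "D 0 (ax i) \<bullet> e l"]) (use c_lim[OF i(1)] i(2) in auto)
  qed
  have c_smallo: "c k l \<in> o[G](\<lambda>_. 1)"
    if k: "k \<in> ix ` {1..n}" and l: "l \<in> {1..DIM('a)} - ix ` {1..n}" and kl: "?d k = ?d l" for k l
  proof -
    obtain i where i: "i \<in> {1..n}" "k = ix i" using k by blast
    \<comment> \<open>The limit of the coefficient is an entry of a diagonal block of the Jacobian
      matrix outside its identity part.\<close>
    have "D 0 (ax i) \<bullet> e l = 0" using deriv_upper[OF i(1) l] degree_ix[OF i(1)] kl i(2) by simp
    then show ?thesis
      by (intro smalloI_tendsto) (use c_lim[OF i(1), of l] i(2) in auto)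
  qed
  have graph: "\<forall>\<^sub>F p in G. \<omega> p \<bullet> e l =
      (\<Sum>k | k \<in> ix ` {1..n} \<and> ?d l \<le> ?d k. (\<omega> p \<bullet> e k) * c k l p)"
    if l: "l \<in> {1..DIM('a)} - ix ` {1..n}" for l
    using eventually_compose_filterlim[OF eventually_frame u_lim] eventually_compose_filterlim[OF degree u_lim]
  proof eventually_elim
    case (elim p)
    have "ldiff (\<Psi> (u p)) (\<omega> p) \<in> range (D (u p))" using \<omega>[of p] by (simp add: \<gamma>_def \<gamma>'_def)
    then have "\<omega> p = (\<Sum>k=1..n. (\<omega> p \<bullet> e (ix k)) *\<^sub>R frame k (u p))" using elim(1) by blast
    then have "\<omega> p \<bullet> e l = (\<Sum>k=1..n. (\<omega> p \<bullet> e (ix k)) *\<^sub>R frame k (u p)) \<bullet> e l" by (rule arg_cong)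
    also have "\<dots> = (\<Sum>k=1..n. (\<omega> p \<bullet> e (ix k)) * (frame k (u p) \<bullet> e l))"
      by (simp add: inner_sum_left)
    also have "\<dots> = (\<Sum>k=1..n. (\<omega> p \<bullet> e (ix k)) * c (ix k) l p)"
      by (intro sum.cong refl) (simp only: c_def inv_into_f_f[OF ix(2)])
    also have "\<dots> = (\<Sum>k\<in>ix ` {1..n}. (\<omega> p \<bullet> e k) * c k l p)"
      by (subst sum.reindex[OF ix(2)]) (simp add: o_def)
    also have "\<dots> = (\<Sum>k | k \<in> ix ` {1..n} \<and> ?d l \<le> ?d k. (\<omega> p \<bullet> e k) * c k l p)"
    \<comment> \<open>Tangential indices of degree lower than that of \<open>l\<close> drop out by
      \<open>degree\<close>, the consequence of maximality.\<close>
    proof (rule sum.mono_neutral_right)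
      show "\<forall>k\<in>ix ` {1..n} - {k. k \<in> ix ` {1..n} \<and> ?d l \<le> ?d k}. (\<omega> p \<bullet> e k) * c k l p = 0"
      proof
        fix k assume "k \<in> ix ` {1..n} - {k. k \<in> ix ` {1..n} \<and> ?d l \<le> ?d k}"
        then obtain i where i: "i \<in> {1..n}" "k = ix i" "?d k < ?d l" by auto
        then have "frame i (u p) \<bullet> e l = 0" using elim(2) degree_ix[OF i(1)] l by auto
        then have "c k l p = 0" by (simp only: c_def i(2) inv_into_f_f[OF ix(2) i(1)])
        then show "(\<omega> p \<bullet> e k) * c k l p = 0" by simp
      qed
    qed auto
    finally show ?case .
  qed
  have "(\<lambda>p. \<gamma> p \<bullet> e s) \<in> o[G](\<lambda>p. norm (fst p) ^ ?d s)"
  proof (rule tangential_curve_smallo[OF basis, where F = "at 0" and \<rho> = norm and \<gamma>' = \<gamma>' and \<omega> = \<omega> and c = c and I = "ix ` {1..n}", folded G_def])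
    show "ix ` {1..n} \<subseteq> {1..DIM('a)}" using ix(1) by blast
  qed (fact \<rho> | rule subalgebra deriv_\<gamma> \<gamma>_bigo \<omega>_bigo tangential graph c_bigo c_smallo s always_eventually allI start
      \<omega>[symmetric]; assumption?)+
  \<comment> \<open>The uniform estimate is restricted to the end points \<tau> = 1.\<close>
  moreover have "filterlim (\<lambda>t. (t, 1)) G (at (0::real^'n))"
    unfolding G_def filterlim_iff eventually_prod_principal
    by (auto elim: eventually_mono)
  ultimately have "(\<lambda>t. \<gamma> (t, 1) \<bullet> e s) \<in> o[at 0](\<lambda>t. norm (fst (t, 1::real)) ^ ?d s)"
    by (rule landau_o.small.compose)
  then show ?thesis by (simp add: \<gamma>_def u_def)
qed

end

section \<open>Special coordinates\<close>

text \<open>Induction in steps of two, since raising \<open>m\<close> by 2 multiplies the function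
  by the square of x. The base case |x| x is differentiated at 0 from the difference
  quotient.\<close>

lemma DERIV_abs_power_mult: "((\<lambda>x::real. \<bar>x\<bar> ^ m * x) has_real_derivative real (Suc m) * \<bar>x\<bar> ^ m) (at x)"
proof (induction m rule: induct_nat_012)
  case 0
  show ?case by simp
next
  case 1
  consider "x = 0" | "x > 0" | "x < 0" by linarith
  then show ?case
  proof cases
    case 1
    have "((\<lambda>h::real. \<bar>h\<bar>) \<longlongrightarrow> 0) (at 0)" by (rule tendsto_eq_intros | simp)+
    then have "((\<lambda>h::real. (\<bar>0 + h\<bar> ^ 1 * (0 + h) - \<bar>0\<bar> ^ 1 * 0) / h) \<longlongrightarrow> 0) (at 0)"
      by (rule filterlim_cong[THEN iffD1, rotated -1]) (auto simp: eventually_at_filter)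
    then show ?thesis using 1 by (simp add: DERIV_def)
  next
    case 2
    have "((\<lambda>x::real. x * x) has_real_derivative 2 * x) (at x)" by (auto intro!: derivative_eq_intros)
    then have "((\<lambda>x::real. \<bar>x\<bar> ^ 1 * x) has_real_derivative 2 * x) (at x)"
      by (rule has_field_derivative_transform_within_open[of _ _ _ "{0<..}"]) (use 2 in auto)
    then show ?thesis using 2 by simp
  next
    case 3
    have "((\<lambda>x::real. - x * x) has_real_derivative - 2 * x) (at x)" by (auto intro!: derivative_eq_intros)
    then have "((\<lambda>x::real. \<bar>x\<bar> ^ 1 * x) has_real_derivative - 2 * x) (at x)"
      by (rule has_field_derivative_transform_within_open[of _ _ _ "{..<0}"]) (use 3 in auto)
    then show ?thesis using 3 by simp
  qed
next
  case (ge2 m)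
  have "((\<lambda>x::real. x\<^sup>2) has_real_derivative 2 * x) (at x)" by (auto intro!: derivative_eq_intros)
  from DERIV_mult[OF this ge2(1)]
  have "((\<lambda>x. x\<^sup>2 * (\<bar>x\<bar> ^ m * x)) has_real_derivative 2 * x * (\<bar>x\<bar> ^ m * x) + real (Suc m) * \<bar>x\<bar> ^ m * x\<^sup>2) (at x)" .
  moreover have sq: "x\<^sup>2 = \<bar>x\<bar> * \<bar>x\<bar>" for x :: real by (simp add: power2_eq_square)
  have "x\<^sup>2 * (\<bar>x\<bar> ^ m * x) = \<bar>x\<bar> ^ Suc (Suc m) * x" for x :: real
    unfolding sq by (simp only: power_Suc mult_ac)
  moreover have "2 * x * (\<bar>x\<bar> ^ m * x) + real (Suc m) * \<bar>x\<bar> ^ m * x\<^sup>2 = real (Suc (Suc (Suc m))) * \<bar>x\<bar> ^ Suc (Suc m)"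
  proof -
    have "2 * x * (\<bar>x\<bar> ^ m * x) + real (Suc m) * \<bar>x\<bar> ^ m * x\<^sup>2 = real (Suc (Suc (Suc m))) * (\<bar>x\<bar> ^ m * x\<^sup>2)"
      by (simp add: power2_eq_square algebra_simps)
    then show ?thesis unfolding sq by (simp only: power_Suc mult_ac)
  qed
  ultimately show ?case by simp
qed

lemma signed_power_eq: "1 \<le> m \<Longrightarrow> \<bar>x\<bar> ^ m / real m * sgn x = \<bar>x\<bar> ^ (m - 1) * x / real m"
  by (cases m) (auto simp: abs_if sgn_if)

lemma C1_on_signed_power:
  assumes "1 \<le> m"
  shows "C1_on UNIV (\<lambda>x::real. \<bar>x\<bar> ^ m / real m * sgn x)"
proof -
  have eq: "(\<lambda>x::real. \<bar>x\<bar> ^ m / real m * sgn x) = (\<lambda>x. \<bar>x\<bar> ^ (m - 1) * x / real m)"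
    using signed_power_eq[OF assms] by (rule ext)
  have "((\<lambda>x. \<bar>x\<bar> ^ m / real m * sgn x) has_real_derivative \<bar>x\<bar> ^ (m - 1)) (at x)" for x :: real
    unfolding eq using DERIV_cdivide[OF DERIV_abs_power_mult[of "m - 1" x], of "real m"] assms by simp
  then show ?thesis
    unfolding C1_on_euclidean_iff
    by (intro exI[of _ "\<lambda>x h. \<bar>x\<bar> ^ (m - 1) * h"] conjI ballI allI)
      (auto simp: has_field_derivative_def intro!: continuous_intros)
qed

lemma C1_on_homogeneous_reparam:
  assumes "\<And>i. i \<in> {1..CARD('n)} \<Longrightarrow> 1 \<le> b i"
  shows "C1_on UNIV (homogeneous_reparam idx b :: real^'n::finite \<Rightarrow> real^'n)"
  unfolding homogeneous_reparam_def
proof (rule C1_on_sum)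
  fix i assume i: "i \<in> {1..CARD('n)}"
  have "C1_on UNIV (\<lambda>t::real^'n. \<bar>t $ idx i\<bar> ^ b i / real (b i) * sgn (t $ idx i))"
    by (rule C1_on_compose[OF C1_on_bounded_linear[OF bounded_linear_vec_nth] C1_on_signed_power[OF assms[OF i]]]) simp
  from C1_on_compose[OF this C1_on_bounded_linear[OF bounded_linear_scaleR_left[of "axis (idx i) 1"]]]
  show "C1_on UNIV (\<lambda>t::real^'n. (\<bar>t $ idx i\<bar> ^ b i / real (b i) * sgn (t $ idx i)) *\<^sub>R (axis (idx i) 1 :: real^'n))"
    by blast
qed

text \<open>Carries a column in block j of \<alpha> to the row at the same position in layer j. It
  inverts the map s \<mapsto> s - m_(j-1) + \<mu>_(j-1) of the theorem.\<close>

definition special_index :: "(nat \<Rightarrow> 'a::euclidean_space set) \<Rightarrow> (nat \<Rightarrow> nat) \<Rightarrow> nat \<Rightarrow> nat" where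
  "special_index H \<alpha> k = layer_sum H (block \<alpha> k - 1) + (k - partial_sum \<alpha> (block \<alpha> k - 1))"

context special_chart
begin

lemma homogeneous_reparam_nth:
  "k \<in> {1..n} \<Longrightarrow>
    homogeneous_reparam idx b t $ idx k = \<bar>t $ idx k\<bar> ^ b k / real (b k) * sgn (t $ idx k)"
  unfolding homogeneous_reparam_def n_eq[symmetric] by (rule sum_axis_nth)

lemma homeomorphism_homogeneous_reparam: "\<exists>g. homeomorphism UNIV UNIV (homogeneous_reparam idx b) g"
proof -
  \<comment> \<open>\<open>root\<close> is an odd function for every exponent, even ones included,
    which matches the sign factor in \<eta>.\<close>
  let ?g = "\<lambda>y :: real^'n. \<Sum>k=1..n. root (b k) (real (b k) * y $ idx k) *\<^sub>R ax k"
  have b: "0 < b k" if "k \<in> {1..n}" for k using b_layer[OF that] by simp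
  have 1: "?g (homogeneous_reparam idx b t) = t" for t
  proof (rule vec_eq_idxI)
    fix k assume k: "k \<in> {1..n}"
    show "?g (homogeneous_reparam idx b t) $ idx k = t $ idx k"
      unfolding sum_axis_nth[OF k] homogeneous_reparam_nth[OF k]
      using root_sgn_power[OF b[OF k], of "t $ idx k"] b[OF k] by (simp add: mult.commute)
  qed
  have 2: "homogeneous_reparam idx b (?g y) = y" for y
  proof (rule vec_eq_idxI)
    fix k assume k: "k \<in> {1..n}"
    show "homogeneous_reparam idx b (?g y) $ idx k = y $ idx k"
      unfolding homogeneous_reparam_nth[OF k] sum_axis_nth[OF k]
      using sgn_power_root[OF b[OF k], of "real (b k) * y $ idx k"] b[OF k] by (simp add: field_simps)
  qed
  have "continuous_on UNIV (homogeneous_reparam idx b :: real^'n \<Rightarrow> real^'n)"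
    by (rule C1_on_frechet_derivative(3)[OF C1_on_homogeneous_reparam]) (use b n_eq in force)
  moreover have surj: "range ?g = UNIV" "range (homogeneous_reparam idx b :: real^'n \<Rightarrow> real^'n) = UNIV"
    by (rule surjI[where f = "homogeneous_reparam idx b"], rule 1) (rule surjI[where f = ?g], rule 2)
  moreover have "continuous_on UNIV ?g"
    by (intro continuous_intros)
  ultimately have "homeomorphism UNIV UNIV (homogeneous_reparam idx b) ?g"
    unfolding homeomorphism_def using 1 2 surj by blast
  then show ?thesis by blast
qed

end

section \<open>From index blocks to special charts\<close>

context homogeneous_group
begin

context
  fixes \<alpha> :: "nat \<Rightarrow> nat"
  assumes \<alpha>_le: "\<And>j. j \<in> {1..\<iota>} \<Longrightarrow> \<alpha> j \<le> layer_dim H j"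
begin

lemma block_index_degree:
  assumes j: "j \<in> {1..\<iota>}" and c: "c \<in> {1..\<alpha> j}"
  shows "deg (layer_sum H (j - 1) + c) = j" "layer_sum H (j - 1) + c \<in> {1..DIM('a)}"
    "block \<alpha> (partial_sum \<alpha> (j - 1) + c) = j" "partial_sum \<alpha> (j - 1) + c \<in> {1..partial_sum \<alpha> \<iota>}"
proof -
  have s: "partial_sum c' j = partial_sum c' (j - 1) + c' j" for c' using partial_sum_step[of j] j by simp
  show "deg (layer_sum H (j - 1) + c) = j"
    by (rule block_eqI) (use j c \<alpha>_le[OF j] s[of "layer_dim H"] in auto)
  show "block \<alpha> (partial_sum \<alpha> (j - 1) + c) = j"
    by (rule block_eqI) (use j c s[of \<alpha>] in auto)
  show "layer_sum H (j - 1) + c \<in> {1..DIM('a)}"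
    using partial_sum_mono[of j \<iota> "layer_dim H"] layer_sum_step s[of "layer_dim H"] c j \<alpha>_le[OF j] by simp
  show "partial_sum \<alpha> (j - 1) + c \<in> {1..partial_sum \<alpha> \<iota>}"
    using partial_sum_mono[of j \<iota> \<alpha>] s[of \<alpha>] c j by simp
qed

lemma special_index_cases:
  assumes "k \<in> {1..partial_sum \<alpha> \<iota>}"
  obtains j c where "j \<in> {1..\<iota>}" "c \<in> {1..\<alpha> j}" "k = partial_sum \<alpha> (j - 1) + c" "block \<alpha> k = j"
    "special_index H \<alpha> k = layer_sum H (j - 1) + c"
proof -
  let ?j = "block \<alpha> k" and ?c = "k - partial_sum \<alpha> (block \<alpha> k - 1)"
  have b: "1 \<le> ?j" "?j \<le> \<iota>" "partial_sum \<alpha> (?j - 1) < k" "k \<le> partial_sum \<alpha> ?j"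
    using block_bounds[of k \<alpha> \<iota>] assms by auto
  show ?thesis
    by (rule that[of ?j ?c]) (use b partial_sum_step[OF b(1), of \<alpha>] in \<open>auto simp: special_index_def\<close>)
qed

lemma special_index_block:
  assumes "j \<in> {1..\<iota>}" "c \<in> {1..\<alpha> j}"
  shows "special_index H \<alpha> (partial_sum \<alpha> (j - 1) + c) = layer_sum H (j - 1) + c"
  unfolding special_index_def block_index_degree(3)[OF assms] by simp

lemma special_indices_eq: "special_indices H \<iota> \<alpha> = special_index H \<alpha> ` {1..partial_sum \<alpha> \<iota>}"
proof (intro subset_antisym subsetI)
  fix s assume "s \<in> special_indices H \<iota> \<alpha>"
  then obtain j where j: "j \<in> {1..\<iota>}" "s \<in> {layer_sum H (j - 1) + 1..layer_sum H (j - 1) + \<alpha> j}"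
    unfolding special_indices_def by blast
  define c where "c = s - layer_sum H (j - 1)"
  have c: "c \<in> {1..\<alpha> j}" "s = layer_sum H (j - 1) + c" using j(2) by (auto simp: c_def)
  show "s \<in> special_index H \<alpha> ` {1..partial_sum \<alpha> \<iota>}"
    unfolding c(2) special_index_block[OF j(1) c(1), symmetric]
    by (rule imageI[OF block_index_degree(4)[OF j(1) c(1)]])
next
  fix s assume "s \<in> special_index H \<alpha> ` {1..partial_sum \<alpha> \<iota>}"
  then obtain k where k: "k \<in> {1..partial_sum \<alpha> \<iota>}" "s = special_index H \<alpha> k" by blast
  obtain j c where "j \<in> {1..\<iota>}" "c \<in> {1..\<alpha> j}" "special_index H \<alpha> k = layer_sum H (j - 1) + c"
    using k(1) by (rule special_index_cases)
  then show "s \<in> special_indices H \<iota> \<alpha>"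
    unfolding special_indices_def k(2) by (intro UN_I[of j]) auto
qed

lemma special_index_degree:
  assumes k: "k \<in> {1..partial_sum \<alpha> \<iota>}"
  shows "deg (special_index H \<alpha> k) = block \<alpha> k"
    and "special_index H \<alpha> k \<in> {1..DIM('a)}"
    and "special_index H \<alpha> k - layer_sum H (block \<alpha> k - 1) + partial_sum \<alpha> (block \<alpha> k - 1) = k"
proof -
  obtain j c where jc: "j \<in> {1..\<iota>}" "c \<in> {1..\<alpha> j}" "k = partial_sum \<alpha> (j - 1) + c" "block \<alpha> k = j"
    "special_index H \<alpha> k = layer_sum H (j - 1) + c"
    using k by (rule special_index_cases)
  show "deg (special_index H \<alpha> k) = block \<alpha> k" "special_index H \<alpha> k \<in> {1..DIM('a)}"
    using block_index_degree(1,2)[OF jc(1,2)] jc by simp_all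
  show "special_index H \<alpha> k - layer_sum H (block \<alpha> k - 1) + partial_sum \<alpha> (block \<alpha> k - 1) = k"
    unfolding jc(4,5) using jc(3) by simp
qed

lemma inj_special_index: "inj_on (special_index H \<alpha>) {1..partial_sum \<alpha> \<iota>}"
proof (rule inj_onI)
  fix k k' assume k: "k \<in> {1..partial_sum \<alpha> \<iota>}" and k': "k' \<in> {1..partial_sum \<alpha> \<iota>}"
    and eq: "special_index H \<alpha> k = special_index H \<alpha> k'"
  have "block \<alpha> k = block \<alpha> k'"
    using special_index_degree(1)[OF k] special_index_degree(1)[OF k'] eq by simp
  then show "k = k'"
    using special_index_degree(3)[OF k] special_index_degree(3)[OF k'] eq by simp
qed

end

text \<open>A column \<open>k\<close> and a row \<open>s\<close> are located in a block, at column
  \<open>c\<close> and row \<open>?r\<close> of it; the three cases of the block condition become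
  the three comparisons of \<open>block \<alpha> k\<close> with \<open>deg s\<close>.\<close>

lemma special_chart_special_coordinates:
  fixes idx :: "nat \<Rightarrow> 'n::finite"
  assumes idx: "bij_betw idx {1..CARD('n)} UNIV" and sc: "special_coordinates H \<iota> idx S \<alpha> e U \<psi>"
  shows "special_chart br gmul H \<iota> e idx (special_index H \<alpha>) (block \<alpha>) CARD('n) U
    (\<lambda>y. \<Sum>j=1..DIM('a). \<psi> j y *\<^sub>R e j) S"
proof -
  let ?m = "layer_sum H" and ?\<mu> = "partial_sum \<alpha>" and ?\<Psi> = "\<lambda>y. \<Sum>j=1..DIM('a). \<psi> j y *\<^sub>R e j"
  let ?D = "\<lambda>k. fderiv ?\<Psi> 0 (axis (idx k) 1)"
  have \<alpha>: "\<alpha> j \<le> layer_dim H j" if "j \<in> {1..\<iota>}" for j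
    using sc that by (simp add: special_coordinates_def Let_def)
  have n: "?\<mu> \<iota> = CARD('n)"
    using sc by (simp add: special_coordinates_def Let_def partial_sum_def)
  have basis: "orthonormal_graded_basis H \<iota> e" and U: "open U" "0 \<in> U" and emb: "C1_embedding U ?\<Psi>"
    and image: "?\<Psi> ` U \<subseteq> S" and zero: "?\<Psi> 0 = 0"
    using sc by (simp_all add: special_coordinates_def Let_def)
  have jac: "\<forall>j\<in>{1..\<iota>}. \<forall>i\<in>{1..\<iota>}. \<forall>r\<in>{1..layer_dim H j}. \<forall>c\<in>{1..\<alpha> i}.
         (i < j \<longrightarrow> partial_deriv idx (?\<mu> (i - 1) + c) (\<psi> (?m (j - 1) + r)) 0 = 0) \<and>
         (i = j \<longrightarrow> partial_deriv idx (?\<mu> (i - 1) + c) (\<psi> (?m (j - 1) + r)) 0 = (if r = c then 1 else 0)) \<and>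
         (i > j \<longrightarrow> r \<le> \<alpha> j \<longrightarrow> partial_deriv idx (?\<mu> (i - 1) + c) (\<psi> (?m (j - 1) + r)) 0 = 0)"
    and coord: "\<forall>j\<in>{1..\<iota>}. \<forall>s\<in>{?m (j - 1) + 1..?m (j - 1) + \<alpha> j}. \<forall>y\<in>U.
         \<psi> s y = y $ idx (s - ?m (j - 1) + ?\<mu> (j - 1))"
    using sc unfolding special_coordinates_def Let_def by blast+
  have C1: "C1_on U ?\<Psi>" using emb by (simp add: C1_embedding_def)
  note comp = combination_inner_basis[OF basis]
  have pd: "partial_deriv idx k (\<psi> s) 0 = ?D k \<bullet> e s"
    if s: "s \<in> {1..DIM('a)}" for s k
  proof -
    have "((\<lambda>y. ?\<Psi> y \<bullet> e s) has_derivative (\<lambda>h. fderiv ?\<Psi> 0 h \<bullet> e s)) (at 0)"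
      by (rule has_derivative_inner_left[OF C1_on_frechet_derivative(1)[OF C1 U(2)]])
    then have "(\<psi> s has_derivative (\<lambda>h. fderiv ?\<Psi> 0 h \<bullet> e s)) (at 0)"
      unfolding comp[OF s] by simp
    from frechet_derivative_at[OF this, symmetric] show ?thesis unfolding partial_deriv_def by (rule fun_cong)
  qed
  have jac': "(block \<alpha> k < deg s \<longrightarrow> ?D k \<bullet> e s = 0) \<and>
      (block \<alpha> k = deg s \<longrightarrow>
        ?D k \<bullet> e s = (if s = special_index H \<alpha> k then 1 else 0)) \<and>
      (deg s < block \<alpha> k \<longrightarrow> s \<in> special_indices H \<iota> \<alpha> \<longrightarrow>
        ?D k \<bullet> e s = 0)"
    if k: "k \<in> {1..CARD('n)}" and s: "s \<in> {1..DIM('a)}" for k s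
  proof -
    obtain i c where ic: "i \<in> {1..\<iota>}" "c \<in> {1..\<alpha> i}" "k = ?\<mu> (i - 1) + c" "block \<alpha> k = i"
      "special_index H \<alpha> k = ?m (i - 1) + c"
      using special_index_cases[OF \<alpha>, of k] k n by auto
    let ?j = "deg s" and ?r = "s - ?m (deg s - 1)"
    have j: "1 \<le> ?j" "?j \<le> \<iota>" "?m (?j - 1) < s" "s \<le> ?m ?j"
      using block_bounds[of s "layer_dim H" \<iota>] s layer_sum_step by auto
    have r: "?r \<in> {1..layer_dim H ?j}" "s = ?m (?j - 1) + ?r"
      using j partial_sum_step[OF j(1), of "layer_dim H"] by auto
    \<comment> \<open>The special indices are the first \<open>\<alpha> j\<close> rows of their
      layer, exactly those required to vanish in the blocks with i > j.\<close>
    have ra: "?r \<le> \<alpha> ?j" if "s \<in> special_indices H \<iota> \<alpha>"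
    proof -
      obtain k' where k': "k' \<in> {1..?\<mu> \<iota>}" "s = special_index H \<alpha> k'"
        using \<open>s \<in> special_indices H \<iota> \<alpha>\<close> special_indices_eq[OF \<alpha>] by blast
      obtain j' c' where "j' \<in> {1..\<iota>}" "c' \<in> {1..\<alpha> j'}" "block \<alpha> k' = j'" "special_index H \<alpha> k' = ?m (j' - 1) + c'"
        using special_index_cases[OF \<alpha> k'(1)] by metis
      then show ?thesis using special_index_degree(1)[OF \<alpha> k'(1)] k'(2) by auto
    qed
    have "?j \<in> {1..\<iota>}" using j by simp
    note J = jac[rule_format, OF this ic(1) r(1) ic(2), folded ic(3) r(2), unfolded pd[OF s]]
    have "s = special_index H \<alpha> k \<longleftrightarrow> ?r = c" if "i = ?j"
      using r(2) ic(5) that by auto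
    then show ?thesis unfolding ic(4) using J ra by auto
  qed
  show ?thesis
  proof unfold_locales
    show "inj_on (special_index H \<alpha>) {1..CARD('n)}" using inj_special_index[OF \<alpha>] n by simp
    show "inj (fderiv ?\<Psi> y)" if "y \<in> U" for y
      using emb that by (simp add: C1_embedding_def)
    fix k assume k: "k \<in> {1..CARD('n)}"
    then have k': "k \<in> {1..?\<mu> \<iota>}" using n by simp
    note ix = special_index_degree[OF \<alpha> k']
    show "special_index H \<alpha> k \<in> {1..DIM('a)}" "deg (special_index H \<alpha> k) = block \<alpha> k"
      using ix by simp_all
    show "?D k \<bullet> e (special_index H \<alpha> j) = (if j = k then 1 else 0)"
      if j: "j \<in> {1..CARD('n)}" for j
    proof -
      have j': "j \<in> {1..?\<mu> \<iota>}" using j n by simp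
      have "special_index H \<alpha> j \<in> special_indices H \<iota> \<alpha>" using special_indices_eq[OF \<alpha>] j' by blast
      moreover have "special_index H \<alpha> j = special_index H \<alpha> k \<longleftrightarrow> j = k"
        using inj_on_eq_iff[OF inj_special_index[OF \<alpha>] j' k'] by simp
      ultimately show ?thesis
        using jac'[OF k special_index_degree(2)[OF \<alpha> j']]
          special_index_degree(1)[OF \<alpha> j'] ix(1)
        by (cases "block \<alpha> k" "deg (special_index H \<alpha> j)" rule: linorder_cases) auto
    qed
    show "?D k \<bullet> e l = 0"
      if l: "l \<in> {1..DIM('a)} - special_index H \<alpha> ` {1..CARD('n)}" and "block \<alpha> k \<le> deg l" for l
      using jac'[OF k, of l] that k by (cases "block \<alpha> k = deg l") auto
    show "?\<Psi> y \<bullet> e (special_index H \<alpha> k) = y $ idx k" if y: "y \<in> U" for y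
    proof -
      obtain j c where "j \<in> {1..\<iota>}" "c \<in> {1..\<alpha> j}" "k = ?\<mu> (j - 1) + c" "special_index H \<alpha> k = ?m (j - 1) + c"
        using special_index_cases[OF \<alpha> k'] by metis
      then show ?thesis using coord[rule_format, of j "special_index H \<alpha> k" y] y comp[OF ix(2)] by (simp add: add.commute)
    qed
  qed (use idx basis U C1 image zero in auto)
qed

end

theorem theorem6p1:
  fixes br gmul :: "'a::euclidean_space \<Rightarrow> 'a \<Rightarrow> 'a"
    and H :: "nat \<Rightarrow> 'a set"
    and \<iota> N :: nat
    and f e :: "nat \<Rightarrow> 'a"
    and \<Sigma> :: "'a set"
    and p :: 'a
    and idx :: "nat \<Rightarrow> 'n::finite"
    and \<alpha> \<mu> b d :: "nat \<Rightarrow> nat"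
    and U :: "(real^'n) set"
    and \<psi> \<Gamma> :: "nat \<Rightarrow> real^'n \<Rightarrow> real"
    and \<eta> :: "real^'n \<Rightarrow> real^'n"
    and \<Sigma>p :: "'a set"
    and I :: "nat set"
  assumes "homogeneous_group br H \<iota> gmul"
    and "orthonormal_graded_basis H \<iota> f"
    and "C1_submanifold (CARD('n)) \<Sigma>"
    and "submanifold_degree gmul H f (CARD('n)) \<Sigma> = N"
    and "p \<in> \<Sigma>"
    and "algebraically_regular gmul H f (CARD('n)) \<Sigma> p"
    and "pointwise_degree gmul H f (CARD('n)) \<Sigma> p = N"
    and "horizontal_point gmul H \<iota> f (CARD('n)) \<Sigma> p \<or> \<iota> = 2 \<or> CARD('n) = 1 \<or>
         transversal_point gmul H \<iota> f (CARD('n)) \<Sigma> p"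
    and "\<Sigma>p = gmul (- p) ` \<Sigma>"
    and "bij_betw idx {1..CARD('n)} UNIV"
    and "special_coordinates H \<iota> idx \<Sigma>p \<alpha> e U \<psi>"
    and "\<mu> = partial_sum \<alpha>"
    and "b = block \<alpha>"
    and "d = index_degree H"
    and "\<eta> = homogeneous_reparam idx b"
    and "\<Gamma> = (\<lambda>s t. \<psi> s (\<eta> t))"
    and "I = special_indices H \<iota> \<alpha>"
  shows "C1_on UNIV \<eta> \<and> (\<exists>g. homeomorphism UNIV UNIV \<eta> g) \<and>
    (\<exists>r>0. \<eta> ` ball 0 r \<subseteq> U \<and> (\<forall>s\<in>{1..DIM('a)}. C1_on (ball 0 r) (\<Gamma> s))) \<and>
    I \<subseteq> {1..DIM('a)} \<and>
    homogeneous_tangent_space gmul H f (CARD('n)) \<Sigma>p 0 = span (e ` I) \<and>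
    (\<forall>s\<in>{1..DIM('a)}.
       (s \<in> I \<longrightarrow>
          (\<forall>\<^sub>F t in nhds 0.
             \<Gamma> s t = (let k = s - layer_sum H (d s - 1) + \<mu> (d s - 1)
                      in \<bar>t $ idx k\<bar> ^ d s / real (d s) * sgn (t $ idx k)))) \<and>
       (s \<notin> I \<longrightarrow> \<Gamma> s \<in> o[at 0](\<lambda>t. norm t ^ d s)))"
proof -
  define \<Psi> where "\<Psi> y = (\<Sum>j=1..DIM('a). \<psi> j y *\<^sub>R e j)" for y
  define ix where "ix = special_index H \<alpha>"
  interpret homogeneous_group br H \<iota> gmul by (rule assms(1))
  interpret special_chart br gmul H \<iota> e idx ix b "CARD('n)" U \<Psi> \<Sigma>p
    using special_chart_special_coordinates[OF assms(10,11)]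
    unfolding assms(13) ix_def \<Psi>_def[abs_def] .
  have \<alpha>: "\<alpha> j \<le> layer_dim H j" if "j \<in> {1..\<iota>}" for j
    using assms(11) that by (simp add: special_coordinates_def Let_def)
  have n: "partial_sum \<alpha> \<iota> = CARD('n)"
    using assms(11) by (simp add: special_coordinates_def Let_def partial_sum_def)
  have I: "I = ix ` {1..CARD('n)}"
    unfolding assms(17) ix_def using special_indices_eq[OF \<alpha>] n by simp
  have comp: "\<psi> s y = \<Psi> y \<bullet> e s" if "s \<in> {1..DIM('a)}" for s y
    unfolding \<Psi>_def combination_inner_basis[OF basis that] ..
  have regular: "algebraically_regular gmul H f CARD('n) \<Sigma>p 0"
    using assms(6) tangent_fields_translate[of f "CARD('n)" "- p" \<Sigma> p]
    by (simp add: algebraically_regular_def assms(9))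
  \<comment> \<open>The subspace bounding the tangent space of \<Sigma> at \<open>x\<close> is
    translated to one at \<open>\<Psi> y\<close>; with the chart it determines the tangent space
    there.\<close>
  have tangent: "tangent_space \<Sigma>p (\<Psi> y) = range (D y)" if y: "y \<in> U" for y
  proof -
    have "\<Psi> y \<in> \<Sigma>p" using image y by blast
    then obtain x where x: "x \<in> \<Sigma>" "\<Psi> y = gmul (- p) x" unfolding assms(9) by blast
    obtain W where W: "subspace W" "dim W \<le> CARD('n)" "tangent_space \<Sigma> x \<subseteq> W"
      by (rule tangent_space_subset_subspace[OF assms(3) x(1)])
    let ?L = "fderiv (gmul (- p)) x"
    show ?thesis
    proof (rule tangent_space_chart[OF y])
      show "subspace (?L ` W)" by (rule linear_subspace_image[OF linear_frechet_gmul W(1)])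
      show "dim (?L ` W) \<le> CARD('n)" using dim_image_le[OF linear_frechet_gmul, of _ _ W] W(2) order_trans by blast
      show "tangent_space \<Sigma>p (\<Psi> y) \<subseteq> ?L ` W"
        unfolding assms(9) x(2) tangent_space_translate using W(3) by blast
    qed
  qed
  then have tangent0: "tangent_space \<Sigma>p 0 = range (D 0)" using U(2) zero by metis
  \<comment> \<open>The degree N is attained at \<open>p\<close>, so it equals the sum of the
    \<open>b k\<close>. As the degree of the whole submanifold it bounds the pointwise degrees along
    the chart.\<close>
  have deg0: "(\<Sum>k=1..CARD('n). b k) = N"
    using pointwise_degree_zero[OF assms(2) tangent0] assms(7)
      pointwise_degree_translate[of f "CARD('n)" "- p" \<Sigma> p] by (simp add: assms(9))
  have degree: "pointwise_degree gmul H f CARD('n) \<Sigma>p (\<Psi> y) \<le> (\<Sum>k=1..CARD('n). b k)" if y: "y \<in> U" for y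
  proof -
    have "\<Psi> y \<in> \<Sigma>p" using image y by blast
    then obtain x where x: "x \<in> \<Sigma>" "\<Psi> y = gmul (- p) x" unfolding assms(9) by blast
    then show ?thesis
      using pointwise_degree_le[OF assms(2) x(1), of "CARD('n)"] assms(4) deg0
      by (simp add: assms(9) pointwise_degree_translate)
  qed
  have \<eta>_C1: "C1_on UNIV \<eta>"
    unfolding assms(15) by (rule C1_on_homogeneous_reparam) (use b_layer in force)
  have \<eta>_nth: "\<eta> t $ idx k = \<bar>t $ idx k\<bar> ^ b k / real (b k) * sgn (t $ idx k)" if "k \<in> {1..CARD('n)}" for k t
    unfolding assms(15) by (rule homogeneous_reparam_nth[OF that])
  have \<eta>_0: "\<eta> 0 = 0" by (rule vec_eq_idxI) (simp add: \<eta>_nth del: atLeastAtMost_iff)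
  have "open (\<eta> -` U)" by (rule open_vimage[OF U(1) C1_on_frechet_derivative(3)[OF \<eta>_C1]])
  moreover have "0 \<in> \<eta> -` U" using \<eta>_0 U(2) by simp
  ultimately obtain r where r: "0 < r" "ball 0 r \<subseteq> \<eta> -` U" by (rule openE)
  then have ball: "\<eta> ` ball 0 r \<subseteq> U" by blast
  have \<Gamma>_C1: "C1_on (ball 0 r) (\<Gamma> s)" if s: "s \<in> {1..DIM('a)}" for s
  proof -
    have "C1_on U (\<lambda>y. \<Psi> y \<bullet> e s)"
      by (rule C1_on_compose[OF C1 C1_on_bounded_linear[OF bounded_linear_inner_left, where U = UNIV]]) simp
    from C1_on_compose[OF C1_on_subset[OF \<eta>_C1] this ball]
    show ?thesis by (simp add: assms(16) comp[OF s])
  qed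
  have in_U: "\<forall>\<^sub>F t in nhds 0. \<eta> t \<in> U"
    using r ball by (auto simp: eventually_nhds_metric dist_commute intro!: exI[of _ r])
  have exact: "\<forall>\<^sub>F t in nhds 0. \<Gamma> s t = (let k = s - layer_sum H (d s - 1) + \<mu> (d s - 1)
      in \<bar>t $ idx k\<bar> ^ d s / real (d s) * sgn (t $ idx k))" if s: "s \<in> I" for s
  proof -
    obtain k where k: "k \<in> {1..CARD('n)}" "s = ix k" using s I by blast
    then have k': "k \<in> {1..partial_sum \<alpha> \<iota>}" using n by simp
    have d: "d s = b k" using degree_ix[OF k(1)] k(2) assms(14) by simp
    have "s - layer_sum H (d s - 1) + \<mu> (d s - 1) = k"
      using special_index_degree(3)[OF \<alpha> k'] unfolding d unfolding k(2) ix_def assms(12,13) by simp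
    moreover have "s \<in> {1..DIM('a)}" using ix(1)[OF k(1)] k(2) by simp
    ultimately show ?thesis
      using in_U by (auto elim!: eventually_mono
        simp: assms(16) comp k(2) coordinate[OF _ k(1)] \<eta>_nth[OF k(1)] d[unfolded k(2)] simp del: atLeastAtMost_iff)
  qed
  have small: "\<Gamma> s \<in> o[at 0](\<lambda>t. norm t ^ d s)" if s: "s \<in> {1..DIM('a)}" "s \<notin> I" for s
  proof -
    \<comment> \<open>The components of \<eta>: division by \<open>b k\<close>, which is at least 1,
      and the sign factor do not increase the absolute value, so the weight bound holds with
      constant 1.\<close>
    let ?h = "\<lambda>k t. \<bar>t $ idx k\<bar> ^ b k / real (b k) * sgn (t $ idx k)"
    have "(\<lambda>t. \<Psi> (\<Sum>k=1..CARD('n). ?h k t *\<^sub>R axis (idx k) 1) \<bullet> e s) \<in> o[at 0](\<lambda>t. norm t ^ index_degree H s)"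
    proof (rule graph_coordinate_smallo)
      fix k and t :: "real^'n" assume k: "k \<in> {1..CARD('n)}"
      have "\<bar>?h k t\<bar> \<le> \<bar>t $ idx k\<bar> ^ b k"
        using b_layer[OF k] by (auto simp: abs_mult abs_sgn_eq divide_le_eq mult_le_cancel_left1)
      also have "\<dots> \<le> norm t ^ b k" by (intro power_mono component_le_norm_cart) simp
      finally show "\<bar>?h k t\<bar> \<le> norm t ^ b k" .
    next
      show "\<forall>\<^sub>F y in nhds 0. \<forall>k\<in>{1..CARD('n)}. \<forall>l\<in>{1..DIM('a)}. b k < index_degree H l \<longrightarrow> frame k y \<bullet> e l = 0"
        by (rule frame_degree[OF assms(2) tangent0 tangent degree])
      show "s \<in> {1..DIM('a)} - ix ` {1..CARD('n)}" using s I by blast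
    qed (rule regular_imp_subalgebra[OF assms(2) tangent0 regular])
    then show ?thesis
      by (simp add: assms(14,15,16) comp[OF s(1)] homogeneous_reparam_def)
  qed
  have "homogeneous_tangent_space gmul H f CARD('n) \<Sigma>p 0 = span (e ` I)"
    using homogeneous_tangent_space_zero[OF assms(2) tangent0] I by simp
  moreover have "I \<subseteq> {1..DIM('a)}" using I ix(1) by blast
  moreover have "\<exists>g. homeomorphism UNIV UNIV \<eta> g"
    using homeomorphism_homogeneous_reparam assms(15) by simp
  ultimately show ?thesis using \<eta>_C1 r(1) ball \<Gamma>_C1 exact small by blast
qed

end
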